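(* Let $N>1$ be an integer, let $\Omega\subset\mathbb{R}^N$ be open and bounded, let $G\colon\mathbb{R}^N\to[0,+\infty)$ be of class $C^\infty$ with $\operatorname{supp}G=\overline{B^N_1(0)}$, $G(-x)=G(x)$ for all $x\in\mathbb{R}^N$, and $\int_{\mathbb{R}^N}G(x)\,dx=1$. Let $f\colon[0,+\infty)\to\mathbb{R}$ be continuous and non-decreasing with $f(0)=0$. Let $\mathscr{F}_\varepsilon$ and $\mathscr{F}$ be the functionals defined in the context. Let $D\subset\mathbb{R}^{N-1}$ be open and bounded with Lipschitz boundary, and let $u_h,u\in C^{1,1}(D)$ ($h\in\mathbb{N}$) with $u_h>0$ and $u>0$ on $D$, such that $u_h\to u$ uniformly in $C^1(D)$ (that is, $u_h\to u$ and $\nabla u_h\to\nabla u$ uniformly on $D$). Set $$E_h=\{(x,y)\in\mathbb{R}^{N-1}\times\mathbb{R}: x\in D,\ 0\le y\le u_h(x)\},$$ $$E=\{(x,y)\in\mathbb{R}^{N-1}\times\mathbb{R}: x\in D,\ 0\le y\le u(x)\}.$$ Then for every sequence $(\varepsilon_h)$ of positive numbers with $\varepsilon_h\to0$, $$\liminf_{h\to+\infty}\mathscr{F}_{\varepsilon_h}(E_h)\ge\mathscr{F}(E).$$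
   Context: $B^N_1(0)$ is the open unit ball of $\mathbb{R}^N$, $\mathbb{S}^{N-1}=\partial B^N_1(0)$, $E^c=\mathbb{R}^N\setminus E$, $\chi_A$ is the characteristic function of $A$, and $\mathcal{H}^{N-1}$ is the $(N-1)$-dimensional Hausdorff measure. $C^{1,1}(D)$ denotes the $C^1$ functions on $D$ with Lipschitz gradient. A measurable set $E\subseteq\mathbb{R}^N$ has finite perimeter in $\Omega$ if $\sup\{\int_E\operatorname{div}X\,dx: X\in C^1_c(\Omega;\mathbb{R}^N),\ \|X\|_\infty\le1\}<+\infty$. The family of such sets is denoted $\mathcal{P}_N(\Omega)$. The reduced boundary $\partial^*E$ is the set of points $x$ for which there is a unit vector $\nu_E(x)$ (the outer unit normal to $E$ at $x$) such that $\frac{x-E}{r}\to\{y\in\mathbb{R}^N: y\cdot\nu_E(x)\ge0\}$ in $L^1_{\rm loc}(\mathbb{R}^N)$ (i.e. characteristic functions converge) as $r\to0^+$. For $\varepsilon>0$ put $G_\varepsilon(x)=\varepsilon^{-N}G(x/\varepsilon)$ and $$\mathscr{F}_\varepsilon(E)=\frac1\varepsilon\int_{E^c\cap\Omega}f\big((G_\varepsilon*\chi_{E\cap\Omega})(x)\big)\,dx,\qquad E\in\mathcal{P}_N(\Omega).$$ Define $\theta\colon\mathbb{S}^{N-1}\to[0,+\infty)$ by $$\theta(\nu)=\int_0^1 f\left(\int_{\{x\cdot\nu\ge t\}}G(x)\,dx\right)dt,$$ and $$\mathscr{F}(E)=\int_{\partial^*E\cap\Omega}\theta(\nu_E(x))\,d\mathcal{H}^{N-1}(x),\qquad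 E\in\mathcal{P}_N(\Omega).$$ *)

theory Defs
  imports "HOL-Analysis.Analysis"
begin

section \<open>Hausdorff measure\<close>

text \<open>
  The contribution of a covering set \<open>A\<close> is \<open>\<omega>\<^sub>k (diam A / 2)^k\<close>, so that \<open>\<H>\<^sup>k\<close> agrees with
  \<open>k\<close>-dimensional surface area.  The empty set is treated apart only because of \<open>k = 0\<close>.
  \<^const>\<open>diameter\<close> is meaningful for bounded sets only, whence \<^const>\<open>bounded\<close> in the coverings.
\<close>

definition hausdorff_weight :: "nat \<Rightarrow> 'a::euclidean_space set \<Rightarrow> ennreal" where
  "hausdorff_weight k A =
     (if A = {} then 0 else ennreal (unit_ball_vol (real k) * (diameter A / 2) ^ k))"

definition hausdorff_pre :: "nat \<Rightarrow> real \<Rightarrow> 'a::euclidean_space set \<Rightarrow> ennreal" where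
  "hausdorff_pre k \<delta> A =
     (INF C \<in> {C :: nat \<Rightarrow> 'a set.
                 A \<subseteq> (\<Union>i. C i) \<and> (\<forall>i. bounded (C i) \<and> diameter (C i) \<le> \<delta>)}.
        \<Sum>i. hausdorff_weight k (C i))"

definition hausdorff_outer :: "nat \<Rightarrow> 'a::euclidean_space set \<Rightarrow> ennreal" where
  "hausdorff_outer k A = (SUP \<delta> \<in> {0<..}. hausdorff_pre k \<delta> A)"

text \<open>The measurable sets are the Caratheodory-measurable ones.\<close>

definition hausdorff_measure :: "nat \<Rightarrow> 'a::euclidean_space measure" where
  "hausdorff_measure k =
     measure_of UNIV (lambda_system UNIV UNIV (hausdorff_outer k)) (hausdorff_outer k)"

text \<open>
  \<^const>\<open>measure_of\<close> yields the zero measure unless its arguments form a measure space; the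
  following facts show that they do.
\<close>

lemma hausdorff_pre_empty:
  assumes "\<delta> > 0"
  shows "hausdorff_pre k \<delta> ({} :: 'a::euclidean_space set) = 0"
proof -
  have "hausdorff_pre k \<delta> ({} :: 'a set) \<le> (\<Sum>i::nat. hausdorff_weight k ({} :: 'a set))"
    unfolding hausdorff_pre_def
    by (rule INF_lower2[where i = "\<lambda>_. {}"]) (use assms in auto)
  then show ?thesis
    by (simp add: hausdorff_weight_def)
qed

lemma hausdorff_pre_mono: "A \<subseteq> B \<Longrightarrow> hausdorff_pre k \<delta> A \<le> hausdorff_pre k \<delta> B"
  unfolding hausdorff_pre_def by (rule INF_superset_mono) auto

lemma hausdorff_pre_subadditive:
  fixes A :: "nat \<Rightarrow> 'a::euclidean_space set"
  shows "hausdorff_pre k \<delta> (\<Union>i. A i) \<le> (\<Sum>i. hausdorff_pre k \<delta> (A i))"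
proof (rule ennreal_le_epsilon)
  fix e :: real
  assume e: "0 < e" and fin: "(\<Sum>i. hausdorff_pre k \<delta> (A i)) < top"
  have "\<exists>C. A i \<subseteq> (\<Union>j. C j) \<and> (\<forall>j. bounded (C j) \<and> diameter (C j) \<le> \<delta>) \<and>
          (\<Sum>j::nat. hausdorff_weight k (C j)) < hausdorff_pre k \<delta> (A i) + ennreal (e * (1/2) ^ Suc i)"
    for i
  proof -
    have "hausdorff_pre k \<delta> (A i) < top"
      using ennreal_suminf_lessD[OF fin] .
    then have "hausdorff_pre k \<delta> (A i) < hausdorff_pre k \<delta> (A i) + ennreal (e * (1/2) ^ Suc i)"
      using e ennreal_add_left_cancel_less[of "hausdorff_pre k \<delta> (A i)" 0 "ennreal (e * (1/2) ^ Suc i)"]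
      by (simp add: less_top)
    then show ?thesis
      unfolding hausdorff_pre_def INF_less_iff by blast
  qed
  then obtain C where C: "\<And>i. A i \<subseteq> (\<Union>j. C i j)"
      "\<And>i j. bounded (C i j)" "\<And>i j. diameter (C i j) \<le> \<delta>"
      "\<And>i. (\<Sum>j::nat. hausdorff_weight k (C i j)) < hausdorff_pre k \<delta> (A i) + ennreal (e * (1/2) ^ Suc i)"
    by metis
  define B where "B = case_prod C \<circ> prod_decode"
  have "(\<Union>i. A i) \<subseteq> (\<Union>n. B n)"
  proof
    fix x assume "x \<in> (\<Union>i. A i)"
    then obtain i j where "x \<in> C i j" using C(1) by blast
    then have "x \<in> B (prod_encode (i, j))" by (simp add: B_def)
    then show "x \<in> (\<Union>n. B n)" by blast
  qed
  then have "hausdorff_pre k \<delta> (\<Union>i. A i) \<le> (\<Sum>n. hausdorff_weight k (B n))"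
    unfolding hausdorff_pre_def
    by (intro INF_lower) (auto simp: B_def C(2,3) split: prod.split)
  also have "\<dots> = (\<Sum>i. \<Sum>j. hausdorff_weight k (C i j))"
    using suminf_ennreal_2dimen[of "\<lambda>i. \<Sum>j. hausdorff_weight k (C i j)"
        "\<lambda>(i, j). hausdorff_weight k (C i j)"]
    by (simp add: B_def o_def case_prod_beta)
  also have "\<dots> \<le> (\<Sum>i. hausdorff_pre k \<delta> (A i) + ennreal (e * (1/2) ^ Suc i))"
    by (intro suminf_le less_imp_le[OF C(4)]) auto
  also have "\<dots> = (\<Sum>i. hausdorff_pre k \<delta> (A i)) + (\<Sum>i. ennreal (e * (1/2) ^ Suc i))"
    by (rule suminf_add[symmetric]) auto
  also have "(\<Sum>i. ennreal (e * (1/2) ^ Suc i)) = ennreal e"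
    using sums_mult[OF power_half_series, of e] e by (intro suminf_ennreal_eq) auto
  finally show "hausdorff_pre k \<delta> (\<Union>i. A i) \<le> (\<Sum>i. hausdorff_pre k \<delta> (A i)) + ennreal e" .
qed

lemma outer_measure_space_hausdorff_outer:
  "outer_measure_space (UNIV :: 'a::euclidean_space set set) (hausdorff_outer k)"
  unfolding outer_measure_space_def
proof (intro conjI)
  show "positive (UNIV :: 'a set set) (hausdorff_outer k)"
    unfolding positive_def hausdorff_outer_def
    by (auto simp: hausdorff_pre_empty intro!: SUP_eqI)
  show "increasing (UNIV :: 'a set set) (hausdorff_outer k)"
    unfolding increasing_def hausdorff_outer_def
    by (auto intro!: SUP_mono' hausdorff_pre_mono)
  show "countably_subadditive (UNIV :: 'a set set) (hausdorff_outer k)"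
    unfolding countably_subadditive_def
  proof (intro allI impI)
    fix A :: "nat \<Rightarrow> 'a set"
    show "hausdorff_outer k (\<Union>i. A i) \<le> (\<Sum>i. hausdorff_outer k (A i))"
      unfolding hausdorff_outer_def[of k "\<Union>i. A i"]
    proof (rule SUP_least)
      fix \<delta> :: real assume "\<delta> \<in> {0<..}"
      then have "(\<Sum>i. hausdorff_pre k \<delta> (A i)) \<le> (\<Sum>i. hausdorff_outer k (A i))"
        unfolding hausdorff_outer_def by (intro suminf_le SUP_upper) auto
      with hausdorff_pre_subadditive[of k \<delta> A]
      show "hausdorff_pre k \<delta> (\<Union>i. A i) \<le> (\<Sum>i. hausdorff_outer k (A i))"
        by (rule order_trans)
    qed
  qed
qed

lemma measure_space_hausdorff:
  "measure_space (UNIV :: 'a::euclidean_space set)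
     (lambda_system UNIV UNIV (hausdorff_outer k)) (hausdorff_outer k)"
proof -
  interpret sigma_algebra "UNIV :: 'a set" UNIV
    using sigma_algebra_Pow[of "UNIV :: 'a set"] by simp
  show ?thesis
    by (rule caratheodory_lemma[OF outer_measure_space_hausdorff_outer])
qed

lemma sets_hausdorff_measure:
  "sets (hausdorff_measure k :: 'a::euclidean_space measure) =
     lambda_system UNIV UNIV (hausdorff_outer k)"
proof -
  have "sigma_algebra UNIV (lambda_system (UNIV :: 'a set) UNIV (hausdorff_outer k))"
    using measure_space_hausdorff[where 'a = 'a and k = k] by (simp add: measure_space_def)
  then show ?thesis
    unfolding hausdorff_measure_def by (rule sigma_algebra.sets_measure_of_eq)
qed

lemma emeasure_hausdorff_measure:
  fixes A :: "'a::euclidean_space set"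
  assumes "A \<in> sets (hausdorff_measure k)"
  shows "emeasure (hausdorff_measure k) A = hausdorff_outer k A"
proof (rule emeasure_measure_of[OF hausdorff_measure_def])
  show "positive (sets (hausdorff_measure k :: 'a measure)) (hausdorff_outer k)"
    and "countably_additive (sets (hausdorff_measure k :: 'a measure)) (hausdorff_outer k)"
    using measure_space_hausdorff[where 'a = 'a and k = k]
    by (simp_all add: measure_space_def sets_hausdorff_measure)
qed (use assms in simp_all)


section \<open>Regularity of functions and of domains\<close>

primrec C_k :: "nat \<Rightarrow> ('a::euclidean_space \<Rightarrow> real) \<Rightarrow> bool" where
  "C_k 0 g \<longleftrightarrow> continuous_on UNIV g"
| "C_k (Suc k) g \<longleftrightarrow> (\<forall>x. g differentiable (at x)) \<and>
     (\<forall>b\<in>Basis. C_k k (\<lambda>x. frechet_derivative g (at x) b))"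

definition smooth :: "('a::euclidean_space \<Rightarrow> real) \<Rightarrow> bool" where
  "smooth g \<longleftrightarrow> (\<forall>k. C_k k g)"

definition gradient :: "('a::euclidean_space \<Rightarrow> real) \<Rightarrow> 'a \<Rightarrow> 'a" where
  "gradient u x = (THE d. GDERIV u x :> d)"

definition C11_on :: "'a::euclidean_space set \<Rightarrow> ('a \<Rightarrow> real) \<Rightarrow> bool" where
  "C11_on D u \<longleftrightarrow> (\<forall>x\<in>D. u differentiable (at x)) \<and> continuous_on D (gradient u) \<and>
     (\<exists>L. L-lipschitz_on D (gradient u))"

text \<open>
  Near every boundary point, \<open>D\<close> is the region strictly above the graph, in some unit direction
  \<open>e\<close>, of a Lipschitz function \<open>\<gamma>\<close> on the hyperplane orthogonal to \<open>e\<close>.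
\<close>

definition lipschitz_boundary :: "'a::euclidean_space set \<Rightarrow> bool" where
  "lipschitz_boundary D \<longleftrightarrow>
     (\<forall>p \<in> frontier D. \<exists>r>0. \<exists>e \<gamma> L.
        norm e = 1 \<and> L-lipschitz_on {w. w \<bullet> e = 0} \<gamma> \<and>
        D \<inter> ball p r = {z \<in> ball p r. \<gamma> (z - (z \<bullet> e) *\<^sub>R e) < z \<bullet> e})"


section \<open>Reduced boundary\<close>

definition L1_loc_tendsto_at_0 :: "(real \<Rightarrow> 'a::euclidean_space set) \<Rightarrow> 'a set \<Rightarrow> bool" where
  "L1_loc_tendsto_at_0 A B \<longleftrightarrow>
     (\<forall>K. compact K \<longrightarrow>
        ((\<lambda>r. \<integral>\<^sup>+y\<in>K. ennreal \<bar>indicat_real (A r) y - indicat_real B y\<bar> \<partial>lebesgue) \<longlongrightarrow> 0)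
          (at_right 0))"

text \<open>The blow-ups are \<open>(x - E) / r\<close>, with reflection; this is why the half-space below is
  \<open>y \<bullet> \<nu> \<ge> 0\<close> although \<open>\<nu>\<close> points out of \<open>E\<close>.\<close>

definition is_outer_normal :: "'a::euclidean_space set \<Rightarrow> 'a \<Rightarrow> 'a \<Rightarrow> bool" where
  "is_outer_normal E x \<nu> \<longleftrightarrow> norm \<nu> = 1 \<and>
     L1_loc_tendsto_at_0 (\<lambda>r. (\<lambda>z. (x - z) /\<^sub>R r) ` E) {y. y \<bullet> \<nu> \<ge> 0}"

definition reduced_boundary :: "'a::euclidean_space set \<Rightarrow> 'a set" where
  "reduced_boundary E = {x. \<exists>\<nu>. is_outer_normal E x \<nu>}"

definition outer_normal :: "'a::euclidean_space set \<Rightarrow> 'a \<Rightarrow> 'a" where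
  "outer_normal E x = (THE \<nu>. is_outer_normal E x \<nu>)"


section \<open>The functionals\<close>

text \<open>
  The two functionals have values in \<^typ>\<open>ennreal\<close> and are given by their integral formulas for
  arbitrary sets, not just for sets of finite perimeter.  The function \<open>f\<close> is only ever evaluated
  at nonnegative arguments, where it is meant to be nonnegative, so that \<^const>\<open>ennreal\<close> does not
  truncate.
\<close>

definition rescaled :: "('a::euclidean_space \<Rightarrow> real) \<Rightarrow> real \<Rightarrow> 'a \<Rightarrow> real" where
  "rescaled G \<epsilon> x = G (x /\<^sub>R \<epsilon>) / \<epsilon> ^ DIM('a)"

definition convolution :: "('a::euclidean_space \<Rightarrow> real) \<Rightarrow> ('a \<Rightarrow> real) \<Rightarrow> 'a \<Rightarrow> real" where
  "convolution g h x = (LINT y|lebesgue. g (x - y) * h y)"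

definition F_eps ::
  "(real \<Rightarrow> real) \<Rightarrow> ('a::euclidean_space \<Rightarrow> real) \<Rightarrow> 'a set \<Rightarrow> real \<Rightarrow> 'a set \<Rightarrow> ennreal" where
  "F_eps f G \<Omega> \<epsilon> E =
     ennreal (1 / \<epsilon>) *
     (\<integral>\<^sup>+x\<in>(- E \<inter> \<Omega>). ennreal (f (convolution (rescaled G \<epsilon>) (indicat_real (E \<inter> \<Omega>)) x)) \<partial>lebesgue)"

definition theta :: "(real \<Rightarrow> real) \<Rightarrow> ('a::euclidean_space \<Rightarrow> real) \<Rightarrow> 'a \<Rightarrow> real" where
  "theta f G \<nu> = (LINT t:{0..1}|lebesgue. f (LINT x:{x. x \<bullet> \<nu> \<ge> t}|lebesgue. G x))"

definition F_lim ::
  "(real \<Rightarrow> real) \<Rightarrow> ('a::euclidean_space \<Rightarrow> real) \<Rightarrow> 'a set \<Rightarrow> 'a set \<Rightarrow> ennreal" where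
  "F_lim f G \<Omega> E =
     (\<integral>\<^sup>+x\<in>(reduced_boundary E \<inter> \<Omega>). ennreal (theta f G (outer_normal E x))
        \<partial>hausdorff_measure (DIM('a) - 1))"

definition subgraph :: "'a set \<Rightarrow> ('a \<Rightarrow> real) \<Rightarrow> ('a \<times> real) set" where
  "subgraph D u = {(x, y). x \<in> D \<and> 0 \<le> y \<and> y \<le> u x}"

end

theory Submission
  imports Defs
begin

text \<open>
  Near each point of its reduced boundary where this is a graph over a hyperplane, the limit set \<open>E\<close> is,
  after an isometry \<open>T\<close> of \<open>\<real>\<^sup>N\<close>, the region below a function \<open>g\<close>, and \<open>E\<^sub>h\<close> is the region
  below a function \<open>g\<^sub>h\<close>.  Put \<open>p\<^sub>h = T (w, g\<^sub>h w + \<epsilon>\<^sub>h s)\<close>.  The change of variables from \<open>x\<close> to \<open>(w, s)\<close>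
  cancels the factor \<open>1 / \<epsilon>\<^sub>h\<close>, and \<open>G\<^sub>\<epsilon> * \<chi>\<close> at \<open>p\<^sub>h\<close> converges to the mass of \<open>G\<close> on a half-space
  normal to \<open>T (- \<nabla>g w, 1)\<close>, because only difference quotients of \<open>g\<^sub>h\<close> at scale \<open>\<epsilon>\<^sub>h\<close> enter.  Fatou's lemma then
  bounds the liminf from below by the integral of \<open>\<theta>\<close> against \<open>\<surd>(1 + |\<nabla>g|\<^sup>2) dw\<close>.  It remains to know
  that this dominates the Hausdorff measure of the graph.  Only this inequality is needed, so Vitali coverings
  suffice and the isodiametric inequality does not enter.

  The boundary of the subgraph consists of the top (\<open>g = u\<close>), the bottom (\<open>g = 0\<close>) and the lateral part over
  \<open>\<partial>D\<close>, where \<open>g\<close> is merely Lipschitz.  Rademacher's theorem is avoided: at a point of the reduced boundary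
  the blow-up is a half-space, and for a Lipschitz graph this forces differentiability.
\<close>

subsection \<open>Hausdorff measure\<close>

text \<open>The pieces of the boundary must be added without counting any part of the outer integral
  twice, while Fatou's lemma works chart by chart. Hence every chart carries a weight; the weights
  sum to at most 1 everywhere and to 1 on the part of the reduced boundary that matters. Over
  \<open>D\<close> they are indicators of two disjoint open sets separated by the height u / 2. Off
  \<open>D\<close> they form a partition of unity near the frontier of \<open>D\<close> that is
  switched off inside \<open>D\<close>. This jump is harmless: a chart samples its weight only at
  points outside the limit set (s > 0), which for a lateral chart means outside the cylinder over
  \<open>D\<close>. The second obstacle is measurability, which is established neither for the
  reduced boundary nor for its normal. Every chart therefore supplies a Borel majorant built from
  its parametrisation, and integrals are split only after passing to these majorants. The edges
  where lateral and horizontal parts meet get no chart: they are Lipschitz images of the frontier of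
  \<open>D\<close>, a null set, and are negligible for the (N-1)-dimensional measure.\<close>

lemma hausdorff_outer_mono: "A \<subseteq> B \<Longrightarrow> hausdorff_outer k A \<le> hausdorff_outer k B"
  using outer_measure_space_hausdorff_outer[of k]
  by (auto simp: outer_measure_space_def increasing_def)

lemma hausdorff_outer_UN_le: "hausdorff_outer k (\<Union>i. A i) \<le> (\<Sum>i::nat. hausdorff_outer k (A i))"
  unfolding hausdorff_outer_def[of k "\<Union>i. A i"]
proof (rule SUP_least)
  fix \<delta> :: real assume "\<delta> \<in> {0<..}"
  then have "(\<Sum>i. hausdorff_pre k \<delta> (A i)) \<le> (\<Sum>i. hausdorff_outer k (A i))"
    unfolding hausdorff_outer_def by (intro suminf_le SUP_upper) auto
  with hausdorff_pre_subadditive[of k \<delta> A]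
  show "hausdorff_pre k \<delta> (\<Union>i. A i) \<le> (\<Sum>i. hausdorff_outer k (A i))"
    by (rule order_trans)
qed

lemma hausdorff_outer_empty [simp]: "hausdorff_outer k {} = 0"
  using outer_measure_space_hausdorff_outer[of k]
  by (auto simp: outer_measure_space_def positive_def)

lemma suminf_pair:
  fixes f :: "nat \<Rightarrow> ennreal"
  assumes "\<And>n. n \<ge> 2 \<Longrightarrow> f n = 0"
  shows "suminf f = f 0 + f 1"
proof -
  have "suminf f = sum f {..<2}"
    by (rule suminf_finite) (use assms in auto)
  then show ?thesis by (simp add: numeral_2_eq_2)
qed

lemma hausdorff_outer_Un_le: "hausdorff_outer k (A \<union> B) \<le> hausdorff_outer k A + hausdorff_outer k B"
proof -
  define C where "C = (\<lambda>i::nat. if i = 0 then A else if i = 1 then B else {})"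
  have "A \<union> B \<subseteq> (\<Union>i. C i)" by (auto simp: C_def split: if_splits)
  then have "hausdorff_outer k (A \<union> B) \<le> hausdorff_outer k (\<Union>i. C i)"
    by (rule hausdorff_outer_mono)
  also have "\<dots> \<le> (\<Sum>i. hausdorff_outer k (C i))" by (rule hausdorff_outer_UN_le)
  also have "\<dots> = hausdorff_outer k A + hausdorff_outer k B"
    by (subst suminf_pair) (auto simp: C_def)
  finally show ?thesis .
qed

lemma hausdorff_pre_antimono: "\<delta> \<le> \<delta>' \<Longrightarrow> hausdorff_pre k \<delta>' A \<le> hausdorff_pre k \<delta> A"
  unfolding hausdorff_pre_def by (rule INF_superset_mono) (auto intro: order_trans)

text \<open>Once \<delta> < d, a set of diameter at most \<delta> cannot meet both \<open>A\<close>
  and \<open>B\<close>, so every admissible cover of the union splits into a cover of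
  \<open>A\<close> and a cover of \<open>B\<close>.\<close>

lemma hausdorff_outer_separated:
  assumes "d > 0" and sep: "\<And>x y. x \<in> A \<Longrightarrow> y \<in> B \<Longrightarrow> d \<le> dist x y"
  shows "hausdorff_outer k A + hausdorff_outer k B \<le> hausdorff_outer k (A \<union> B)"
proof -
  have *: "hausdorff_pre k \<delta> A + hausdorff_pre k \<delta> B \<le> hausdorff_pre k \<delta> (A \<union> B)"
    if \<delta>: "0 < \<delta>" "\<delta> < d" for \<delta>
    unfolding hausdorff_pre_def[of _ _ "A \<union> B"]
  proof (rule INF_greatest)
    fix C :: "nat \<Rightarrow> 'a set"
    assume "C \<in> {C. A \<union> B \<subseteq> (\<Union>i. C i) \<and> (\<forall>i. bounded (C i) \<and> diameter (C i) \<le> \<delta>)}"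
    then have cov: "A \<subseteq> (\<Union>i. C i)" "B \<subseteq> (\<Union>i. C i)"
      and bd: "\<And>i. bounded (C i)" "\<And>i. diameter (C i) \<le> \<delta>" by auto
    \<comment> \<open>Discarded sets are replaced by the empty set, which has weight 0, so both
      families stay indexed by nat and their weights add up to those of \<open>C\<close>.\<close>
    define P where "P i = (if C i \<inter> A = {} then {} else C i)" for i
    define Q where "Q i = (if C i \<inter> A = {} then C i else {})" for i
    have "A \<subseteq> (\<Union>i. P i)" using cov(1) by (fastforce simp: P_def)
    moreover have "B \<subseteq> (\<Union>i. Q i)"
    proof
      fix x assume x: "x \<in> B"
      then obtain i where i: "x \<in> C i" using cov by auto
      have "C i \<inter> A = {}"
      proof (rule ccontr)
        assume "C i \<inter> A \<noteq> {}"
        then obtain y where "y \<in> C i" "y \<in> A" by auto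
        then show False
          using diameter_bounded_bound[OF bd(1)[of i], of y x] i sep[of y x] x bd(2)[of i] \<delta> by auto
      qed
      then show "x \<in> (\<Union>i. Q i)" using i by (auto simp: Q_def)
    qed
    ultimately have "hausdorff_pre k \<delta> A + hausdorff_pre k \<delta> B
        \<le> (\<Sum>i. hausdorff_weight k (P i)) + (\<Sum>i. hausdorff_weight k (Q i))"
      unfolding hausdorff_pre_def
      by (intro add_mono INF_lower) (use bd \<delta> in \<open>auto simp: P_def Q_def\<close>)
    also have "\<dots> = (\<Sum>i. hausdorff_weight k (P i) + hausdorff_weight k (Q i))"
      by (rule suminf_add) auto
    also have "\<dots> = (\<Sum>i. hausdorff_weight k (C i))"
      by (rule suminf_cong) (auto simp: P_def Q_def hausdorff_weight_def)
    finally show "hausdorff_pre k \<delta> A + hausdorff_pre k \<delta> B \<le> (\<Sum>i. hausdorff_weight k (C i))" .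
  qed
  have "hausdorff_outer k A + hausdorff_outer k B
      = (SUP \<delta>\<in>{0<..}. hausdorff_pre k \<delta> A + hausdorff_pre k \<delta> B)"
    unfolding hausdorff_outer_def
  proof (rule SUP_add_directed_ennreal[symmetric])
    fix i j :: real assume "i \<in> {0<..}" "j \<in> {0<..}"
    then show "\<exists>l\<in>{0<..}. hausdorff_pre k i A + hausdorff_pre k j B
        \<le> hausdorff_pre k l A + hausdorff_pre k l B"
      by (intro bexI[of _ "min i j"] add_mono hausdorff_pre_antimono) auto
  qed
  also have "\<dots> \<le> hausdorff_outer k (A \<union> B)"
  proof (rule SUP_least)
    fix \<delta> :: real assume "\<delta> \<in> {0<..}"
    define \<eta> where "\<eta> = min \<delta> (d / 2)"
    have \<eta>: "0 < \<eta>" "\<eta> < d" "\<eta> \<le> \<delta>" using \<open>\<delta> \<in> _\<close> \<open>d > 0\<close> by (auto simp: \<eta>_def)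
    have "hausdorff_pre k \<delta> A + hausdorff_pre k \<delta> B \<le> hausdorff_pre k \<eta> A + hausdorff_pre k \<eta> B"
      by (intro add_mono hausdorff_pre_antimono \<eta>)
    also have "\<dots> \<le> hausdorff_pre k \<eta> (A \<union> B)" by (rule *[OF \<eta>(1,2)])
    also have "\<dots> \<le> hausdorff_outer k (A \<union> B)"
      unfolding hausdorff_outer_def by (rule SUP_upper) (use \<eta> in auto)
    finally show "hausdorff_pre k \<delta> A + hausdorff_pre k \<delta> B \<le> hausdorff_outer k (A \<union> B)" .
  qed
  finally show ?thesis .
qed

lemma hausdorff_outer_sum_separated:
  assumes "\<And>i j. i < j \<Longrightarrow> \<exists>d>0. \<forall>x\<in>R i. \<forall>y\<in>R j. d \<le> dist x y"
  shows "(\<Sum>i<N. hausdorff_outer k (R i)) \<le> hausdorff_outer k (\<Union>i<(N::nat). R i)"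
proof (induction N)
  case (Suc N)
  obtain d where d: "\<And>i. i < N \<Longrightarrow> d i > 0 \<and> (\<forall>x\<in>R i. \<forall>y\<in>R N. d i \<le> dist x y)"
    using assms[of _ N] by metis
  \<comment> \<open>Inserting 1 keeps the set nonempty when N = 0.\<close>
  define e where "e = Min (insert 1 (d ` {..<N}))"
  have e: "e > 0" unfolding e_def using d by (subst Min_gr_iff) auto
  have e_le: "e \<le> d i" if "i < N" for i
    unfolding e_def using that by (intro Min_le) auto
  have "(\<Sum>i<Suc N. hausdorff_outer k (R i))
      \<le> hausdorff_outer k (\<Union>i<N. R i) + hausdorff_outer k (R N)"
    using Suc by (auto intro: add_mono)
  also have "\<dots> \<le> hausdorff_outer k ((\<Union>i<N. R i) \<union> R N)"
    by (rule hausdorff_outer_separated[OF e]) (use d e_le in \<open>force intro: order_trans\<close>)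
  also have "(\<Union>i<N. R i) \<union> R N = (\<Union>i<Suc N. R i)" by (auto simp: less_Suc_eq)
  finally show ?case .
qed simp

text \<open>Caratheodory's argument for metric outer measures. The part of \<open>X\<close> at
  distance at least 1/(n+1) from \<open>F\<close> is separated from \<open>F\<close>. What is left
  near \<open>F\<close> is a union of thin shells, whose measures form a convergent series because
  shells of equal parity are separated from each other.\<close>

lemma closed_in_sets_hausdorff:
  assumes "closed F"
  shows "F \<in> sets (hausdorff_measure k)"
proof -
  let ?H = "hausdorff_outer k"
  interpret algebra "UNIV :: 'a set" UNIV
    using sigma_algebra_Pow[of "UNIV :: 'a set"] by (simp add: sigma_algebra_def)
  have "?H (X \<inter> F) + ?H (X - F) \<le> ?H X" for X
  \<comment> \<open>\<open>infdist\<close> to the empty set is 0 by convention, so that case is set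
    apart. If \<open>X\<close> has infinite outer measure the inequality is trivial, and the series
    of shells below could diverge.\<close>
  proof (cases "F = {} \<or> ?H X = top")
    case True
    then show ?thesis by auto
  next
    case False
    then have F: "F \<noteq> {}" and fin: "?H X < top" by (auto simp: less_top)
    define A where "A n = {x \<in> X - F. infdist x F \<ge> 1 / real (Suc n)}" for n
    define R where "R n = A (Suc n) - A n" for n
    have XA: "\<exists>n. x \<in> A n" if "x \<in> X - F" for x
    proof -
      have "infdist x F > 0" using infdist_pos_not_in_closed[OF assms F] that by auto
      then obtain n where "inverse (real (Suc n)) < infdist x F" using reals_Archimedean by blast
      then have "x \<in> A n" using that by (auto simp: A_def inverse_eq_divide)
      then show ?thesis by blast
    qed
    have sepF: "?H (X \<inter> F) + ?H (A n) \<le> ?H X" for n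
    proof -
      have "?H (X \<inter> F) + ?H (A n) \<le> ?H (X \<inter> F \<union> A n)"
      proof (rule hausdorff_outer_separated)
        show "1 / real (Suc n) \<le> dist x y" if "x \<in> X \<inter> F" "y \<in> A n" for x y
          using that infdist_le[of x F y] by (auto simp: A_def dist_commute)
      qed simp
      also have "\<dots> \<le> ?H X" by (rule hausdorff_outer_mono) (auto simp: A_def)
      finally show ?thesis .
    qed
    have R: "1 / real (Suc (Suc n)) \<le> infdist x F \<and> infdist x F < 1 / real (Suc n)" if "x \<in> R n" for x n
      using that by (auto simp: R_def A_def)
    have sepR: "\<exists>d>0. \<forall>x\<in>R n. \<forall>y\<in>R m. d \<le> dist x y" if "Suc n < m" for n m
    proof (intro exI conjI ballI)
      let ?d = "1 / real (Suc (Suc n)) - 1 / real (Suc m)"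
      show "?d > 0" using that by (simp add: divide_strict_left_mono)
      fix x y assume "x \<in> R n" "y \<in> R m"
      then show "?d \<le> dist x y"
        using R[of x n] R[of y m] infdist_triangle_abs[of x F y] by linarith
    qed
    have par: "(\<Sum>i<N. ?H (R (2 * i + c))) \<le> ?H X" for N c
    proof -
      have "(\<Sum>i<N. ?H (R (2 * i + c))) \<le> ?H (\<Union>i<N. R (2 * i + c))"
        by (rule hausdorff_outer_sum_separated) (rule sepR, simp)
      also have "\<dots> \<le> ?H X" by (rule hausdorff_outer_mono) (auto simp: R_def A_def)
      finally show ?thesis .
    qed
    have split2: "(\<Sum>i<2 * N. ?H (R i)) = (\<Sum>i<N. ?H (R (2 * i + 0))) + (\<Sum>i<N. ?H (R (2 * i + 1)))" for N
      by (induction N) (auto simp: algebra_simps)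
    have "(\<Sum>i. ?H (R i)) \<le> 2 * ?H X"
    proof (rule suminf_le_const)
      fix N
      have "(\<Sum>i<N. ?H (R i)) \<le> (\<Sum>i<2 * N. ?H (R i))"
        by (rule sum_mono2) auto
      also have "\<dots> \<le> ?H X + ?H X"
        unfolding split2 by (intro add_mono par)
      finally show "(\<Sum>i<N. ?H (R i)) \<le> 2 * ?H X" by (simp add: mult_2)
    qed simp
    also have "\<dots> < top" using fin by (simp add: ennreal_mult_less_top)
    finally have sumfin: "(\<Sum>i. ?H (R i)) < top" .
    define r where "r i = enn2real (?H (R i))" for i
    have r: "?H (R i) = ennreal (r i)" "0 \<le> r i" for i
      using ennreal_suminf_lessD[OF sumfin, of i] by (auto simp: r_def)
    have sr: "summable r"
      by (rule summable_suminf_not_top) (use r sumfin in auto)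
    have tail: "(\<Sum>i. ?H (R (i + n))) = ennreal (\<Sum>i. r (i + n))" for n
      using sr by (simp add: r suminf_ennreal2 summable_ignore_initial_segment)
    have bound: "?H (X \<inter> F) + ?H (X - F) \<le> ?H X + ennreal (\<Sum>i. r (i + n))" for n
    proof -
      have "X - F \<subseteq> A n \<union> (\<Union>i. R (i + n))"
      proof
        fix x assume x: "x \<in> X - F"
        show "x \<in> A n \<union> (\<Union>i. R (i + n))"
        proof (cases "x \<in> A n")
          case False
          define m where "m = (LEAST m. x \<in> A m)"
          have m: "x \<in> A m" unfolding m_def using XA[OF x] by (rule LeastI_ex)
          have mono: "A i \<subseteq> A j" if "i \<le> j" for i j
          proof -
            have "1 / real (Suc j) \<le> 1 / real (Suc i)" using that by (simp add: field_simps)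
            then show ?thesis by (auto simp: A_def)
          qed
          have "m > n" using False m mono[of m n] by (meson in_mono leI)
          then have "x \<notin> A (m - 1)" using not_less_Least[of "m - 1" "\<lambda>m. x \<in> A m"] by (auto simp: m_def)
          then have "x \<in> R (m - 1 - n + n)" using m \<open>m > n\<close> by (auto simp: R_def)
          then show ?thesis by blast
        qed simp
      qed
      then have "?H (X - F) \<le> ?H (A n \<union> (\<Union>i. R (i + n)))" by (rule hausdorff_outer_mono)
      also have "\<dots> \<le> ?H (A n) + ?H (\<Union>i. R (i + n))" by (rule hausdorff_outer_Un_le)
      also have "\<dots> \<le> ?H (A n) + (\<Sum>i. ?H (R (i + n)))"
        by (intro add_mono hausdorff_outer_UN_le order_refl)
      finally have "?H (X \<inter> F) + ?H (X - F) \<le> (?H (X \<inter> F) + ?H (A n)) + (\<Sum>i. ?H (R (i + n)))"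
        by (simp add: add.assoc add_left_mono)
      also have "\<dots> \<le> ?H X + (\<Sum>i. ?H (R (i + n)))" by (intro add_mono sepF order_refl)
      finally show ?thesis by (simp add: tail)
    qed
    have "(\<lambda>n. ?H X + ennreal (\<Sum>i. r (i + n))) \<longlonglongrightarrow> ?H X + ennreal 0"
      by (intro tendsto_add tendsto_const tendsto_ennrealI suminf_exist_split2 sr)
    then show ?thesis
      using bound by (intro LIMSEQ_le_const[of _ "?H X"]) auto
  qed
  moreover have "?H X \<le> ?H (X \<inter> F) + ?H (X - F)" for X
    using hausdorff_outer_Un_le[of k "X \<inter> F" "X - F"] by (simp add: Int_Diff_Un)
  ultimately show ?thesis
    unfolding sets_hausdorff_measure lambda_system_eq by (auto intro: antisym)
qed

lemma space_hausdorff_measure [simp]: "space (hausdorff_measure k) = UNIV"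
  using closed_in_sets_hausdorff[of UNIV k] sets.sets_into_space[of UNIV "hausdorff_measure k"] by auto

lemma borel_subset_sets_hausdorff: "sets borel \<subseteq> sets (hausdorff_measure k)"
proof -
  have "sigma_sets UNIV (Collect closed) \<subseteq> sets (hausdorff_measure k)"
    using sets.sigma_sets_subset[of "Collect closed" "hausdorff_measure k"] closed_in_sets_hausdorff by auto
  then show ?thesis by (simp add: borel_eq_closed)
qed

lemma borel_measurable_hausdorff:
  "f \<in> measurable borel M \<Longrightarrow> f \<in> measurable (hausdorff_measure k) M"
  using borel_subset_sets_hausdorff[of k] by (auto simp: measurable_def)

lemma emeasure_hausdorff_borel: "A \<in> sets borel \<Longrightarrow> emeasure (hausdorff_measure k) A = hausdorff_outer k A"
  using borel_subset_sets_hausdorff by (intro emeasure_hausdorff_measure) auto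

section \<open>Lipschitz images and comparison with Lebesgue measure in full dimension\<close>

lemma hausdorff_outer_lipschitz_image:
  fixes f :: "'a::euclidean_space \<Rightarrow> 'b::euclidean_space"
  assumes lip: "C-lipschitz_on A f" and "C > 0"
  shows "hausdorff_outer k (f ` A) \<le> ennreal (C ^ k) * hausdorff_outer k A"
  unfolding hausdorff_outer_def[of k "f ` A"]
proof (rule SUP_least)
  fix \<delta> :: real assume "\<delta> \<in> {0<..}"
  then have \<delta>: "\<delta> / C > 0" "\<delta> > 0" using \<open>C > 0\<close> by auto
  \<comment> \<open>A cover of \<open>A\<close> at scale \<delta> / C is carried by \<open>f\<close>
    to a cover of the image at scale \<delta>. The factor C^k stands on the left as its inverse so
    that the right side is a bare infimum over covers.\<close>
  have "ennreal (inverse (C ^ k)) * hausdorff_pre k \<delta> (f ` A) \<le> hausdorff_pre k (\<delta> / C) A"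
    unfolding hausdorff_pre_def[of _ _ A]
  proof (rule INF_greatest)
    fix D :: "nat \<Rightarrow> 'a set"
    assume "D \<in> {D. A \<subseteq> (\<Union>i. D i) \<and> (\<forall>i. bounded (D i) \<and> diameter (D i) \<le> \<delta> / C)}"
    then have cov: "A \<subseteq> (\<Union>i. D i)" and bd: "\<And>i. bounded (D i)" "\<And>i. diameter (D i) \<le> \<delta> / C" by auto
    have dist: "dist x y \<le> C * diameter (D i)" if xy: "x \<in> f ` (D i \<inter> A)" "y \<in> f ` (D i \<inter> A)" for x y i
    proof -
      obtain u v where "u \<in> D i" "u \<in> A" "x = f u" "v \<in> D i" "v \<in> A" "y = f v" using xy by blast
      then show ?thesis
        using lipschitz_onD[OF lip, of u v] diameter_bounded_bound[OF bd(1), of u i v] \<open>C > 0\<close>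
        by (smt (verit) mult_left_mono)
    qed
    have diam: "diameter (f ` (D i \<inter> A)) \<le> C * diameter (D i)" for i
      by (rule diameter_le) (use dist \<open>C > 0\<close> diameter_ge_0[OF bd(1)] in \<open>auto simp: dist_norm\<close>)
    have bd': "bounded (f ` (D i \<inter> A))" for i
      by (rule bounded_two_points[THEN iffD2]) (use dist in blast)
    have "hausdorff_pre k \<delta> (f ` A) \<le> (\<Sum>i. hausdorff_weight k (f ` (D i \<inter> A)))"
      unfolding hausdorff_pre_def
    proof (rule INF_lower, safe)
      fix i show "diameter (f ` (D i \<inter> A)) \<le> \<delta>"
        using diam[of i] bd(2)[of i] \<open>C > 0\<close> by (simp add: field_simps)
    next
      fix x assume "x \<in> A"
      then show "f x \<in> (\<Union>i. f ` (D i \<inter> A))" using cov by blast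
    qed (use bd' in auto)
    also have "\<dots> \<le> (\<Sum>i. ennreal (C ^ k) * hausdorff_weight k (D i))"
    proof (rule suminf_le)
      fix i
      have "diameter (f ` (D i \<inter> A)) ^ k \<le> C ^ k * diameter (D i) ^ k"
        unfolding power_mult_distrib[symmetric]
        by (rule power_mono[OF diam diameter_ge_0[OF bd']])
      then have "unit_ball_vol (real k) * (diameter (f ` (D i \<inter> A)) / 2) ^ k
          \<le> C ^ k * (unit_ball_vol (real k) * (diameter (D i) / 2) ^ k)"
        by (simp add: power_divide field_simps mult_left_mono)
      then show "hausdorff_weight k (f ` (D i \<inter> A)) \<le> ennreal (C ^ k) * hausdorff_weight k (D i)"
        unfolding hausdorff_weight_def using \<open>C > 0\<close> diameter_ge_0[OF bd(1)]
        by (auto simp: ennreal_mult[symmetric] intro!: ennreal_leI)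
    qed auto
    finally have "ennreal (inverse (C ^ k)) * hausdorff_pre k \<delta> (f ` A)
      \<le> ennreal (inverse (C ^ k)) * (ennreal (C ^ k) * (\<Sum>i. hausdorff_weight k (D i)))"
      by (simp add: mult_left_mono)
    also have "\<dots> = (\<Sum>i. hausdorff_weight k (D i))"
      using \<open>C > 0\<close> by (simp add: mult.assoc[symmetric] ennreal_mult[symmetric])
    finally show "ennreal (inverse (C ^ k)) * hausdorff_pre k \<delta> (f ` A) \<le> (\<Sum>i. hausdorff_weight k (D i))" .
  qed
  also have "\<dots> \<le> hausdorff_outer k A"
    unfolding hausdorff_outer_def by (rule SUP_upper) (use \<delta> in auto)
  finally have "ennreal (C ^ k) * (ennreal (inverse (C ^ k)) * hausdorff_pre k \<delta> (f ` A))
    \<le> ennreal (C ^ k) * hausdorff_outer k A" by (simp add: mult_left_mono)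
  then show "hausdorff_pre k \<delta> (f ` A) \<le> ennreal (C ^ k) * hausdorff_outer k A"
    using \<open>C > 0\<close> by (simp add: mult.assoc[symmetric] ennreal_mult[symmetric])
qed

text \<open>The Vitali covering theorems return a countable family over an arbitrary index type,
  whereas \<open>hausdorff_pre\<close> asks for sequences; numbers outside the range of the
  enumeration get the empty set.\<close>

lemma hausdorff_pre_le_countable:
  assumes C: "countable C" and cov: "A \<subseteq> (\<Union>i\<in>C. B i)"
    and bd: "\<And>i. i \<in> C \<Longrightarrow> bounded (B i)" "\<And>i. i \<in> C \<Longrightarrow> diameter (B i) \<le> \<delta>" and "\<delta> > 0"
  shows "hausdorff_pre k \<delta> A \<le> (\<integral>\<^sup>+i. hausdorff_weight k (B i) \<partial>count_space C)"
proof -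
  define D where "D n = (if n \<in> to_nat_on C ` C then B (from_nat_into C n) else {})" for n
  have fn: "from_nat_into C n \<in> C" if "n \<in> to_nat_on C ` C" for n
    using that C by auto
  have "hausdorff_pre k \<delta> A \<le> (\<Sum>n. hausdorff_weight k (D n))"
    unfolding hausdorff_pre_def
  proof (rule INF_lower, safe)
    fix x assume "x \<in> A"
    then obtain i where "i \<in> C" "x \<in> B i" using cov by auto
    then have "x \<in> D (to_nat_on C i)" using C by (auto simp: D_def)
    then show "x \<in> (\<Union>n. D n)" by blast
  qed (use bd \<open>\<delta> > 0\<close> fn in \<open>auto simp: D_def\<close>)
  also have "\<dots> = (\<integral>\<^sup>+n. hausdorff_weight k (D n) \<partial>count_space UNIV)"
    by (rule nn_integral_count_space_nat[symmetric])
  also have "\<dots> = (\<integral>\<^sup>+n. hausdorff_weight k (D n) \<partial>count_space (to_nat_on C ` C))"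
    by (rule nn_integral_count_space_eq) (auto simp: D_def hausdorff_weight_def)
  also have "\<dots> = (\<integral>\<^sup>+i. hausdorff_weight k (D (to_nat_on C i)) \<partial>count_space C)"
    by (rule nn_integral_bij_count_space[symmetric]) (use C in \<open>simp add: bij_betw_def inj_on_to_nat_on\<close>)
  also have "\<dots> = (\<integral>\<^sup>+i. hausdorff_weight k (B i) \<partial>count_space C)"
    by (rule nn_integral_cong) (use C in \<open>auto simp: D_def\<close>)
  finally show ?thesis .
qed

lemma hausdorff_weight_cball:
  "r \<ge> 0 \<Longrightarrow> hausdorff_weight DIM('a) (cball (x::'a::euclidean_space) r) = emeasure lborel (cball x r)"
  by (simp add: hausdorff_weight_def emeasure_cball)

lemma hausdorff_pre_Un_le: "hausdorff_pre k \<delta> (A \<union> B) \<le> hausdorff_pre k \<delta> A + hausdorff_pre k \<delta> B"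
  if "\<delta> > 0"
proof -
  define C where "C = (\<lambda>i::nat. if i = 0 then A else if i = 1 then B else {})"
  have "A \<union> B \<subseteq> (\<Union>i. C i)" by (auto simp: C_def split: if_splits)
  then have "hausdorff_pre k \<delta> (A \<union> B) \<le> hausdorff_pre k \<delta> (\<Union>i. C i)"
    by (rule hausdorff_pre_mono)
  also have "\<dots> \<le> (\<Sum>i. hausdorff_pre k \<delta> (C i))" by (rule hausdorff_pre_subadditive)
  also have "\<dots> = hausdorff_pre k \<delta> A + hausdorff_pre k \<delta> B"
    by (subst suminf_pair) (auto simp: C_def hausdorff_pre_empty that)
  finally show ?thesis .
qed

text \<open>An open set \<open>T\<close> of tiny volume contains disjoint balls around points of
  \<open>N\<close> whose fivefold enlargements cover \<open>N\<close>; the enlargement multiplies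
  the total weight by 5^n only.\<close>

lemma hausdorff_pre_negligible:
  fixes N :: "'a::euclidean_space set"
  assumes N: "negligible N" and "\<delta> > 0"
  shows "hausdorff_pre DIM('a) \<delta> N = 0"
proof -
  have "hausdorff_pre DIM('a) \<delta> N \<le> 0 + ennreal e" if "e > 0" for e :: real
  proof -
    define n where "n = DIM('a)"
    have "N \<in> sets lebesgue" using N by (simp add: negligible_imp_sets)
    moreover have "e / 5 ^ n > 0" using that by simp
    ultimately obtain T where T: "open T" "N \<subseteq> T" "emeasure lebesgue (T - N) < ennreal (e / 5 ^ n)"
      using sets_lebesgue_outer_open by metis
    have "emeasure lebesgue (T - N) = emeasure lebesgue T"
      by (rule emeasure_Diff_null_set) (use N T in \<open>auto simp: negligible_iff_null_sets\<close>)
    with T have eT: "emeasure lborel T < ennreal (e / 5 ^ n)" by simp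
    \<comment> \<open>The bound \<delta> / 10 gives the fivefold ball a diameter of at most
      \<delta>.\<close>
    have "\<exists>r>0. cball x r \<subseteq> T \<and> r \<le> \<delta> / 10" if x: "x \<in> N" for x
    proof -
      obtain r where "r > 0" "cball x r \<subseteq> T" using T x open_contains_cball by blast
      then show ?thesis
        using \<open>\<delta> > 0\<close> by (intro exI[of _ "min r (\<delta> / 10)"]) (auto simp: subset_eq)
    qed
    then obtain r where r: "\<And>x. x \<in> N \<Longrightarrow> r x > 0 \<and> cball x (r x) \<subseteq> T \<and> r x \<le> \<delta> / 10" by metis
    have cov: "N \<subseteq> (\<Union>i\<in>N. cball i (r i))"
    proof
      fix x assume "x \<in> N"
      then show "x \<in> (\<Union>i\<in>N. cball i (r i))" using r[of x] by (intro UN_I[of x]) auto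
    qed
    have r': "0 < r i \<and> r i \<le> \<delta> / 10" if "i \<in> N" for i using r[OF that] by blast
    obtain C where C: "countable C" "C \<subseteq> N"
      "pairwise (\<lambda>i j. disjnt (cball i (r i)) (cball j (r j))) C"
      "N \<subseteq> (\<Union>i\<in>C. cball i (5 * r i))"
      by (rule Vitali_covering_lemma_cballs[OF cov r'])
    have rC: "r i > 0" "r i \<le> \<delta> / 10" "cball i (r i) \<subseteq> T" if "i \<in> C" for i
      using r[of i] C(2) that by auto
    have "hausdorff_pre n \<delta> N \<le> (\<integral>\<^sup>+i. hausdorff_weight n (cball i (5 * r i)) \<partial>count_space C)"
    proof (rule hausdorff_pre_le_countable[OF C(1) C(4) _ _ \<open>\<delta> > 0\<close>])
      fix i assume "i \<in> C"
      then have "r i > 0" "r i \<le> \<delta> / 10" using rC by auto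
      then show "diameter (cball i (5 * r i)) \<le> \<delta>" by simp
    qed auto
    also have "\<dots> = (\<integral>\<^sup>+i. ennreal (5 ^ n) * emeasure lborel (cball i (r i)) \<partial>count_space C)"
    proof (rule nn_integral_cong)
      fix i assume "i \<in> space (count_space C)"
      then have "r i > 0" using rC by auto
      then show "hausdorff_weight n (cball i (5 * r i)) = ennreal (5 ^ n) * emeasure lborel (cball i (r i))"
        unfolding n_def by (simp add: hausdorff_weight_cball emeasure_cball ennreal_mult[symmetric] power_mult_distrib mult_ac)
    qed
    also have "\<dots> = ennreal (5 ^ n) * emeasure lborel (\<Union>i\<in>C. cball i (r i))"
      by (subst emeasure_UN_countable)
         (use C in \<open>auto simp: nn_integral_cmult disjoint_family_on_def pairwise_def disjnt_def\<close>)
    also have "\<dots> \<le> ennreal (5 ^ n) * emeasure lborel T"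
      by (intro mult_left_mono emeasure_mono UN_least rC(3)) (use T in auto)
    also have "\<dots> \<le> ennreal (5 ^ n) * ennreal (e / 5 ^ n)"
      by (intro mult_left_mono less_imp_le eT) simp
    also have "\<dots> = ennreal e" using that by (simp add: ennreal_mult[symmetric])
    finally show ?thesis by (simp add: n_def)
  qed
  then have "hausdorff_pre DIM('a) \<delta> N \<le> 0" by (rule ennreal_le_epsilon)
  then show ?thesis by simp
qed

lemma hausdorff_outer_negligible:
  fixes N :: "'a::euclidean_space set"
  assumes "negligible N"
  shows "hausdorff_outer DIM('a) N = 0"
  unfolding hausdorff_outer_def by (auto simp: hausdorff_pre_negligible assms intro!: SUP_eqI)

text \<open>The Vitali theorem fills an open superset of \<open>A\<close> by disjoint small balls up
  to a null set. For balls the weight is the volume, and the null set is absorbed by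
  \<open>hausdorff_pre_negligible\<close>.\<close>

lemma hausdorff_outer_le_lborel:
  fixes A :: "'a::euclidean_space set"
  assumes A: "A \<in> sets borel"
  shows "hausdorff_outer DIM('a) A \<le> emeasure lborel A"
  unfolding hausdorff_outer_def
proof (rule SUP_least, rule ennreal_le_epsilon)
  fix \<delta> e :: real assume "\<delta> \<in> {0<..}" and "0 < e"
  then have \<delta>: "\<delta> > 0" by simp
  obtain U where U: "open U" "A \<subseteq> U" "emeasure lborel (U - A) \<le> e"
    using outer_regular_lborel_le[OF A \<open>0 < e\<close>] .
  have "emeasure lborel U = emeasure lborel (A \<union> (U - A))"
    using U by (intro arg_cong[of _ _ "emeasure lborel"]) auto
  also have "\<dots> \<le> emeasure lborel A + emeasure lborel (U - A)"
    using A U by (intro emeasure_subadditive) auto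
  also have "\<dots> \<le> emeasure lborel A + e" by (intro add_left_mono U)
  finally have eU: "emeasure lborel U \<le> emeasure lborel A + e" .
  define K where "K = {(x, r). cball x r \<subseteq> U \<and> 0 < r \<and> r \<le> \<delta> / 2}"
  have K0: "0 < snd i" if "i \<in> K" for i using that by (auto simp: K_def)
  have fine: "\<exists>i. i \<in> K \<and> x \<in> cball (fst i) (snd i) \<and> snd i < d" if xd: "x \<in> U" "0 < d" for x d
  proof -
    obtain r where "r > 0" "cball x r \<subseteq> U" using U xd open_contains_cball by blast
    then have "(x, min r (min (\<delta> / 2) (d / 2))) \<in> K" using \<delta> xd by (auto simp: K_def subset_eq)
    then show ?thesis using xd \<open>r > 0\<close> \<delta> by (intro exI conjI) auto
  qed
  obtain C where C: "countable C" "C \<subseteq> K"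
      "pairwise (\<lambda>i j. disjnt (cball (fst i) (snd i)) (cball (fst j) (snd j))) C"
      "negligible (U - (\<Union>i\<in>C. cball (fst i) (snd i)))"
    by (rule Vitali_covering_theorem_cballs[of K snd U fst, OF K0 fine])
  have KC: "0 < snd i" "snd i \<le> \<delta> / 2" "cball (fst i) (snd i) \<subseteq> U" if "i \<in> C" for i
    using subsetD[OF C(2) that] by (simp_all add: K_def case_prod_beta)
  let ?V = "\<Union>i\<in>C. cball (fst i) (snd i)"
  have "hausdorff_pre DIM('a) \<delta> ?V \<le>
      (\<integral>\<^sup>+i. hausdorff_weight DIM('a) (cball (fst i) (snd i)) \<partial>count_space C)"
    by (rule hausdorff_pre_le_countable[OF C(1) order_refl _ _ \<delta>]) (use KC \<delta> in force)+
  also have "\<dots> = (\<integral>\<^sup>+i. emeasure lborel (cball (fst i) (snd i)) \<partial>count_space C)"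
    by (rule nn_integral_cong) (use KC in \<open>simp add: hausdorff_weight_cball less_imp_le\<close>)
  also have "\<dots> = emeasure lborel ?V"
    by (subst emeasure_UN_countable)
       (use C in \<open>auto simp: disjoint_family_on_def pairwise_def disjnt_def\<close>)
  also have "\<dots> \<le> emeasure lborel U"
    by (intro emeasure_mono UN_least KC(3)) (use U in auto)
  finally have V: "hausdorff_pre DIM('a) \<delta> ?V \<le> emeasure lborel U" .
  have "hausdorff_pre DIM('a) \<delta> A \<le> hausdorff_pre DIM('a) \<delta> (?V \<union> (U - ?V))"
    by (rule hausdorff_pre_mono) (use U in auto)
  also have "\<dots> \<le> hausdorff_pre DIM('a) \<delta> ?V + hausdorff_pre DIM('a) \<delta> (U - ?V)"
    by (rule hausdorff_pre_Un_le[OF \<delta>])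
  also have "\<dots> \<le> emeasure lborel U" using V hausdorff_pre_negligible[OF C(4) \<delta>] by simp
  finally show "hausdorff_pre DIM('a) \<delta> A \<le> emeasure lborel A + e" using eU by (rule order_trans)
qed

lemma hausdorff_outer_lipschitz_negligible:
  fixes f :: "'a::euclidean_space \<Rightarrow> 'b::euclidean_space"
  assumes "C-lipschitz_on N f" "negligible N"
  shows "hausdorff_outer DIM('a) (f ` N) = 0"
proof -
  \<comment> \<open>The constant \<open>C\<close> may be 0, while the image lemma divides by
    it.\<close>
  have "(C + 1)-lipschitz_on N f" using assms(1) by (rule lipschitz_on_mono) auto
  moreover have "C + 1 > 0" using lipschitz_on_nonneg[OF assms(1)] by simp
  ultimately have "hausdorff_outer DIM('a) (f ` N) \<le> ennreal ((C + 1) ^ DIM('a)) * hausdorff_outer DIM('a) N"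
    by (rule hausdorff_outer_lipschitz_image)
  then show ?thesis using hausdorff_outer_negligible[OF assms(2)] by simp
qed

section \<open>Lebesgue measure under isometries and stretches\<close>

lemma nn_integral_lborel_translate:
  fixes f :: "'a::euclidean_space \<Rightarrow> ennreal"
  assumes [measurable]: "f \<in> borel_measurable borel"
  shows "(\<integral>\<^sup>+x. f (a + x) \<partial>lborel) = (\<integral>\<^sup>+x. f x \<partial>lborel)"
proof -
  have "(\<integral>\<^sup>+x. f x \<partial>distr lborel borel ((+) a)) = (\<integral>\<^sup>+x. f (a + x) \<partial>lborel)"
    by (rule nn_integral_distr) auto
  then show ?thesis by (simp add: lborel_distr_plus)
qed

text \<open>Both measures are translation invariant, and a Fubini argument (the uniqueness of Haar
  measure) compares them by means of the unit ball, which is invariant under an isometry.\<close>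

lemma distr_lborel_isometry:
  fixes T :: "'a::euclidean_space \<Rightarrow> 'a"
  assumes T: "linear T" and nT: "\<And>x. norm (T x) = norm x"
  shows "distr lborel borel T = lborel"
proof (rule measure_eqI)
  fix A assume "A \<in> sets (distr lborel borel T)"
  then have A[measurable]: "A \<in> sets borel" by simp
  have [measurable]: "T \<in> borel_measurable borel"
    by (intro borel_measurable_continuous_onI linear_continuous_on linear_conv_bounded_linear[THEN iffD1] T)
  have "inj T" unfolding linear_injective_0[OF T] using nT by (metis norm_eq_zero)
  then have "surj T" using T by (simp add: linear_injective_imp_surjective)
  then obtain S where S: "\<And>y. T (S y) = y" by (metis surjD)
  define B where "B = ball (0::'a) 1"
  have [measurable]: "B \<in> sets borel" by (simp add: B_def)
  define c where "c = emeasure lborel B"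
  have c: "c \<noteq> 0" "c \<noteq> top"
    using unit_ball_vol_pos[of "real DIM('a)"] by (auto simp: c_def B_def emeasure_ball simp del: unit_ball_vol_pos)
  \<comment> \<open>\<open>T\<close> is onto and isometric: T x is within distance 1 of y exactly if
    x is within distance 1 of the preimage S y, hence the same value \<open>c\<close> for every
    y.\<close>
  have ball: "(\<integral>\<^sup>+x. indicator B (y - T x) \<partial>lborel) = c" for y
  proof -
    have "norm (T x - y) = norm (S y - x)" for x
      using nT[of "S y - x"] S by (simp add: linear_diff[OF T] norm_minus_commute)
    then have "(\<integral>\<^sup>+x. indicator B (y - T x) \<partial>lborel) = (\<integral>\<^sup>+x. indicator (ball (S y) 1) x \<partial>lborel)"
      by (intro nn_integral_cong) (auto simp: B_def dist_norm indicator_def)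
    also have "\<dots> = c" by (simp add: c_def B_def emeasure_ball)
    finally show ?thesis .
  qed
  have "emeasure (distr lborel borel T) A * c
      = (\<integral>\<^sup>+y. (\<integral>\<^sup>+x. indicator A (T x) \<partial>lborel) * indicator B y \<partial>lborel)"
  proof -
    have "(\<integral>\<^sup>+x. indicator A x \<partial>distr lborel borel T) = (\<integral>\<^sup>+x. indicator A (T x) \<partial>lborel)"
      by (rule nn_integral_distr) auto
    then show ?thesis by (simp add: nn_integral_cmult c_def)
  qed
  also have "\<dots> = (\<integral>\<^sup>+y. (\<integral>\<^sup>+x. indicator A (T x + y) \<partial>lborel) * indicator B y \<partial>lborel)"
  proof (rule nn_integral_cong, rule arg_cong2[where f = "(*)", OF _ refl])
    fix y
    have "(\<integral>\<^sup>+x. indicator A (T (S y + x)) \<partial>lborel) = (\<integral>\<^sup>+x. indicator A (T x) \<partial>lborel)"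
      by (rule nn_integral_lborel_translate) measurable
    then show "(\<integral>\<^sup>+x. indicator A (T x) \<partial>lborel) = (\<integral>\<^sup>+x. indicator A (T x + y) \<partial>lborel)"
      by (simp add: linear_add[OF T] S add.commute)
  qed
  also have "\<dots> = (\<integral>\<^sup>+y. (\<integral>\<^sup>+x. indicator A (T x + y) * indicator B y \<partial>lborel) \<partial>lborel)"
    by (intro nn_integral_cong nn_integral_multc[symmetric]) measurable
  also have "\<dots> = (\<integral>\<^sup>+x. (\<integral>\<^sup>+y. indicator A (T x + y) * indicator B y \<partial>lborel) \<partial>lborel)"
    by (rule lborel_pair.Fubini') measurable
  also have "\<dots> = (\<integral>\<^sup>+x. (\<integral>\<^sup>+y. indicator A y * indicator B (y - T x) \<partial>lborel) \<partial>lborel)"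
  proof (rule nn_integral_cong)
    fix x
    have "(\<integral>\<^sup>+y. indicator A (T x + (- T x + y)) * indicator B (- T x + y) \<partial>lborel)
        = (\<integral>\<^sup>+y. indicator A (T x + y) * indicator B y \<partial>lborel)"
      by (rule nn_integral_lborel_translate) measurable
    then show "(\<integral>\<^sup>+y. indicator A (T x + y) * indicator B y \<partial>lborel)
        = (\<integral>\<^sup>+y. indicator A y * indicator B (y - T x) \<partial>lborel)" by simp
  qed
  also have "\<dots> = (\<integral>\<^sup>+y. (\<integral>\<^sup>+x. indicator A y * indicator B (y - T x) \<partial>lborel) \<partial>lborel)"
    by (rule lborel_pair.Fubini'[symmetric]) measurable
  also have "\<dots> = (\<integral>\<^sup>+y. indicator A y * c \<partial>lborel)"
    by (intro nn_integral_cong) (simp add: nn_integral_cmult ball)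
  also have "\<dots> = emeasure lborel A * c" by (simp add: nn_integral_multc)
  finally show "emeasure (distr lborel borel T) A = emeasure lborel A"
    using c by (metis ennreal_mult_divide_eq mult.commute)
qed simp

text \<open>For \<open>p = q\<close> this is the identity, since \<open>0 / 0 = 0\<close>.\<close>

definition householder :: "'a::euclidean_space \<Rightarrow> 'a \<Rightarrow> 'a \<Rightarrow> 'a" where
  "householder p q x = x - (2 * (x \<bullet> (p - q)) / ((p - q) \<bullet> (p - q))) *\<^sub>R (p - q)"

lemma linear_householder: "linear (householder p q)"
proof -
  define m where "m = p - q"
  show ?thesis
    unfolding householder_def[abs_def] m_def[symmetric]
    by (rule linearI)
       (simp_all add: inner_add_left add_divide_distrib distrib_left scaleR_left_distrib
        scaleR_right_diff_distrib)
qed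

lemma inner_householder: "householder p q x \<bullet> householder p q y = x \<bullet> y"
proof (cases "p = q")
  case False
  define m where "m = p - q"
  have m: "m \<bullet> m \<noteq> 0" using False by (simp add: m_def)
  define \<alpha> where "\<alpha> = 2 * (x \<bullet> m) / (m \<bullet> m)"
  define \<beta> where "\<beta> = 2 * (y \<bullet> m) / (m \<bullet> m)"
  have "\<beta> * (m \<bullet> m) = 2 * (y \<bullet> m)" "\<alpha> * (y \<bullet> m) = \<beta> * (x \<bullet> m)"
    using m by (simp_all add: \<alpha>_def \<beta>_def)
  moreover have "(x - \<alpha> *\<^sub>R m) \<bullet> (y - \<beta> *\<^sub>R m)
      = x \<bullet> y - \<beta> * (x \<bullet> m) - \<alpha> * (y \<bullet> m) + \<alpha> * (\<beta> * (m \<bullet> m))"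
    by (simp only: inner_diff_left inner_diff_right inner_commute[of m y] inner_scaleR_left inner_scaleR_right) argo
  ultimately show ?thesis
    unfolding householder_def m_def[symmetric] \<alpha>_def[symmetric] \<beta>_def[symmetric] by simp
qed (simp add: householder_def)

lemma norm_householder: "norm (householder p q x) = norm x"
  by (simp add: norm_eq_sqrt_inner inner_householder)

lemma householder_involution: "householder p q (householder p q x) = x"
proof (cases "p = q")
  case False
  define m where "m = p - q"
  have m: "m \<bullet> m \<noteq> 0" using False by (simp add: m_def)
  show ?thesis
    unfolding householder_def m_def[symmetric]
    using m by (simp add: inner_diff_left)
qed (simp add: householder_def)

text \<open>For equally long vectors (p - q) . (p - q) = 2 p . (p - q), so the reflection along p -
  q subtracts exactly p - q from p.\<close>

lemma householder_swap:
  assumes "norm p = 1" "norm q = 1"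
  shows "householder p q p = q"
proof (cases "p = q")
  case False
  have 1: "p \<bullet> p = 1" "q \<bullet> q = 1" using assms by (simp_all add: norm_eq_1)
  have "(p - q) \<bullet> (p - q) = 2 * (p \<bullet> (p - q))"
    by (simp add: inner_diff_left inner_diff_right 1 inner_commute)
  moreover have "(p - q) \<bullet> (p - q) \<noteq> 0" using False by simp
  ultimately show ?thesis by (simp add: householder_def)
qed (simp add: householder_def)

lemma image_eq_vimage_inverse:
  assumes "\<And>x. g (f x) = x" "\<And>x. f (g x) = x"
  shows "f ` A = g -` A"
proof (intro set_eqI iffI)
  fix x assume "x \<in> g -` A"
  then have "f (g x) \<in> f ` A" by blast
  then show "x \<in> f ` A" by (simp add: assms)
qed (use assms in auto)

text \<open>As \<open>T\<close> is its own inverse, the image is a preimage, which gives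
  measurability and lets \<open>distr\<close> be evaluated on it.\<close>

lemma emeasure_isometry_image:
  fixes T :: "'a::euclidean_space \<Rightarrow> 'a"
  assumes "linear T" "\<And>x. norm (T x) = norm x" "\<And>x. T (T x) = x" "A \<in> sets borel"
  shows "T ` A \<in> sets borel" "emeasure lborel (T ` A) = emeasure lborel A"
proof -
  have [measurable]: "T \<in> borel_measurable borel"
    by (intro borel_measurable_continuous_onI linear_continuous_on linear_conv_bounded_linear[THEN iffD1] assms)
  have eq: "T ` A = T -` A" by (rule image_eq_vimage_inverse) (rule assms(3))+
  show "T ` A \<in> sets borel"
    unfolding eq using assms(4) measurable_sets[of T borel borel A] by simp
  have "emeasure lborel A = emeasure (distr lborel borel T) A"
    using distr_lborel_isometry[OF assms(1,2)] by simp
  also have "\<dots> = emeasure lborel (T ` A)"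
    by (subst emeasure_distr) (use assms(4) in \<open>auto simp: eq\<close>)
  finally show "emeasure lborel (T ` A) = emeasure lborel A" ..
qed

text \<open>For a coordinate direction \<open>b\<close> the stretch is diagonal and its volume
  factor is the product of the diagonal entries. Conjugation with the reflection that exchanges
  \<open>b\<close> and \<open>a\<close> gives every other direction.\<close>

lemma emeasure_stretch_image:
  fixes a :: "'a::euclidean_space"
  assumes a: "norm a = 1" and J: "J > 0" and A: "A \<in> sets borel"
  defines "M \<equiv> \<lambda>x. x + ((J - 1) * (x \<bullet> a)) *\<^sub>R a"
  shows "M ` A \<in> sets borel" "emeasure lborel (M ` A) = ennreal J * emeasure lborel A"
proof -
  obtain b :: 'a where b: "b \<in> Basis" using nonempty_Basis by blast
  define D where "D x = x + ((J - 1) * (x \<bullet> b)) *\<^sub>R b" for x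
  define D' where "D' x = x + ((1 / J - 1) * (x \<bullet> b)) *\<^sub>R b" for x
  have DD: "D' (D x) = x" "D (D' x) = x" for x
    using J b by (simp_all add: D_def D'_def inner_add_left algebra_simps flip: scaleR_add_left)
       (simp_all add: field_simps)
  have [measurable]: "D \<in> borel_measurable borel" "D' \<in> borel_measurable borel"
    unfolding D_def[abs_def] D'_def[abs_def] by measurable
  have D: "D ` B \<in> sets borel \<and> emeasure lborel (D ` B) = ennreal J * emeasure lborel B"
    if B: "B \<in> sets borel" for B
  proof -
    have eq: "D ` B = D' -` B" by (rule image_eq_vimage_inverse) (rule DD)+
    have DB: "D ` B \<in> sets borel"
      unfolding eq using measurable_sets[of D' borel borel B] B by simp
    define c where "c j = (if j = b then J else 1)" for j
    have Deq: "D = (\<lambda>x. 0 + (\<Sum>j\<in>Basis. (c j * (x \<bullet> j)) *\<^sub>R j))"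
    proof
      fix x
      have "(\<Sum>j\<in>Basis. (c j * (x \<bullet> j)) *\<^sub>R j)
          = (\<Sum>j\<in>Basis. (x \<bullet> j) *\<^sub>R j + (if j = b then ((J - 1) * (x \<bullet> b)) *\<^sub>R b else 0))"
        by (rule sum.cong) (auto simp: c_def algebra_simps)
      also have "\<dots> = D x" using b by (simp add: sum.distrib euclidean_representation D_def)
      finally show "D x = 0 + (\<Sum>j\<in>Basis. (c j * (x \<bullet> j)) *\<^sub>R j)" by simp
    qed
    have prod: "(\<Prod>j\<in>Basis. \<bar>c j\<bar>) = J"
      using b J by (simp add: c_def if_distrib prod.delta cong: if_cong)
    have "lborel = density (distr lborel borel D) (\<lambda>_. ennreal (\<Prod>j\<in>Basis. \<bar>c j\<bar>))"
      unfolding Deq by (rule lborel_affine_euclidean) (use J in \<open>auto simp: c_def\<close>)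
    then have "emeasure lborel (D ` B) = emeasure (density (distr lborel borel D) (\<lambda>_. ennreal J)) (D ` B)"
      unfolding prod by (rule arg_cong)
    also have "\<dots> = ennreal J * emeasure lborel (D -` (D ` B))"
      using DB by (subst emeasure_density) (auto simp: nn_integral_cmult emeasure_distr)
    also have "D -` (D ` B) = B" by (rule inj_vimage_image_eq) (metis injI DD(1))
    finally show ?thesis using DB by simp
  qed
  define Q where "Q = householder b a"
  note Q = linear_householder[of b a, folded Q_def] norm_householder[of b a, folded Q_def]
    householder_involution[of b a, folded Q_def]
  have Qb: "Q b = a" unfolding Q_def by (rule householder_swap) (use a b in auto)
  have "M x = Q (D (Q x))" for x
  proof -
    have "Q x \<bullet> b = x \<bullet> a"
      using inner_householder[of b a "Q x" b] by (simp add: Q(3) Qb flip: Q_def)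
    then show ?thesis
      by (simp add: D_def linear_add[OF Q(1)] linear_cmul[OF Q(1)] Q(3) Qb M_def)
  qed
  then have "M ` A = Q ` (D ` (Q ` A))" by (auto simp: image_image)
  then show "M ` A \<in> sets borel" "emeasure lborel (M ` A) = ennreal J * emeasure lborel A"
    using D emeasure_isometry_image[OF Q] A by metis+
qed

subsection \<open>Hausdorff measure of graphs\<close>

text \<open>All charts of the proof are of this kind: the identity, the reflection of the last
  coordinate, and an exchange of the last coordinate with a direction of the base. An involution
  serves as its own inverse, and together with isometry it makes \<open>T\<close> symmetric
  (\<open>inner_T\<close>).\<close>

locale linear_involutive_isometry =
  fixes T :: "'a::euclidean_space \<Rightarrow> 'a"
  assumes linear_T: "linear T" and norm_T: "norm (T x) = norm x" and T_T [simp]: "T (T x) = x"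
begin

lemma T_diff: "T (x - y) = T x - T y" and T_add: "T (x + y) = T x + T y"
  and T_scaleR: "T (c *\<^sub>R x) = c *\<^sub>R T x"
  using linear_T by (simp_all add: linear_diff linear_add linear_cmul)

lemma dist_T: "dist (T x) (T y) = dist x y"
  unfolding dist_norm T_diff[symmetric] norm_T ..

lemma inner_T_T: "T x \<bullet> T y = x \<bullet> y"
proof -
  have "norm (T x + T y) = norm (x + y)" by (simp add: norm_T flip: T_add)
  then have "(T x + T y) \<bullet> (T x + T y) = (x + y) \<bullet> (x + y)"
    by (simp add: norm_eq_sqrt_inner)
  moreover have "T z \<bullet> T z = z \<bullet> z" for z using norm_T[of z] by (simp add: norm_eq_sqrt_inner)
  ultimately show ?thesis by (simp add: inner_add_left inner_add_right inner_commute)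
qed

lemma inner_T: "T x \<bullet> y = x \<bullet> T y"
  using inner_T_T[of x "T y"] by simp

lemma continuous_T: "continuous_on S T"
  by (intro linear_continuous_on linear_conv_bounded_linear[THEN iffD1] linear_T)

lemma measurable_T [measurable]: "T \<in> borel_measurable borel"
  by (intro borel_measurable_continuous_onI continuous_T)

lemma T_eq_iff: "T x = y \<longleftrightarrow> x = T y"
  by auto

lemma nn_integral_T:
  assumes [measurable]: "f \<in> borel_measurable borel"
  shows "(\<integral>\<^sup>+x. f (T x) \<partial>lborel) = (\<integral>\<^sup>+x. f x \<partial>lborel)"
  using nn_integral_distr[of T lborel borel f] by (simp add: distr_lborel_isometry linear_T norm_T)

end

locale rotated_graph = linear_involutive_isometry T
  for T :: "'a::euclidean_space \<times> real \<Rightarrow> 'a \<times> real" +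
  fixes g :: "'a \<Rightarrow> real"
  assumes measurable_g [measurable]: "g \<in> borel_measurable borel"
begin

lemma measurable_fst_T [measurable]: "(\<lambda>x. fst (T x)) \<in> borel_measurable borel"
  and measurable_snd_T [measurable]: "(\<lambda>x. snd (T x)) \<in> borel_measurable borel"
  by (auto intro!: borel_measurable_continuous_onI continuous_intros continuous_on_compose2[OF continuous_T])

definition \<Gamma> :: "'a \<Rightarrow> 'a \<times> real" where "\<Gamma> w = T (w, g w)"

lemma T_\<Gamma> [simp]: "T (\<Gamma> w) = (w, g w)"
  by (simp add: \<Gamma>_def)

lemma measurable_\<Gamma> [measurable]: "\<Gamma> \<in> borel_measurable borel"
  unfolding \<Gamma>_def[abs_def]
  by (rule measurable_compose[OF _ measurable_T]) (simp flip: borel_prod)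

lemma \<Gamma>_image: "\<Gamma> ` W = {x. fst (T x) \<in> W \<and> snd (T x) = g (fst (T x))}"
proof (intro set_eqI iffI)
  fix x assume "x \<in> {x. fst (T x) \<in> W \<and> snd (T x) = g (fst (T x))}"
  then have Tx: "T x = (fst (T x), g (fst (T x)))" and "fst (T x) \<in> W" by (simp_all add: prod_eq_iff)
  moreover have "x = \<Gamma> (fst (T x))" unfolding \<Gamma>_def Tx[symmetric] by simp
  ultimately show "x \<in> \<Gamma> ` W" by blast
qed auto

lemma sets_\<Gamma>_image [measurable]: "W \<in> sets borel \<Longrightarrow> \<Gamma> ` W \<in> sets borel"
proof -
  assume W: "W \<in> sets borel"
  have "(\<lambda>x. snd (T x) - g (fst (T x))) \<in> borel_measurable borel"
    by (intro borel_measurable_diff measurable_snd_T measurable_compose[OF measurable_fst_T measurable_g])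
  from measurable_sets[OF this, of "{0}"] measurable_sets[OF measurable_fst_T W]
  have "(\<lambda>x. fst (T x)) -` W \<inter> (\<lambda>x. snd (T x) - g (fst (T x))) -` {0} \<in> sets borel"
    by simp
  also have "(\<lambda>x. fst (T x)) -` W \<inter> (\<lambda>x. snd (T x) - g (fst (T x))) -` {0} = \<Gamma> ` W"
    by (auto simp: \<Gamma>_image)
  finally show "\<Gamma> ` W \<in> sets borel" .
qed

text \<open>The graph of a linear function with slope \<open>c\<close> is isometric to its base
  stretched by J = sqrt (1 + |c|^2) along \<open>c\<close>. If \<open>g\<close> is affine on
  \<open>A\<close> only up to \<delta>, the graph is still a (1 + \<delta>)-Lipschitz image of the
  stretched set, to which the comparison with Lebesgue measure applies.\<close>

lemma hausdorff_\<Gamma>_almost_linear: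
  assumes A: "A \<in> sets borel" and "\<delta> > 0"
    and lin: "\<And>w v. w \<in> A \<Longrightarrow> v \<in> A \<Longrightarrow> \<bar>g w - g v - c \<bullet> (w - v)\<bar> \<le> \<delta> * norm (w - v)"
  shows "hausdorff_outer DIM('a) (\<Gamma> ` A) \<le> ennreal ((1 + \<delta>) ^ DIM('a) * norm (c, 1::real)) * emeasure lborel A"
proof -
  define J where "J = norm (c, 1::real)"
  have J2: "J\<^sup>2 = 1 + (norm c)\<^sup>2" by (simp add: J_def norm_Pair)
  have J: "J > 0" by (simp add: J_def zero_prod_def)
  \<comment> \<open>If c = 0 any unit vector will do, since then J = 1.\<close>
  obtain e where e: "norm e = 1" "c = norm c *\<^sub>R e"
  proof (cases "c = 0")
    case True
    obtain b :: 'a where "b \<in> Basis" using nonempty_Basis by blast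
    then show ?thesis using True that[of b] by simp
  next
    case False
    then show ?thesis using that[of "c /\<^sub>R norm c"] by simp
  qed
  have ee: "e \<bullet> e = 1" using e(1) by (simp add: norm_eq_1)
  define M where "M x = x + ((J - 1) * (x \<bullet> e)) *\<^sub>R e" for x
  define M' where "M' x = x + ((1 / J - 1) * (x \<bullet> e)) *\<^sub>R e" for x
  have M'M: "M' (M x) = x" for x
    using J ee by (simp add: M_def M'_def inner_add_left algebra_simps flip: scaleR_add_left)
  have Mdiff: "M x - M y = M (x - y)" for x y
    by (simp add: M_def inner_diff_left algebra_simps)
  have norm_M: "norm (M z) = norm (z, c \<bullet> z)" for z
  proof -
    have "M z \<bullet> M z = z \<bullet> z + (J\<^sup>2 - 1) * (z \<bullet> e)\<^sup>2"
      by (simp add: M_def inner_add_left inner_add_right ee inner_commute[of e z] power2_eq_square algebra_simps)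
    also have "(J\<^sup>2 - 1) * (z \<bullet> e)\<^sup>2 = (c \<bullet> z)\<^sup>2"
    proof -
      have "c \<bullet> z = norm c * (z \<bullet> e)" by (subst e(2)) (simp add: inner_commute)
      then show ?thesis by (simp add: J2 power_mult_distrib)
    qed
    finally show ?thesis by (simp add: norm_eq_sqrt_inner power2_eq_square)
  qed
  have lip: "(1 + \<delta>)-lipschitz_on (M ` A) (\<lambda>x. \<Gamma> (M' x))"
  proof (rule lipschitz_onI)
    fix x y assume "x \<in> M ` A" "y \<in> M ` A"
    then obtain w v where wv: "w \<in> A" "v \<in> A" "x = M w" "y = M v" by auto
    have "dist (\<Gamma> w) (\<Gamma> v) = norm (w - v, g w - g v)"
      unfolding \<Gamma>_def dist_T by (simp add: dist_norm)
    also have "(w - v, g w - g v) = (w - v, c \<bullet> (w - v)) + (0, g w - g v - c \<bullet> (w - v))" by simp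
    also have "norm \<dots> \<le> norm (M (w - v)) + \<bar>g w - g v - c \<bullet> (w - v)\<bar>"
      by (rule order_trans[OF norm_triangle_ineq]) (simp add: norm_M norm_Pair)
    also have "\<dots> \<le> norm (M (w - v)) + \<delta> * norm (M (w - v))"
    proof -
      have "norm (w - v) \<le> norm (M (w - v))" using norm_fst_le[of "w - v" "c \<bullet> (w - v)"] by (simp add: norm_M)
      then have "\<delta> * norm (w - v) \<le> \<delta> * norm (M (w - v))" using \<open>\<delta> > 0\<close> by simp
      with lin[OF wv(1,2)] show ?thesis by linarith
    qed
    finally show "dist (\<Gamma> (M' x)) (\<Gamma> (M' y)) \<le> (1 + \<delta>) * dist x y"
      by (simp add: wv M'M dist_norm Mdiff algebra_simps)
  qed (use \<open>\<delta> > 0\<close> in simp)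
  have eq: "\<Gamma> ` A = (\<lambda>x. \<Gamma> (M' x)) ` (M ` A)" by (simp add: image_image M'M)
  have "hausdorff_outer DIM('a) (\<Gamma> ` A) \<le> ennreal ((1 + \<delta>) ^ DIM('a)) * hausdorff_outer DIM('a) (M ` A)"
    unfolding eq by (rule hausdorff_outer_lipschitz_image[OF lip]) (use \<open>\<delta> > 0\<close> in simp)
  also have "\<dots> \<le> ennreal ((1 + \<delta>) ^ DIM('a)) * (ennreal J * emeasure lborel A)"
    using emeasure_stretch_image[OF e(1) J A, folded M_def]
    by (intro mult_left_mono) (auto intro: hausdorff_outer_le_lborel[THEN order_trans])
  also have "\<dots> = ennreal ((1 + \<delta>) ^ DIM('a) * J) * emeasure lborel A"
    using J \<open>\<delta> > 0\<close> by (simp add: ennreal_mult mult.assoc)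
  finally show ?thesis by (simp add: J_def)
qed

text \<open>A countable decomposition into pieces on which one slope works uniformly:
  \<open>c\<close> runs through a dense set, \<open>m\<close> fixes a scale 1/(m+1) at which the
  derivative estimate already holds, and \<open>q\<close> localises to a ball in which any two
  points are closer than this scale.\<close>

lemma almost_linear_cover:
  assumes W: "W \<in> sets borel" and a[measurable]: "a \<in> borel_measurable borel" and "\<delta> > 0"
    and deriv: "\<And>w. w \<in> W \<Longrightarrow> (g has_derivative (\<lambda>z. a w \<bullet> z)) (at w)"
  obtains A :: "nat \<Rightarrow> 'a set" and c where "\<And>i. A i \<in> sets borel" "W = (\<Union>i. A i)" "disjoint_family A"
    "\<And>i w v. w \<in> A i \<Longrightarrow> v \<in> A i \<Longrightarrow> \<bar>g w - g v - c i \<bullet> (w - v)\<bar> \<le> \<delta> * norm (w - v)"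
    "\<And>i w. w \<in> A i \<Longrightarrow> norm (a w - c i) \<le> \<delta>"
proof -
  obtain Q :: "'a set" where Q: "countable Q" "\<And>X. open X \<Longrightarrow> X \<noteq> {} \<Longrightarrow> \<exists>d\<in>Q. d \<in> X"
    using countable_dense_setE by blast
  have dense: "\<exists>q\<in>Q. norm (x - q) < r" if "r > 0" for x r
    using Q(2)[of "ball x r"] that by (auto simp: dist_norm)
  \<comment> \<open>With "v is far from w" as an alternative, and weak inequalities throughout, the
    condition is closed in \<open>w\<close> relative to \<open>W\<close> for each fixed
    \<open>v\<close>. Hence the pieces are Borel although uncountably many \<open>v\<close> are
    involved.\<close>
  define P where "P c m w v \<longleftrightarrow> norm (v - w) \<ge> 1 / real (Suc m) \<or>
      \<bar>g v - g w - c \<bullet> (v - w)\<bar> \<le> \<delta> * norm (v - w)" for c m w v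
  define B where "B = (\<lambda>(c, m, q). {w \<in> W. (\<forall>v\<in>W. P c m w v) \<and> norm (w - q) < 1 / (2 * real (Suc m))
      \<and> norm (a w - c) \<le> \<delta>})"
  have cont: "continuous_on W g"
    using deriv by (meson continuous_at_imp_continuous_on has_derivative_continuous)
  have PW: "{w \<in> W. \<forall>v\<in>W. P c m w v} \<in> sets borel" for c m
  proof (cases "W = {}")
    case False
    have cl: "closedin (top_of_set W) {w \<in> W. P c m w v}" for v
    proof -
      have "{w \<in> W. P c m w v} = (W \<inter> (\<lambda>w. norm (v - w)) -` {1 / real (Suc m)..}) \<union>
          (W \<inter> (\<lambda>w. \<bar>g v - g w - c \<bullet> (v - w)\<bar> - \<delta> * norm (v - w)) -` {..0})"
        by (auto simp: P_def)
      also have "closedin (top_of_set W) \<dots>"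
        by (intro closedin_Un continuous_closedin_preimage continuous_intros cont closed_atLeast closed_atMost)
      finally show ?thesis .
    qed
    have "{w \<in> W. \<forall>v\<in>W. P c m w v} = (\<Inter>v\<in>W. {w \<in> W. P c m w v})" using False by auto
    also have "closedin (top_of_set W) \<dots>" using False cl by (intro closedin_INT) auto
    finally obtain K where "closed K" "{w \<in> W. \<forall>v\<in>W. P c m w v} = W \<inter> K"
      by (auto simp: closedin_closed)
    then show ?thesis using W by auto
  qed simp
  have B_meas: "B i \<in> sets borel" for i
  proof -
    obtain c m q where i: "i = (c, m, q)" by (cases i)
    have "B i = {w \<in> W. \<forall>v\<in>W. P c m w v} \<inter> {w. norm (w - q) < 1 / (2 * real (Suc m)) \<and> norm (a w - c) \<le> \<delta>}"
      by (auto simp: B_def i)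
    also have "\<dots> \<in> sets borel" by (intro sets.Int PW) measurable
    finally show ?thesis .
  qed
  define I where "I = Q \<times> (UNIV :: nat set) \<times> Q"
  have "Q \<noteq> {}" using dense[of 1] by auto
  then have I: "countable I" "I \<noteq> {}" using Q by (auto simp: I_def)
  have cover: "\<exists>i\<in>I. w \<in> B i" if w: "w \<in> W" for w
  proof -
    \<comment> \<open>The tolerance is halved between the derivative estimate and the error of
      replacing \<open>a w\<close> by a slope from the dense set.\<close>
    obtain d where d: "d > 0" "\<And>v. norm (v - w) < d \<Longrightarrow> norm (g v - g w - a w \<bullet> (v - w)) \<le> \<delta> / 2 * norm (v - w)"
      using deriv[OF w, unfolded has_derivative_at_alt] \<open>\<delta> > 0\<close> by (meson half_gt_zero)
    obtain m where m: "1 / real (Suc m) < d" using reals_Archimedean[OF d(1)] by (auto simp: inverse_eq_divide)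
    obtain c where c: "c \<in> Q" "norm (a w - c) < \<delta> / 2" using dense[of "\<delta> / 2"] \<open>\<delta> > 0\<close> by auto
    obtain q where q: "q \<in> Q" "norm (w - q) < 1 / (2 * real (Suc m))" using dense[of "1 / (2 * real (Suc m))"] by auto
    have "P c m w v" for v
    proof (cases "norm (v - w) < 1 / real (Suc m)")
      case True
      have "\<bar>(a w - c) \<bullet> (v - w)\<bar> \<le> norm (a w - c) * norm (v - w)" by (rule Cauchy_Schwarz_ineq2)
      also have "\<dots> \<le> \<delta> / 2 * norm (v - w)" using c by (intro mult_right_mono) auto
      finally have "\<bar>g v - g w - c \<bullet> (v - w)\<bar> \<le> \<delta> / 2 * norm (v - w) + \<delta> / 2 * norm (v - w)"
        using d(2)[of v] True m unfolding inner_diff_left[of "a w" c "v - w"] real_norm_def by linarith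
      then show ?thesis by (simp add: P_def field_simps)
    qed (simp add: P_def)
    then have "w \<in> B (c, m, q)" using w q c \<open>\<delta> > 0\<close> by (auto simp: B_def)
    then show ?thesis using c q by (auto simp: I_def)
  qed
  define A where "A = disjointed (\<lambda>i. B (from_nat_into I i))"
  have AB: "A i \<subseteq> B (from_nat_into I i)" for i unfolding A_def by (rule disjointed_subset)
  show thesis
  proof (rule that[of A "\<lambda>i. fst (from_nat_into I i)"])
    show "A i \<in> sets borel" for i
      using sets.range_disjointed_sets[of "\<lambda>i. B (from_nat_into I i)" borel] B_meas unfolding A_def by blast
    have "(\<Union>i. A i) = (\<Union>i. B (from_nat_into I i))" unfolding A_def by (rule UN_disjointed_eq)
    also have "\<dots> = (\<Union>i\<in>I. B i)" using I by (metis UN_extend_simps(10) range_from_nat_into)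
    also have "\<dots> = W" using cover by (auto simp: B_def)
    finally show "W = (\<Union>i. A i)" ..
    show "disjoint_family A" unfolding A_def by (rule disjoint_family_disjointed)
  next
    fix i w assume "w \<in> A i"
    then have w: "w \<in> B (from_nat_into I i)" using AB by auto
    then show "norm (a w - fst (from_nat_into I i)) \<le> \<delta>" by (auto simp: B_def split: prod.splits)
    fix v assume "v \<in> A i"
    then have v: "v \<in> B (from_nat_into I i)" using AB by auto
    obtain c m q where i: "from_nat_into I i = (c, m, q)" by (cases "from_nat_into I i")
    have "P c m v w" "norm (w - q) < 1 / (2 * real (Suc m))" "norm (v - q) < 1 / (2 * real (Suc m))"
      using w v by (auto simp: B_def i)
    moreover from this have "norm (w - v) < 1 / real (Suc m)"
    proof -
      have "1 / (2 * real (Suc m)) + 1 / (2 * real (Suc m)) = 1 / real (Suc m)" by (simp add: field_simps)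
      moreover have "norm (w - v) \<le> norm (w - q) + norm (v - q)"
        using norm_triangle_ineq4[of "w - q" "v - q"] by simp
      ultimately show ?thesis
        using add_strict_mono[OF \<open>norm (w - q) < _\<close> \<open>norm (v - q) < _\<close>] by simp
    qed
    ultimately show "\<bar>g w - g v - fst (from_nat_into I i) \<bullet> (w - v)\<bar> \<le> \<delta> * norm (w - v)"
      by (auto simp: P_def i)
  qed
qed

text \<open>Summing the almost linear pieces gives the bound up to powers of 1 + \<delta>: as many
  as the dimension from the Lipschitz constant, and one more from replacing the slope
  \<open>c i\<close> by \<open>a w\<close> in the area density. Then \<delta> tends to 0.\<close>

lemma hausdorff_\<Gamma>_image_le:
  assumes W: "W \<in> sets borel" and a[measurable]: "a \<in> borel_measurable borel"
    and deriv: "\<And>w. w \<in> W \<Longrightarrow> (g has_derivative (\<lambda>z. a w \<bullet> z)) (at w)"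
  shows "hausdorff_outer DIM('a) (\<Gamma> ` W) \<le> (\<integral>\<^sup>+w\<in>W. ennreal (norm (a w, 1::real)) \<partial>lborel)"
proof -
  let ?I = "\<integral>\<^sup>+w\<in>W. ennreal (norm (a w, 1::real)) \<partial>lborel"
  have *: "hausdorff_outer DIM('a) (\<Gamma> ` W) \<le> ennreal ((1 + \<delta>) ^ Suc DIM('a)) * ?I" if "\<delta> > 0" for \<delta>
  proof -
    obtain A :: "nat \<Rightarrow> 'a set" and c where A: "\<And>i. A i \<in> sets borel" "W = (\<Union>i. A i)" "disjoint_family A"
      "\<And>i w v. w \<in> A i \<Longrightarrow> v \<in> A i \<Longrightarrow> \<bar>g w - g v - c i \<bullet> (w - v)\<bar> \<le> \<delta> * norm (w - v)"
      "\<And>i w. w \<in> A i \<Longrightarrow> norm (a w - c i) \<le> \<delta>"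
      by (rule almost_linear_cover[OF W a \<open>\<delta> > 0\<close> deriv]) (assumption, rule that)
    note [measurable] = A(1)
    have "hausdorff_outer DIM('a) (\<Gamma> ` W) \<le> (\<Sum>i. hausdorff_outer DIM('a) (\<Gamma> ` A i))"
      unfolding A(2) image_UN by (rule hausdorff_outer_UN_le)
    also have "\<dots> \<le> (\<Sum>i. \<integral>\<^sup>+w\<in>A i. ennreal ((1 + \<delta>) ^ Suc DIM('a)) * ennreal (norm (a w, 1::real)) \<partial>lborel)"
    proof (rule suminf_le)
      fix i
      have "hausdorff_outer DIM('a) (\<Gamma> ` A i) \<le> ennreal ((1 + \<delta>) ^ DIM('a) * norm (c i, 1::real)) * emeasure lborel (A i)"
        by (rule hausdorff_\<Gamma>_almost_linear[OF A(1) \<open>\<delta> > 0\<close> A(4)])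
      also have "\<dots> = (\<integral>\<^sup>+w\<in>A i. ennreal ((1 + \<delta>) ^ DIM('a) * norm (c i, 1::real)) \<partial>lborel)"
        by (simp add: nn_integral_cmult)
      also have "\<dots> \<le> (\<integral>\<^sup>+w\<in>A i. ennreal ((1 + \<delta>) ^ Suc DIM('a)) * ennreal (norm (a w, 1::real)) \<partial>lborel)"
      proof (intro nn_integral_mono)
        fix w
        have "norm (c i, 1::real) \<le> (1 + \<delta>) * norm (a w, 1::real)" if "w \<in> A i"
        proof -
          have "norm (c i, 1::real) \<le> norm (a w, 1::real) + norm (a w - c i, 0::real)"
            using norm_triangle_ineq4[of "(a w, 1::real)" "(a w - c i, 0::real)"] by simp
          also have "\<dots> \<le> norm (a w, 1::real) + \<delta> * norm (a w, 1::real)"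
          proof -
            \<comment> \<open>The component 1 turns the additive error \<delta> into a relative
              one.\<close>
            have "1 \<le> norm (a w, 1::real)" using norm_snd_le[of "1::real" "a w"] by simp
            then have "\<delta> * 1 \<le> \<delta> * norm (a w, 1::real)" using \<open>\<delta> > 0\<close> by (intro mult_left_mono) auto
            then show ?thesis using A(5)[OF that] by (simp add: norm_Pair)
          qed
          finally show ?thesis by (simp add: algebra_simps)
        qed
        then show "ennreal ((1 + \<delta>) ^ DIM('a) * norm (c i, 1::real)) * indicator (A i) w
            \<le> ennreal ((1 + \<delta>) ^ Suc DIM('a)) * ennreal (norm (a w, 1::real)) * indicator (A i) w"
          using \<open>\<delta> > 0\<close>
          by (auto split: split_indicator simp: ennreal_mult[symmetric] mult.assoc mult.left_commute
              intro!: ennreal_leI mult_left_mono)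
      qed
      finally show "hausdorff_outer DIM('a) (\<Gamma> ` A i)
        \<le> (\<integral>\<^sup>+w\<in>A i. ennreal ((1 + \<delta>) ^ Suc DIM('a)) * ennreal (norm (a w, 1::real)) \<partial>lborel)" .
    qed auto
    also have "\<dots> = (\<integral>\<^sup>+w\<in>W. ennreal ((1 + \<delta>) ^ Suc DIM('a)) * ennreal (norm (a w, 1::real)) \<partial>lborel)"
      unfolding A(2) by (rule nn_integral_disjoint_family[symmetric]) (use A(1,3) in auto)
    also have "\<dots> = ennreal ((1 + \<delta>) ^ Suc DIM('a)) * ?I"
      by (subst nn_integral_cmult[symmetric]) (use W in \<open>auto simp: mult.assoc\<close>)
    finally show ?thesis .
  qed
  have "(\<lambda>k. ennreal ((1 + 1 / real (Suc k)) ^ Suc DIM('a)) * ?I) \<longlonglongrightarrow> ennreal ((1 + 0) ^ Suc DIM('a)) * ?I"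
    by (intro tendsto_mult_ennreal tendsto_const tendsto_ennrealI tendsto_power tendsto_add LIMSEQ_Suc lim_1_over_n) auto
  then have "(\<lambda>k. ennreal ((1 + 1 / real (Suc k)) ^ Suc DIM('a)) * ?I) \<longlonglongrightarrow> ?I" by simp
  then show ?thesis
    by (rule LIMSEQ_le_const) (intro exI allI impI *, simp)
qed

text \<open>The inequality for sets becomes one for measures: the Hausdorff measure on the graph,
  projected to the parameter domain, is at most the measure with the area density. Integrals of
  functions of the parameter follow by monotonicity in the measure.\<close>

lemma nn_integral_hausdorff_\<Gamma>_le:
  assumes W[measurable]: "W \<in> sets borel" and a[measurable]: "a \<in> borel_measurable borel"
    and y[measurable]: "y \<in> borel_measurable borel"
    and deriv: "\<And>w. w \<in> W \<Longrightarrow> (g has_derivative (\<lambda>z. a w \<bullet> z)) (at w)"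
  shows "(\<integral>\<^sup>+x\<in>\<Gamma> ` W. y (fst (T x)) \<partial>hausdorff_measure DIM('a))
    \<le> (\<integral>\<^sup>+w\<in>W. y w * ennreal (norm (a w, 1::real)) \<partial>lborel)"
proof -
  let ?H = "hausdorff_measure DIM('a) :: ('a \<times> real) measure"
  define \<rho> where "\<rho> = distr (density ?H (indicator (\<Gamma> ` W))) borel (\<lambda>x. fst (T x))"
  define \<mu> where "\<mu> = density lborel (\<lambda>w. ennreal (norm (a w, 1::real)) * indicator W w)"
  have [measurable]: "(\<lambda>x. fst (T x)) \<in> ?H \<rightarrow>\<^sub>M borel"
    by (rule borel_measurable_hausdorff) measurable
  have [measurable]: "indicator (\<Gamma> ` W) \<in> ?H \<rightarrow>\<^sub>M (borel :: ennreal measure)"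
    by (rule borel_measurable_hausdorff) measurable
  have sets: "sets \<rho> = sets \<mu>" by (simp add: \<rho>_def \<mu>_def)
  have "emeasure \<rho> X \<le> emeasure \<mu> X" for X
  proof (cases "X \<in> sets borel")
    case X[measurable]: True
    have Xpre: "(\<lambda>x. fst (T x)) -` X \<in> sets ?H"
      using measurable_sets[of "\<lambda>x. fst (T x)" ?H borel X] by simp
    have "emeasure \<rho> X = (\<integral>\<^sup>+x. indicator (\<Gamma> ` W) x * indicator ((\<lambda>x. fst (T x)) -` X) x \<partial>?H)"
      unfolding \<rho>_def using Xpre by (subst emeasure_distr) (auto simp: emeasure_density)
    also have "\<dots> = (\<integral>\<^sup>+x. indicator (\<Gamma> ` (W \<inter> X)) x \<partial>?H)"
      by (rule nn_integral_cong) (auto simp: \<Gamma>_image split: split_indicator)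
    also have "\<dots> = hausdorff_outer DIM('a) (\<Gamma> ` (W \<inter> X))"
      by (subst nn_integral_indicator)
         (auto intro!: emeasure_hausdorff_borel borel_subset_sets_hausdorff[THEN subsetD])
    also have "\<dots> \<le> (\<integral>\<^sup>+w\<in>W \<inter> X. ennreal (norm (a w, 1::real)) \<partial>lborel)"
      by (rule hausdorff_\<Gamma>_image_le[OF _ a deriv]) auto
    also have "\<dots> = emeasure \<mu> X"
      unfolding \<mu>_def by (subst emeasure_density) (auto simp: indicator_inter_arith mult.assoc)
    finally show ?thesis .
  next
    case False
    then have "X \<notin> sets \<rho>" by (simp add: \<rho>_def)
    then show ?thesis by (simp add: emeasure_notin_sets)
  qed
  then have "\<rho> \<le> \<mu>" using sets by (intro less_eq_measure.intros(3)) (auto simp: le_fun_def dest: sets_eq_imp_space_eq)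
  have "(\<integral>\<^sup>+x\<in>\<Gamma> ` W. y (fst (T x)) \<partial>?H) = (\<integral>\<^sup>+x. y (fst (T x)) \<partial>density ?H (indicator (\<Gamma> ` W)))"
    by (subst nn_integral_density) (auto simp: mult.commute)
  also have "\<dots> = (\<integral>\<^sup>+w. y w \<partial>\<rho>)" unfolding \<rho>_def by (subst nn_integral_distr) auto
  also have "\<dots> \<le> (\<integral>\<^sup>+w. y w \<partial>\<mu>)" by (rule nn_integral_mono_measure[OF sets \<open>\<rho> \<le> \<mu>\<close>])
  also have "\<dots> = (\<integral>\<^sup>+w\<in>W. y w * ennreal (norm (a w, 1::real)) \<partial>lborel)"
    unfolding \<mu>_def by (subst nn_integral_density) (auto simp: mult_ac)
  finally show ?thesis .
qed

end

subsection \<open>Outer normals of graphs\<close>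

text \<open>The graph itself is left undecided, because \<open>subgraph\<close> contains its top
  but, for open \<open>D\<close>, not its lateral boundary.\<close>

definition lies_below :: "('a \<times> real \<Rightarrow> 'a \<times> real) \<Rightarrow> ('a \<Rightarrow> real) \<Rightarrow> ('a \<times> real) set \<Rightarrow> ('a \<times> real) set \<Rightarrow> bool" where
  "lies_below T g U E \<longleftrightarrow>
     (\<forall>v s. T (v, s) \<in> U \<longrightarrow> (s < g v \<longrightarrow> T (v, s) \<in> E) \<and> (g v < s \<longrightarrow> T (v, s) \<notin> E))"

text \<open>Convergence in L1 says nothing about single points. But once blow-up and half-space
  differ on \<open>K\<close> by less than the volume of a ball of radius \<rho>, every such ball in
  \<open>K\<close> contains a point where they agree. The range of r does not depend on the centre
  \<open>c\<close>.\<close>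

lemma outer_normal_blowup:
  fixes E :: "'a::euclidean_space set"
  assumes "is_outer_normal E x \<nu>" and "\<rho> > 0"
  shows "\<forall>\<^sub>F r in at_right 0. \<forall>c. norm c \<le> R \<longrightarrow> (\<exists>z\<in>ball c \<rho>. x - r *\<^sub>R z \<in> E \<longleftrightarrow> 0 \<le> z \<bullet> \<nu>)"
proof -
  define A where "A = (\<lambda>r. (\<lambda>z. (x - z) /\<^sub>R r) ` E)"
  define B where "B = {z. z \<bullet> \<nu> \<ge> 0}"
  define K where "K = cball (0::'a) (R + \<rho>)"
  define m where "m = ennreal (unit_ball_vol (real DIM('a)) * \<rho> ^ DIM('a))"
  have "((\<lambda>r. \<integral>\<^sup>+y\<in>K. ennreal \<bar>indicat_real (A r) y - indicat_real B y\<bar> \<partial>lebesgue) \<longlongrightarrow> 0) (at_right 0)"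
    using assms(1) by (auto simp: is_outer_normal_def L1_loc_tendsto_at_0_def A_def B_def K_def)
  moreover have "0 < m" using \<open>\<rho> > 0\<close> by (simp add: m_def)
  ultimately have "\<forall>\<^sub>F r in at_right 0. (\<integral>\<^sup>+y\<in>K. ennreal \<bar>indicat_real (A r) y - indicat_real B y\<bar> \<partial>lebesgue) < m"
    by (rule order_tendstoD(2))
  then show ?thesis
    using eventually_at_right_less[of 0]
  proof eventually_elim
    case (elim r)
    show ?case
    proof (intro allI impI, rule ccontr)
      fix c :: 'a assume c: "norm c \<le> R" and *: "\<not> (\<exists>z\<in>ball c \<rho>. x - r *\<^sub>R z \<in> E \<longleftrightarrow> 0 \<le> z \<bullet> \<nu>)"
      have A_iff: "z \<in> A r \<longleftrightarrow> x - r *\<^sub>R z \<in> E" for z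
      proof
        assume "x - r *\<^sub>R z \<in> E"
        moreover have "z = (x - (x - r *\<^sub>R z)) /\<^sub>R r" using elim(2) by simp
        ultimately show "z \<in> A r" unfolding A_def by (rule rev_image_eqI)
      qed (use elim(2) in \<open>auto simp: A_def\<close>)
      have "m = (\<integral>\<^sup>+y. indicator (ball c \<rho>) y \<partial>lebesgue)"
        using \<open>\<rho> > 0\<close> by (simp add: m_def emeasure_ball)
      also have "\<dots> \<le> (\<integral>\<^sup>+y\<in>K. ennreal \<bar>indicat_real (A r) y - indicat_real B y\<bar> \<partial>lebesgue)"
      proof (rule nn_integral_mono)
        fix z
        show "indicator (ball c \<rho>) z \<le> ennreal \<bar>indicat_real (A r) z - indicat_real B z\<bar> * indicator K z"
        proof (cases "z \<in> ball c \<rho>")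
          case True
          then have "z \<in> K" using c norm_triangle_ineq2[of z c]
            by (auto simp: K_def dist_norm norm_minus_commute)
          then show ?thesis using * True by (auto simp: A_iff B_def indicator_def)
        qed simp
      qed
      finally show False using elim(1) by simp
    qed
  qed
qed

text \<open>The half-space contains the points near \<nu> and none near - \<nu>, so the blow-up
  yields points of \<open>E\<close> and points outside \<open>E\<close> arbitrarily close to
  x.\<close>

lemma is_outer_normal_imp_frontier:
  fixes E :: "'a::euclidean_space set"
  assumes "is_outer_normal E x \<nu>"
  shows "x \<in> frontier E"
proof (rule ccontr)
  assume "x \<notin> frontier E"
  then have "x \<in> interior E \<or> x \<in> interior (- E)" by (auto simp: frontier_def interior_closure)
  then obtain d where d: "d > 0" "ball x d \<subseteq> E \<or> ball x d \<subseteq> - E"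
    by (meson mem_interior)
  have \<nu>: "norm \<nu> = 1" using assms by (simp add: is_outer_normal_def)
  \<comment> \<open>Test points lie within 1/2 of a unit vector, hence have norm at most 3/2, and r
    < d / 2 keeps their rescalings in the ball of radius d.\<close>
  have "d / 2 > 0" using d by simp
  have "\<forall>\<^sub>F r in at_right 0. 0 < r \<and> r < d / 2 \<and>
      (\<forall>c. norm c \<le> 1 \<longrightarrow> (\<exists>z\<in>ball c (1/2). x - r *\<^sub>R z \<in> E \<longleftrightarrow> 0 \<le> z \<bullet> \<nu>))"
    using outer_normal_blowup[OF assms half_gt_zero[OF zero_less_one], of 1] eventually_at_right_less[of 0]
      eventually_at_right_real[OF \<open>d / 2 > 0\<close>]
    by eventually_elim auto
  then obtain r where r: "0 < r" "r < d / 2"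
      "\<And>c. norm c \<le> 1 \<Longrightarrow> \<exists>z\<in>ball c (1/2). x - r *\<^sub>R z \<in> E \<longleftrightarrow> 0 \<le> z \<bullet> \<nu>"
    using eventually_happens'[OF trivial_limit_at_right_real] by blast
  have near: "x - r *\<^sub>R z \<in> ball x d" if "z \<in> ball c (1/2)" "norm c = 1" for z c
  proof -
    have "norm z \<le> 3 / 2" using that norm_triangle_ineq2[of z c] by (auto simp: dist_norm norm_minus_commute)
    then have "r * norm z \<le> r * (3 / 2)" using r by (intro mult_left_mono) auto
    then have "r * norm z < d" using r by linarith
    then show ?thesis using r by (simp add: dist_norm)
  qed
  have inner: "\<bar>z \<bullet> \<nu> - c \<bullet> \<nu>\<bar> \<le> 1 / 2" if "z \<in> ball c (1/2)" for z c
  proof -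
    have "\<bar>(z - c) \<bullet> \<nu>\<bar> \<le> norm (z - c) * norm \<nu>" by (rule Cauchy_Schwarz_ineq2)
    then show ?thesis using that \<nu> by (simp add: inner_diff_left dist_norm norm_minus_commute)
  qed
  have \<nu>\<nu>: "\<nu> \<bullet> \<nu> = 1" using \<nu> by (simp add: norm_eq_1)
  obtain z where z: "z \<in> ball \<nu> (1/2)" "x - r *\<^sub>R z \<in> E \<longleftrightarrow> 0 \<le> z \<bullet> \<nu>"
    using r(3)[of \<nu>] \<nu> by auto
  obtain z' where z': "z' \<in> ball (- \<nu>) (1/2)" "x - r *\<^sub>R z' \<in> E \<longleftrightarrow> 0 \<le> z' \<bullet> \<nu>"
    using r(3)[of "- \<nu>"] \<nu> by auto
  have "x - r *\<^sub>R z \<in> E" "x - r *\<^sub>R z' \<notin> E"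
    using z z' inner[OF z(1)] inner[OF z'(1)] \<nu>\<nu> by auto
  moreover have "x - r *\<^sub>R z \<in> ball x d" by (rule near[OF z(1) \<nu>])
  moreover have "x - r *\<^sub>R z' \<in> ball x d" by (rule near[OF z'(1)]) (simp add: \<nu>)
  ultimately show False using d by blast
qed


text \<open>Lipschitz continuity enters twice. It puts a whole cone below the base point into
  \<open>E\<close>, so the half-space is not vertical and has the form t >= a . v; and it transfers
  what the blow-up reveals at some nearby point to the direction under consideration. A difference
  quotient away from a . z would leave room for a small ball between graph and hyperplane, on which
  subgraph and half-space disagree.\<close>

lemma (in rotated_graph) outer_normal_imp_derivative:
  assumes nu: "is_outer_normal E (\<Gamma> w) \<nu>" and \<delta>: "\<delta> > 0"
    and chart: "lies_below T g (ball (\<Gamma> w) \<delta>) E"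
    and lip: "L-lipschitz_on (ball w \<delta>) g"
  shows "\<exists>a. (g has_derivative (\<lambda>z. a \<bullet> z)) (at w) \<and> T (- a, 1) = norm (a, 1::real) *\<^sub>R \<nu>"
proof -
  obtain n' nN where n: "T \<nu> = (n', nN)" by (cases "T \<nu>")
  have "norm (T \<nu>) = 1" using nu by (simp add: norm_T is_outer_normal_def)
  then have n1: "(norm n')\<^sup>2 + nN\<^sup>2 = 1" by (simp add: n norm_Pair)
  have L: "L \<ge> 0" using lip by (rule lipschitz_on_nonneg)
  have blow: "\<forall>\<^sub>F r in at_right 0. 0 < r \<and> r * (R + \<rho>) < \<delta> \<and>
      (\<forall>v t. norm (v, t) \<le> R \<longrightarrow> (\<exists>v' t'. norm (v' - v, t' - t) < \<rho> \<and>
         (T (w - r *\<^sub>R v', g w - r * t') \<in> E \<longleftrightarrow> 0 \<le> v' \<bullet> n' + t' * nN)))"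
    if "\<rho> > 0" "R > 0" for \<rho> R
  proof -
    have "\<delta> / (R + \<rho>) > 0" using that \<delta> by simp
    show ?thesis
      using outer_normal_blowup[OF nu \<open>\<rho> > 0\<close>, of R] eventually_at_right_real[OF \<open>\<delta> / (R + \<rho>) > 0\<close>]
    proof eventually_elim
      case (elim r)
      have "\<exists>v' t'. norm (v' - v, t' - t) < \<rho> \<and>
         (T (w - r *\<^sub>R v', g w - r * t') \<in> E \<longleftrightarrow> 0 \<le> v' \<bullet> n' + t' * nN)" if vt: "norm (v, t) \<le> R" for v t
      proof -
        have "norm (T (v, t)) \<le> R" using vt by (simp add: norm_T)
        then obtain z where z: "z \<in> ball (T (v, t)) \<rho>" "\<Gamma> w - r *\<^sub>R z \<in> E \<longleftrightarrow> 0 \<le> z \<bullet> \<nu>"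
          using elim(1) by blast
        obtain v' t' where z': "T z = (v', t')" by (cases "T z")
        have "norm (v' - v, t' - t) = dist (T z) (v, t)" by (simp add: z' dist_norm)
        also have "\<dots> = dist z (T (v, t))" using dist_T[of z "T (v, t)"] by simp
        finally have 1: "norm (v' - v, t' - t) < \<rho>" using z(1) by (simp add: dist_commute)
        have 2: "\<Gamma> w - r *\<^sub>R z = T (w - r *\<^sub>R v', g w - r * t')"
          by (subst T_eq_iff[symmetric]) (simp add: T_diff T_scaleR z')
        have 3: "z \<bullet> \<nu> = v' \<bullet> n' + t' * nN"
          using inner_T_T[of z \<nu>] by (simp add: z' n)
        show ?thesis using 1 z(2) unfolding 2 3 by blast
      qed
      then show ?case using elim(2) that by (auto simp: field_simps)
    qed
  qed
  have chart': "(t' < q \<longrightarrow> T (w - r *\<^sub>R v', g w - r * t') \<notin> E) \<and> (q < t' \<longrightarrow> T (w - r *\<^sub>R v', g w - r * t') \<in> E)"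
    if "norm (v', t') < R + \<rho>" "r * (R + \<rho>) < \<delta>" "r > 0" "q * r = g w - g (w - r *\<^sub>R v')" for v' t' q r R \<rho>
  proof -
    have "r * norm (v', t') \<le> r * (R + \<rho>)" using that by (intro mult_left_mono) auto
    moreover have "dist (\<Gamma> w) (T (w - r *\<^sub>R v', g w - r * t')) = norm (r *\<^sub>R (v', t'))"
      unfolding \<Gamma>_def dist_T by (simp add: dist_norm)
    moreover have "norm (r *\<^sub>R (v', t')) = r * norm (v', t')"
      unfolding norm_scaleR using that by simp
    ultimately have "T (w - r *\<^sub>R v', g w - r * t') \<in> ball (\<Gamma> w) \<delta>"
      unfolding mem_ball using that by linarith
    note c = chart[unfolded lies_below_def, rule_format, OF this]
    have "t' < q \<longleftrightarrow> g (w - r *\<^sub>R v') < g w - r * t'" "q < t' \<longleftrightarrow> g w - r * t' < g (w - r *\<^sub>R v')"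
      using mult_less_cancel_right_pos[OF that(3), of t' q] mult_less_cancel_right_pos[OF that(3), of q t'] that(4)
      by (auto simp: mult.commute)
    with c show ?thesis by simp
  qed
  have lip': "\<bar>g (w - r *\<^sub>R u) - g (w - r *\<^sub>R v)\<bar> \<le> L * r * norm (u - v)"
    if "r * norm u < \<delta>" "r * norm v < \<delta>" "r > 0" for u v r
  proof -
    have "w - r *\<^sub>R u \<in> ball w \<delta>" "w - r *\<^sub>R v \<in> ball w \<delta>" using that by (simp_all add: dist_norm)
    from lipschitz_onD[OF lip this] have "\<bar>g (w - r *\<^sub>R u) - g (w - r *\<^sub>R v)\<bar> \<le> L * norm (r *\<^sub>R (v - u))"
      by (simp add: dist_norm scaleR_diff_right)
    then show ?thesis using that by (simp add: norm_minus_commute mult.assoc)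
  qed
  \<comment> \<open>Blow-ups are reflected, so a large \<open>s\<close> means a point far below the
    graph, which lies in \<open>E\<close>.\<close>
  have cone: "0 \<le> v \<bullet> n' + s * nN" if vs: "s > (L + 1) * norm v" for v s
  proof (rule ccontr)
    assume "\<not> 0 \<le> v \<bullet> n' + s * nN"
    define U where "U = {p. (L + 1) * norm (fst p) < snd p} \<inter> {p. fst p \<bullet> n' + snd p * nN < 0}"
    have "open U" unfolding U_def by (intro open_Int open_Collect_less continuous_intros)
    moreover have "(v, s) \<in> U" using vs \<open>\<not> _\<close> by (simp add: U_def)
    ultimately obtain \<rho> where \<rho>: "\<rho> > 0" "ball (v, s) \<rho> \<subseteq> U" using openE by blast
    define R where "R = norm (v, s) + 1"
    have "R > 0" by (simp add: R_def add_nonneg_pos)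
    obtain r where r: "0 < r" "r * (R + \<rho>) < \<delta>"
        "\<And>v t. norm (v, t) \<le> R \<Longrightarrow> (\<exists>v' t'. norm (v' - v, t' - t) < \<rho> \<and>
         (T (w - r *\<^sub>R v', g w - r * t') \<in> E \<longleftrightarrow> 0 \<le> v' \<bullet> n' + t' * nN))"
      using eventually_happens'[OF trivial_limit_at_right_real blow[OF \<open>\<rho> > 0\<close> \<open>R > 0\<close>]] by blast
    obtain v' t' where v': "norm (v' - v, t' - s) < \<rho>"
         "T (w - r *\<^sub>R v', g w - r * t') \<in> E \<longleftrightarrow> 0 \<le> v' \<bullet> n' + t' * nN"
      using r(3)[of v s] by (auto simp: R_def)
    have "(v', t') \<in> ball (v, s) \<rho>" using v'(1) norm_minus_commute[of "(v, s)" "(v', t')"] by (simp add: dist_norm)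
    then have U: "(L + 1) * norm v' < t'" "v' \<bullet> n' + t' * nN < 0" using \<rho> by (auto simp: U_def)
    have nv': "norm (v', t') < R + \<rho>"
      using v'(1) norm_triangle_ineq[of "(v, s)" "(v' - v, t' - s)"] by (simp add: R_def)
    have "norm v' \<le> norm (v', t')" by (simp add: norm_fst_le)
    then have "r * norm v' \<le> r * (R + \<rho>)" using nv' r(1) by (intro mult_left_mono) auto
    then have "r * norm v' < \<delta>" using r(2) by simp
    define q where "q = (g w - g (w - r *\<^sub>R v')) / r"
    have "g w - g (w - r *\<^sub>R v') \<le> L * r * norm v'"
      using lip'[of r 0 v'] \<open>r * norm v' < \<delta>\<close> r(1) \<delta> by auto
    then have "q \<le> L * norm v'" using r(1) by (simp add: q_def field_simps)
    also have "\<dots> \<le> (L + 1) * norm v'" by (simp add: distrib_right)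
    also have "\<dots> < t'" by (rule U)
    finally have "T (w - r *\<^sub>R v', g w - r * t') \<in> E"
      using chart'[OF nv' r(2,1), of q] r(1) by (simp add: q_def)
    then show False using v'(2) U(2) by simp
  qed
  \<comment> \<open>If the normal were horizontal, the cone would contain a vector with first
    component - n', on which the linear form has the value -1.\<close>
  have "nN > 0"
  proof (rule ccontr)
    assume "\<not> nN > 0"
    moreover have "nN \<ge> 0" using cone[of 0 1] by simp
    ultimately have [simp]: "nN = 0" by simp
    have "0 \<le> - n' \<bullet> n'" using cone[of "- n'" "(L + 1) * norm n' + 1"] by simp
    moreover have "n' \<bullet> n' = 1" using n1 by (simp add: power2_norm_eq_inner)
    ultimately show False by simp
  qed
  define a where "a = - n' /\<^sub>R nN"
  define C where "C = norm a"
  have half: "v \<bullet> n' + t * nN = nN * (t - a \<bullet> v)" for v t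
    using \<open>nN > 0\<close> by (simp add: a_def algebra_simps inner_commute)
  have deriv: "(g has_derivative (\<lambda>z. a \<bullet> z)) (at w)"
    unfolding has_derivative_at_alt
  proof (intro conjI allI impI)
    show "bounded_linear ((\<bullet>) a)" by (rule bounded_linear_inner_right)
    fix \<eta> :: real assume \<eta>: "\<eta> > 0"
    \<comment> \<open>\<rho> bounds the displacement of the test point. It changes \<open>t\<close>
      by at most \<rho>, the quotient by L \<rho> and a . z by C \<rho>; together this is \<eta> /
      4, below the gap \<eta> / 2 kept on both sides of \<open>t\<close>. \<open>R\<close> is large
      enough for all (z, t) that occur.\<close>
    define \<rho> where "\<rho> = \<eta> / (4 * (1 + L + C))"
    define R where "R = 2 + C + \<eta>"
    have "C \<ge> 0" by (simp add: C_def)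
    have "\<rho> > 0" "R > 0" using \<eta> L \<open>C \<ge> 0\<close> by (simp_all add: \<rho>_def R_def add_pos_nonneg)
    have \<rho>\<eta>: "\<rho> + L * \<rho> + C * \<rho> = \<eta> / 4"
    proof -
      have "1 + L + C > 0" using L \<open>C \<ge> 0\<close> by simp
      then have "\<rho> * (1 + L + C) = \<eta> / 4" by (simp add: \<rho>_def field_simps)
      then show ?thesis by (simp add: algebra_simps)
    qed
    obtain d where d: "d > 0" and D: "\<And>r. 0 < r \<Longrightarrow> r < d \<Longrightarrow> 0 < r \<and> r * (R + \<rho>) < \<delta> \<and>
      (\<forall>v t. norm (v, t) \<le> R \<longrightarrow> (\<exists>v' t'. norm (v' - v, t' - t) < \<rho> \<and>
         (T (w - r *\<^sub>R v', g w - r * t') \<in> E \<longleftrightarrow> 0 \<le> v' \<bullet> n' + t' * nN)))"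
      using blow[OF \<open>\<rho> > 0\<close> \<open>R > 0\<close>] unfolding eventually_at_right_field by blast
    show "\<exists>d>0. \<forall>y. norm (y - w) < d \<longrightarrow> norm (g y - g w - a \<bullet> (y - w)) \<le> \<eta> * norm (y - w)"
    proof (intro exI[of _ d] conjI allI impI d)
      fix y assume y: "norm (y - w) < d"
      show "norm (g y - g w - a \<bullet> (y - w)) \<le> \<eta> * norm (y - w)"
      proof (cases "y = w")
        case False
        define r where "r = norm (y - w)"
        define z where "z = (w - y) /\<^sub>R r"
        define q where "q = (g w - g (w - r *\<^sub>R z)) / r"
        have r: "0 < r" "r < d" using False y by (simp_all add: r_def)
        note Dr = D[OF r]
        have z: "norm z = 1" "w - r *\<^sub>R z = y" using r by (simp_all add: z_def r_def norm_minus_commute[of w y])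
        have az: "\<bar>a \<bullet> z\<bar> \<le> C" using Cauchy_Schwarz_ineq2[of a z] z by (simp add: C_def)
        \<comment> \<open>\<sigma> records on which side the quotient fails. The height
          \<open>t\<close> lies \<eta> / 2 away from a . z towards \<open>q\<close>, so graph and
          half-space give opposite answers at the nearby test point (v', t').\<close>
        have key: False if sg: "\<sigma> = 1 \<or> \<sigma> = -1" and bad: "\<sigma> * (q - a \<bullet> z) > \<eta>" for \<sigma> :: real
        proof -
          define t where "t = a \<bullet> z + \<sigma> * \<eta> / 2"
          have "norm (z, t) \<le> norm z + norm t" by (rule norm_Pair_le)
          then have zt: "norm (z, t) \<le> R"
            using az z sg \<eta> by (auto simp: t_def R_def)
          then obtain v' t' where v': "norm (v' - z, t' - t) < \<rho>"
              "T (w - r *\<^sub>R v', g w - r * t') \<in> E \<longleftrightarrow> 0 \<le> v' \<bullet> n' + t' * nN"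
            using Dr by blast
          have nv: "norm (v' - z) < \<rho>" "\<bar>t' - t\<bar> < \<rho>"
            using v'(1) norm_fst_le[of "v' - z" "t' - t"] norm_snd_le[of "t' - t" "v' - z"] by auto
          have nv': "norm (v', t') < R + \<rho>"
            using v'(1) norm_triangle_ineq[of "(z, t)" "(v' - z, t' - t)"] zt by simp
          have "norm v' \<le> norm (v', t')" by (simp add: norm_fst_le)
          then have "r * norm v' \<le> r * (R + \<rho>)" using nv' r(1) by (intro mult_left_mono) auto
          then have rv': "r * norm v' < \<delta>" using Dr by linarith
          have "1 \<le> R + \<rho>" using \<open>\<rho> > 0\<close> \<eta> \<open>C \<ge> 0\<close> by (simp add: R_def)
          then have "r * 1 \<le> r * (R + \<rho>)" using r(1) by (intro mult_left_mono) auto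
          then have rz: "r * norm z < \<delta>" using Dr unfolding z(1) by linarith
          define q' where "q' = (g w - g (w - r *\<^sub>R v')) / r"
          have "\<bar>q - q'\<bar> = \<bar>g (w - r *\<^sub>R v') - g (w - r *\<^sub>R z)\<bar> / r"
            using r(1) by (simp add: q_def q'_def diff_divide_distrib[symmetric])
          also have "\<dots> \<le> L * norm (v' - z)"
            using lip'[OF rv' rz r(1)] r(1) by (simp add: field_simps)
          also have "\<dots> \<le> L * \<rho>" using nv L by (intro mult_left_mono) auto
          finally have qq: "\<bar>q - q'\<bar> \<le> L * \<rho>" .
          have "\<bar>a \<bullet> (v' - z)\<bar> \<le> C * norm (v' - z)" unfolding C_def by (rule Cauchy_Schwarz_ineq2)
          also have "\<dots> \<le> C * \<rho>" using nv \<open>C \<ge> 0\<close> by (intro mult_left_mono) auto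
          finally have aa: "\<bar>a \<bullet> v' - a \<bullet> z\<bar> \<le> C * \<rho>" by (simp add: inner_diff_right)
          have "0 \<le> L * \<rho>" "0 \<le> C * \<rho>" using L \<open>C \<ge> 0\<close> \<open>\<rho> > 0\<close> by simp_all
          note * = this qq aa nv(2) \<rho>\<eta> \<eta> \<open>\<rho> > 0\<close>
          have pos: "0 < \<sigma> * (t' - a \<bullet> v')" "0 < \<sigma> * (q' - t')"
          proof -
            consider "\<sigma> = 1" "q - a \<bullet> z > \<eta>" "t = a \<bullet> z + \<eta> / 2" | "\<sigma> = -1" "a \<bullet> z - q > \<eta>" "t = a \<bullet> z - \<eta> / 2"
              using sg bad by (auto simp: t_def)
            then have "0 < \<sigma> * (t' - a \<bullet> v') \<and> 0 < \<sigma> * (q' - t')"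
            proof cases
              case 1
              have "0 < t' - a \<bullet> v'" "0 < q' - t'" using * 1(2,3) by linarith+
              then show ?thesis using 1(1) by simp
            next
              case 2
              have "0 < a \<bullet> v' - t'" "0 < t' - q'" using * 2(2,3) by linarith+
              then show ?thesis using 2(1) by simp
            qed
            then show "0 < \<sigma> * (t' - a \<bullet> v')" "0 < \<sigma> * (q' - t')" by auto
          qed
          have E: "(t' < q' \<longrightarrow> T (w - r *\<^sub>R v', g w - r * t') \<notin> E) \<and>
              (q' < t' \<longrightarrow> T (w - r *\<^sub>R v', g w - r * t') \<in> E)"
            by (rule chart'[OF nv']) (use Dr r(1) in \<open>auto simp: q'_def\<close>)
          show False
            using sg
          proof
            assume "\<sigma> = 1"
            then have "0 \<le> v' \<bullet> n' + t' * nN" unfolding half using pos \<open>nN > 0\<close> by simp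
            then show False using v'(2) E pos \<open>\<sigma> = 1\<close> by simp
          next
            assume "\<sigma> = -1"
            then have "v' \<bullet> n' + t' * nN < 0" unfolding half using pos \<open>nN > 0\<close> by (simp add: mult_pos_neg)
            then show False using v'(2) E pos \<open>\<sigma> = -1\<close> by simp
          qed
        qed
        have "q - a \<bullet> z \<le> \<eta>" by (rule ccontr) (use key[of 1] in simp)
        moreover have "- (q - a \<bullet> z) \<le> \<eta>" by (rule ccontr) (use key[of "-1"] in simp)
        ultimately have "\<bar>q - a \<bullet> z\<bar> \<le> \<eta>" by (simp add: abs_le_iff)
        then have "r * \<bar>q - a \<bullet> z\<bar> \<le> r * \<eta>" using r(1) by (intro mult_left_mono) auto
        moreover have "r * (q - a \<bullet> z) = - (g y - g w - a \<bullet> (y - w))"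
          using r(1) z(2) by (simp add: q_def z_def inner_diff_right field_simps)
        then have "r * \<bar>q - a \<bullet> z\<bar> = \<bar>g y - g w - a \<bullet> (y - w)\<bar>"
          using r(1) by (metis abs_minus_cancel abs_mult abs_of_pos)
        ultimately show ?thesis by (simp add: r_def mult.commute)
      qed simp
    qed
  qed
  have "nN *\<^sub>R (- a, 1) = T \<nu>" using \<open>nN > 0\<close> by (simp add: n a_def)
  then have eq: "nN *\<^sub>R T (- a, 1) = \<nu>" by (simp only: T_scaleR[symmetric] T_T)
  have "nN * norm (a, 1::real) = norm \<nu>"
    using \<open>nN > 0\<close> by (simp add: norm_T norm_Pair flip: eq)
  then have "nN * norm (a, 1::real) = 1" using nu by (simp add: is_outer_normal_def)
  then have "norm (a, 1::real) *\<^sub>R \<nu> = T (- a, 1)"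
    by (simp add: mult.commute flip: eq)
  with deriv show ?thesis by metis
qed

text \<open>\<open>outer_normal\<close> is a definite description. Each candidate normal determines
  a gradient of \<open>g\<close> at \<open>w\<close>, and the uniqueness of derivatives makes the
  normal unique.\<close>

lemma (in rotated_graph) outer_normal_eq:
  assumes rb: "\<Gamma> w \<in> reduced_boundary E" and \<delta>: "\<delta> > 0"
    and chart: "lies_below T g (ball (\<Gamma> w) \<delta>) E"
    and lip: "L-lipschitz_on (ball w \<delta>) g"
  shows "\<exists>a. (g has_derivative (\<lambda>z. a \<bullet> z)) (at w) \<and>
    outer_normal E (\<Gamma> w) = T (- a, 1) /\<^sub>R norm (a, 1::real)"
proof -
  note D = outer_normal_imp_derivative[OF _ \<delta> chart lip]
  obtain \<nu> where \<nu>: "is_outer_normal E (\<Gamma> w) \<nu>" using rb by (auto simp: reduced_boundary_def)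
  obtain a where a: "(g has_derivative (\<lambda>z. a \<bullet> z)) (at w)" "T (- a, 1) = norm (a, 1::real) *\<^sub>R \<nu>"
    using D[OF \<nu>] by auto
  have pos: "norm (a, 1::real) \<noteq> 0" by (simp add: zero_prod_def)
  have "outer_normal E (\<Gamma> w) = \<nu>"
    unfolding outer_normal_def
  proof (rule the_equality)
    show "is_outer_normal E (\<Gamma> w) \<nu>" by (rule \<nu>)
    fix \<nu>' assume "is_outer_normal E (\<Gamma> w) \<nu>'"
    then obtain a' where a': "(g has_derivative (\<lambda>z. a' \<bullet> z)) (at w)" "T (- a', 1) = norm (a', 1::real) *\<^sub>R \<nu>'"
      using D by blast
    have "(\<lambda>z. a \<bullet> z) = (\<lambda>z. a' \<bullet> z)" by (rule has_derivative_unique[OF a(1) a'(1)])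
    then have "a = a'" by (metis inner_commute vector_eq_rdot)
    then have "norm (a, 1::real) *\<^sub>R \<nu>' = norm (a, 1::real) *\<^sub>R \<nu>" using a(2) a'(2) by simp
    then show "\<nu>' = \<nu>" using pos by simp
  qed
  then show ?thesis using a pos by (intro exI[of _ a]) simp
qed

subsection \<open>Lower bound in a chart\<close>

locale interaction_kernel =
  fixes G :: "'a::euclidean_space \<Rightarrow> real" and f :: "real \<Rightarrow> real"
  assumes G_nonneg: "0 \<le> G x"
    and G_measurable [measurable]: "G \<in> borel_measurable borel"
    and G_integrable: "integrable lborel G"
    and f_continuous: "continuous_on {0..} f"
    and f_nonneg: "0 \<le> t \<Longrightarrow> 0 \<le> f t"
begin

text \<open>Continuity of \<open>f\<close> is known on the half-line only, so measurability goes
  through the continuous extension t |-> f (max 0 t).\<close>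

lemma measurable_f_comp:
  assumes [measurable]: "h \<in> borel_measurable M" and "\<And>x. 0 \<le> h x"
  shows "(\<lambda>x. f (h x)) \<in> borel_measurable M"
proof -
  have "continuous_on UNIV (\<lambda>t. f (max 0 t))"
    by (rule continuous_on_compose2[OF f_continuous]) (auto intro!: continuous_intros)
  then have [measurable]: "(\<lambda>t. f (max 0 t)) \<in> borel_measurable borel"
    by (rule borel_measurable_continuous_onI)
  have "(\<lambda>x. f (max 0 (h x))) \<in> borel_measurable M" by measurable
  then show ?thesis using assms(2) by (simp add: max_absorb2)
qed

definition mass :: "'a \<Rightarrow> real \<Rightarrow> real" where
  "mass \<nu> t = (\<integral>z. (if t \<le> z \<bullet> \<nu> then G z else 0) \<partial>lborel)"

text \<open>\<open>theta\<close> with the range of integration extended to the whole half-line, so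
  that multiplying \<nu> by a constant becomes a mere substitution in t.\<close>

definition tension :: "'a \<Rightarrow> ennreal" where
  "tension \<nu> = (\<integral>\<^sup>+t\<in>{0<..}. ennreal (f (mass \<nu> t)) \<partial>lborel)"

definition weighted_energy :: "('a \<Rightarrow> ennreal) \<Rightarrow> 'a set \<Rightarrow> real \<Rightarrow> 'a set \<Rightarrow> ennreal" where
  "weighted_energy \<phi> \<Omega> \<epsilon> E = ennreal (1 / \<epsilon>) * (\<integral>\<^sup>+x\<in>- E \<inter> \<Omega>.
     \<phi> x * ennreal (f (convolution (rescaled G \<epsilon>) (indicat_real (E \<inter> \<Omega>)) x)) \<partial>lborel)"

text \<open>One piece of the boundary: \<open>\<phi>\<close> cuts out a part of the domain of integration of \<^const>\<open>F_eps\<close>, and \<open>Y\<close> is a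
  measurable majorant of \<open>\<phi> \<theta>(\<nu>)\<close>, which need not be measurable itself.\<close>

definition charted :: "('a \<Rightarrow> ennreal) \<Rightarrow> 'a set \<Rightarrow> (nat \<Rightarrow> real) \<Rightarrow> (nat \<Rightarrow> 'a set) \<Rightarrow> 'a set \<Rightarrow> 'a set \<Rightarrow> bool" where
  "charted \<phi> \<Omega> \<epsilon> E E0 S \<longleftrightarrow> (\<exists>Y\<in>borel_measurable borel.
     (\<integral>\<^sup>+x. Y x \<partial>hausdorff_measure (DIM('a) - 1)) \<le> liminf (\<lambda>h. weighted_energy \<phi> \<Omega> (\<epsilon> h) (E h)) \<and>
     (\<forall>x\<in>S. \<phi> x * tension (outer_normal E0 x) \<le> Y x))"

text \<open>Points where \<phi> vanishes satisfy the majorant condition by Y >= 0, even if the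
  tension there is infinite, since 0 times infinity is 0.\<close>

lemma charted_subset:
  assumes "charted \<phi> \<Omega> \<epsilon> E E0 S" "\<And>x. x \<in> S' \<Longrightarrow> \<phi> x \<noteq> 0 \<Longrightarrow> x \<in> S"
  shows "charted \<phi> \<Omega> \<epsilon> E E0 S'"
  using assms unfolding charted_def by (metis mult_zero_left zero_le)

lemma mass_nonneg: "0 \<le> mass \<nu> t"
  unfolding mass_def by (intro Bochner_Integration.integral_nonneg) (simp add: G_nonneg)

lemma measurable_mass [measurable (raw)]:
  assumes [measurable]: "p \<in> borel_measurable M" "q \<in> borel_measurable M"
  shows "(\<lambda>x. mass (p x) (q x)) \<in> borel_measurable M"
  unfolding mass_def by measurable

lemma measurable_tension [measurable]: "tension \<in> borel_measurable borel"
proof -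
  have [measurable]: "(\<lambda>x. f (mass (fst x) (snd x))) \<in> borel_measurable (borel \<Otimes>\<^sub>M lborel)"
    by (rule measurable_f_comp) (auto simp: mass_nonneg)
  have "(\<lambda>\<nu>. \<integral>\<^sup>+t. ennreal (f (mass (fst (\<nu>, t)) (snd (\<nu>, t)))) * indicator {0<..} t \<partial>lborel) \<in> borel_measurable borel"
    by measurable
  then show ?thesis by (simp add: tension_def[abs_def])
qed

lemma theta_le_tension: "ennreal (theta f G \<nu>) \<le> tension \<nu>"
proof -
  have inner: "(LINT x:{x. x \<bullet> \<nu> \<ge> t}|lebesgue. G x) = mass \<nu> t" for t
  proof -
    have "(LINT x:{x. x \<bullet> \<nu> \<ge> t}|lebesgue. G x) = (\<integral>x. (if t \<le> x \<bullet> \<nu> then G x else 0) \<partial>lebesgue)"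
      unfolding set_lebesgue_integral_def by (intro Bochner_Integration.integral_cong) auto
    also have "\<dots> = mass \<nu> t" unfolding mass_def by (rule integral_completion) measurable
    finally show ?thesis .
  qed
  define h where "h t = indicat_real {0..1} t *\<^sub>R f (mass \<nu> t)" for t
  have h0: "h t \<ge> 0" for t by (simp add: h_def f_nonneg mass_nonneg)
  have th: "theta f G \<nu> = (\<integral>t. h t \<partial>lebesgue)"
    unfolding theta_def inner by (simp add: set_lebesgue_integral_def h_def)
  show ?thesis
  proof (cases "integrable lebesgue h")
    case True
    then have "ennreal (theta f G \<nu>) = (\<integral>\<^sup>+t. ennreal (h t) \<partial>lebesgue)"
      unfolding th using h0 by (intro nn_integral_eq_integral[symmetric]) auto
    also have "\<dots> = (\<integral>\<^sup>+t. ennreal (h t) \<partial>lborel)" by (rule nn_integral_completion)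
    also have "\<dots> \<le> tension \<nu>"
      unfolding tension_def
    proof (rule nn_integral_mono_AE)
      show "AE t in lborel. ennreal (h t) \<le> ennreal (f (mass \<nu> t)) * indicator {0<..} t"
        using AE_lborel_singleton[of "0::real"]
        by eventually_elim (auto simp: h_def split: split_indicator)
    qed
    finally show ?thesis .
  next
    \<comment> \<open>\<open>theta\<close> then has the default value 0 of a non-integrable
      integral.\<close>
    case False
    then show ?thesis by (simp add: th not_integrable_integral_eq)
  qed
qed

text \<open>Graph coordinates produce the vector (- a, 1) in place of the unit normal; with
  \<open>c\<close> its length, the factor that appears here is exactly the area density of the
  graph.\<close>

lemma tension_scale:
  assumes "c > 0"
  shows "(\<integral>\<^sup>+s\<in>{0<..}. ennreal (f (mass (c *\<^sub>R \<nu>) s)) \<partial>lborel) = ennreal c * tension \<nu>"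
proof -
  have [measurable]: "(\<lambda>s. f (mass (c *\<^sub>R \<nu>) s)) \<in> borel_measurable borel"
    by (rule measurable_f_comp) (auto simp: mass_nonneg)
  have "(\<integral>\<^sup>+s\<in>{0<..}. ennreal (f (mass (c *\<^sub>R \<nu>) s)) \<partial>lborel)
      = \<bar>c\<bar> * (\<integral>\<^sup>+t. ennreal (f (mass (c *\<^sub>R \<nu>) (0 + c * t))) * indicator {0<..} (0 + c * t) \<partial>lborel)"
    by (rule nn_integral_real_affine) (use assms in auto)
  also have "(\<integral>\<^sup>+t. ennreal (f (mass (c *\<^sub>R \<nu>) (0 + c * t))) * indicator {0<..} (0 + c * t) \<partial>lborel) = tension \<nu>"
    unfolding tension_def using assms
    by (intro nn_integral_cong) (auto split: split_indicator simp: zero_less_mult_iff mass_def)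
  finally show ?thesis using assms by simp
qed

text \<open>The substitution y = x - \<epsilon> z cancels the power of \<epsilon>, so that the scale
  enters only through the blow-up of \<open>E\<close> at x.\<close>

lemma convolution_rescaled:
  assumes [measurable]: "E \<in> sets borel" and "\<epsilon> > 0"
  shows "convolution (rescaled G \<epsilon>) (indicat_real E) x = (\<integral>z. G z * indicat_real E (x - \<epsilon> *\<^sub>R z) \<partial>lborel)"
proof -
  let ?n = "DIM('a)"
  let ?h = "\<lambda>y. rescaled G \<epsilon> (x - y) * indicat_real E y"
  have [measurable]: "?h \<in> borel_measurable borel" unfolding rescaled_def by measurable
  have lb: "lborel = density (distr lborel borel (\<lambda>z. x + (- \<epsilon>) *\<^sub>R z)) (\<lambda>_. ennreal (\<bar>- \<epsilon>\<bar> ^ ?n))"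
    by (rule lborel_affine) (use assms in simp)
  have "convolution (rescaled G \<epsilon>) (indicat_real E) x = (\<integral>y. ?h y \<partial>lborel)"
    unfolding convolution_def by (rule integral_completion) measurable
  also have "\<dots> = (\<integral>y. ?h y \<partial>density (distr lborel borel (\<lambda>z. x + (- \<epsilon>) *\<^sub>R z)) (\<lambda>_. ennreal (\<bar>- \<epsilon>\<bar> ^ ?n)))"
    by (rule arg_cong[OF lb])
  also have "\<dots> = (\<integral>y. (\<bar>- \<epsilon>\<bar> ^ ?n) *\<^sub>R ?h y \<partial>distr lborel borel (\<lambda>z. x + (- \<epsilon>) *\<^sub>R z))"
    by (rule integral_density) auto
  also have "\<dots> = (\<integral>z. (\<bar>- \<epsilon>\<bar> ^ ?n) *\<^sub>R ?h (x + (- \<epsilon>) *\<^sub>R z) \<partial>lborel)"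
    by (rule integral_distr) auto
  also have "\<dots> = (\<integral>z. G z * indicat_real E (x - \<epsilon> *\<^sub>R z) \<partial>lborel)"
    by (rule Bochner_Integration.integral_cong) (use \<open>\<epsilon> > 0\<close> in \<open>auto simp: rescaled_def\<close>)
  finally show ?thesis .
qed

lemma convolution_nonneg:
  assumes "E \<in> sets borel" and "\<epsilon> > 0"
  shows "0 \<le> convolution (rescaled G \<epsilon>) (indicat_real E) x"
  unfolding convolution_rescaled[OF assms] by (intro Bochner_Integration.integral_nonneg) (simp add: G_nonneg)

lemma measurable_convolution:
  assumes [measurable]: "E \<in> sets borel" and "\<epsilon> > 0"
  shows "convolution (rescaled G \<epsilon>) (indicat_real E) \<in> borel_measurable borel"
  unfolding convolution_rescaled[OF assms, abs_def] by measurable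

end

locale rotated_kernel = linear_involutive_isometry T + interaction_kernel G f
  for T :: "'a::euclidean_space \<times> real \<Rightarrow> 'a \<times> real" and G :: "'a \<times> real \<Rightarrow> real" and f
begin

text \<open>With T z = (z', t), the displaced sample point lies below the graph of
  \<open>gs h\<close> iff a difference quotient in the direction - z' exceeds s - t. The limit of
  the quotients decides this off a hyperplane, and dominated convergence with majorant
  \<open>G\<close> applies.\<close>

lemma convolution_limit:
  fixes gs :: "nat \<Rightarrow> 'a \<Rightarrow> real"
  assumes \<epsilon>: "\<And>h. \<epsilon> h > 0" "\<epsilon> \<longlonglongrightarrow> 0" and E[measurable]: "\<And>h. E h \<in> sets borel"
    and \<Omega>: "open \<Omega>" "T (w, y) \<in> \<Omega>" and gs: "(\<lambda>h. gs h w) \<longlonglongrightarrow> y"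
    and quot: "\<And>z. (\<lambda>h. (gs h (w - \<epsilon> h *\<^sub>R z) - gs h w) / \<epsilon> h) \<longlonglongrightarrow> - (a \<bullet> z)"
    and "\<delta> > 0" and chart: "\<forall>\<^sub>F h in sequentially. lies_below T (gs h) (ball (T (w, y)) \<delta>) (E h)"
  shows "(\<lambda>h. convolution (rescaled G (\<epsilon> h)) (indicat_real (E h \<inter> \<Omega>)) (T (w, gs h w + \<epsilon> h * s)))
      \<longlonglongrightarrow> mass (T (- a, 1)) s"
proof -
  define p where "p h = T (w, gs h w + \<epsilon> h * s)" for h
  have [measurable]: "\<Omega> \<in> sets borel" using \<Omega> by simp
  have pt: "(\<lambda>h. T (w - \<epsilon> h *\<^sub>R z', gs h w + \<epsilon> h * s - \<epsilon> h * t)) \<longlonglongrightarrow> T (w, y)" for z' t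
  proof -
    have "(\<lambda>h. (w - \<epsilon> h *\<^sub>R z', gs h w + \<epsilon> h * s - \<epsilon> h * t)) \<longlonglongrightarrow> (w - 0 *\<^sub>R z', y + 0 * s - 0 * t)"
      by (intro tendsto_intros \<epsilon> gs)
    then show ?thesis
      using continuous_on_tendsto_compose[OF continuous_T[of UNIV], of _ "(w, y)" sequentially] by simp
  qed
  have "(\<lambda>h. \<integral>z. G z * indicat_real (E h \<inter> \<Omega>) (p h - \<epsilon> h *\<^sub>R z) \<partial>lborel)
      \<longlonglongrightarrow> (\<integral>z. (if s \<le> z \<bullet> T (- a, 1) then G z else 0) \<partial>lborel)"
  proof (rule integral_dominated_convergence[where w = G])
    \<comment> \<open>On this hyperplane the limit quotient equals the threshold and the indicator
      may oscillate; it is a null set.\<close>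
    let ?N = "{z. T (- a, 1) \<bullet> z = s}"
    have "T (- a, 1) \<noteq> 0" using norm_T[of "(- a, 1)"] by (auto simp: zero_prod_def)
    then have "negligible ?N" by (intro negligible_hyperplane) auto
    then have "emeasure lebesgue ?N = 0" by (simp add: negligible_iff_emeasure0 negligible_imp_sets)
    moreover have N: "?N \<in> sets borel"
      by (rule borel_closed) (rule closed_hyperplane)
    ultimately have "?N \<in> null_sets lborel" by auto
    then have "AE z in lborel. z \<notin> ?N" by (rule AE_not_in)
    then show "AE z in lborel. (\<lambda>h. G z * indicat_real (E h \<inter> \<Omega>) (p h - \<epsilon> h *\<^sub>R z))
        \<longlonglongrightarrow> (if s \<le> z \<bullet> T (- a, 1) then G z else 0)"
    proof eventually_elim
      case (elim z)
      obtain z' t where z: "T z = (z', t)" by (cases "T z")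
      have zin: "z \<bullet> T (- a, 1) = t - a \<bullet> z'"
        by (simp add: z inner_commute flip: inner_T)
      have ne: "t - a \<bullet> z' \<noteq> s" using elim by (simp add: zin inner_commute[of "T (- a, 1)"])
      have pz: "p h - \<epsilon> h *\<^sub>R z = T (w - \<epsilon> h *\<^sub>R z', gs h w + \<epsilon> h * s - \<epsilon> h * t)" for h
        by (subst T_eq_iff[symmetric]) (simp add: T_diff T_scaleR z p_def)
      have ev1: "\<forall>\<^sub>F h in sequentially. p h - \<epsilon> h *\<^sub>R z \<in> \<Omega>"
        unfolding pz using pt \<Omega> by (rule topological_tendstoD)
      have ev2: "\<forall>\<^sub>F h in sequentially. p h - \<epsilon> h *\<^sub>R z \<in> ball (T (w, y)) \<delta>"
        unfolding pz using pt by (rule topological_tendstoD) (use \<open>\<delta> > 0\<close> in auto)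
      have "\<forall>\<^sub>F h in sequentially. indicat_real (E h \<inter> \<Omega>) (p h - \<epsilon> h *\<^sub>R z) = (if s \<le> t - a \<bullet> z' then 1 else 0)"
      proof (cases "s < t - a \<bullet> z'")
        case True
        then have "s - t < - (a \<bullet> z')" by simp
        from order_tendstoD(1)[OF quot this] ev1 ev2 chart
        show ?thesis
        proof eventually_elim
          case (elim h)
          have "gs h w + \<epsilon> h * s - \<epsilon> h * t < gs h (w - \<epsilon> h *\<^sub>R z')"
            using elim(1) \<epsilon>(1)[of h] by (simp add: field_simps)
          then show ?case using elim(2,3,4) True unfolding pz lies_below_def by auto
        qed
      next
        case False
        then have "- (a \<bullet> z') < s - t" using ne by simp
        from order_tendstoD(2)[OF quot this] ev1 ev2 chart
        show ?thesis
        proof eventually_elim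
          case (elim h)
          have "gs h (w - \<epsilon> h *\<^sub>R z') < gs h w + \<epsilon> h * s - \<epsilon> h * t"
            using elim(1) \<epsilon>(1)[of h] by (simp add: field_simps)
          then show ?case using elim(2,3,4) False ne unfolding pz lies_below_def by auto
        qed
      qed
      then have "\<forall>\<^sub>F h in sequentially. G z * indicat_real (E h \<inter> \<Omega>) (p h - \<epsilon> h *\<^sub>R z)
          = (if s \<le> z \<bullet> T (- a, 1) then G z else 0)"
        by eventually_elim (simp add: zin)
      then show ?case by (rule tendsto_eventually)
    qed
    show "AE z in lborel. norm (G z * indicat_real (E h \<inter> \<Omega>) (p h - \<epsilon> h *\<^sub>R z)) \<le> G z" for h
      by (auto simp: G_nonneg split: split_indicator)
  qed (use G_integrable in auto)
  then show ?thesis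
    by (simp add: mass_def convolution_rescaled \<epsilon> p_def)
qed

lemma energy_liminf:
  fixes gs :: "nat \<Rightarrow> 'a \<Rightarrow> real" and \<phi> :: "'a \<times> real \<Rightarrow> ennreal"
  assumes W[measurable]: "W \<in> sets borel" and \<epsilon>: "\<And>h. \<epsilon> h > 0" "\<epsilon> \<longlonglongrightarrow> 0"
    and E[measurable]: "\<And>h. E h \<in> sets borel" and \<phi>[measurable]: "\<phi> \<in> borel_measurable borel"
    and gsm[measurable]: "\<And>h. gs h \<in> borel_measurable borel" and \<Omega>: "open \<Omega>"
    and W\<Omega>: "\<And>w. w \<in> W \<Longrightarrow> T (w, g w) \<in> \<Omega>" and gs: "\<And>w. w \<in> W \<Longrightarrow> (\<lambda>h. gs h w) \<longlonglongrightarrow> g w"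
    and quot: "\<And>w z. w \<in> W \<Longrightarrow> (\<lambda>h. (gs h (w - \<epsilon> h *\<^sub>R z) - gs h w) / \<epsilon> h) \<longlonglongrightarrow> - (a w \<bullet> z)"
    and chart: "\<And>w. w \<in> W \<Longrightarrow> \<exists>\<delta>>0. \<forall>\<^sub>F h in sequentially. lies_below T (gs h) (ball (T (w, g w)) \<delta>) (E h)"
    and weight: "\<And>w s. w \<in> W \<Longrightarrow> s > 0 \<Longrightarrow> (\<lambda>h. \<phi> (T (w, gs h w + \<epsilon> h * s))) \<longlonglongrightarrow> \<phi> (T (w, g w))"
    and fin: "\<And>x. \<phi> x < top"
  shows "(\<integral>\<^sup>+w\<in>W. \<phi> (T (w, g w)) * tension (T (- a w, 1) /\<^sub>R norm (a w, 1::real)) * ennreal (norm (a w, 1::real)) \<partial>lborel)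
    \<le> liminf (\<lambda>h. weighted_energy \<phi> \<Omega> (\<epsilon> h) (E h))"
proof -
  have [measurable]: "\<Omega> \<in> sets borel" using \<Omega> by simp
  define cv where "cv h = convolution (rescaled G (\<epsilon> h)) (indicat_real (E h \<inter> \<Omega>))" for h
  have cv0: "0 \<le> cv h x" for h x unfolding cv_def by (rule convolution_nonneg) (use \<epsilon> in auto)
  have [measurable]: "cv h \<in> borel_measurable borel" for h
    unfolding cv_def by (rule measurable_convolution) (use \<epsilon> in auto)
  have [measurable]: "(\<lambda>x. f (cv h x)) \<in> borel_measurable borel" for h
    by (rule measurable_f_comp) (auto simp: cv0)
  define K where "K h x = \<phi> x * ennreal (f (cv h x)) * indicator (- E h \<inter> \<Omega>) x" for h x
  have Km[measurable]: "K h \<in> borel_measurable borel" for h unfolding K_def[abs_def] by measurable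
  have KT[measurable]: "(\<lambda>p. K h (T p)) \<in> borel_measurable (borel \<Otimes>\<^sub>M borel)" for h
    unfolding borel_prod by measurable
  \<comment> \<open>\<open>K\<close> in graph coordinates, with the height measured in units of
    \<open>\<epsilon> h\<close> from the moving graph of \<open>gs h\<close>.\<close>
  define H where "H h p = K h (T (fst p, gs h (fst p) + \<epsilon> h * snd p))" for h p
  have Hm[measurable]: "H h \<in> borel_measurable (lborel \<Otimes>\<^sub>M lborel)" for h
  proof -
    have "(\<lambda>p. (fst p, gs h (fst p) + \<epsilon> h * snd p)) \<in> borel \<Otimes>\<^sub>M borel \<rightarrow>\<^sub>M borel \<Otimes>\<^sub>M borel"
      by measurable
    from measurable_compose[OF this KT[of h]] show ?thesis by (simp add: H_def[abs_def])
  qed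
  have eqH: "ennreal (1 / \<epsilon> h) * (\<integral>\<^sup>+x. K h x \<partial>lborel) = (\<integral>\<^sup>+p. H h p \<partial>(lborel \<Otimes>\<^sub>M lborel))" for h
  proof -
    have [measurable]: "(\<lambda>t. K h (T (w, t))) \<in> borel_measurable borel" for w
      using measurable_compose[OF measurable_Pair1' KT[of h], of w] by simp
    have "(\<integral>\<^sup>+x. K h x \<partial>lborel) = (\<integral>\<^sup>+p. K h (T p) \<partial>(lborel \<Otimes>\<^sub>M lborel))"
      by (simp add: nn_integral_T lborel_prod)
    also have "\<dots> = (\<integral>\<^sup>+w. \<integral>\<^sup>+t. K h (T (w, t)) \<partial>lborel \<partial>lborel)"
      using KT[of h] by (intro lborel.nn_integral_fst[symmetric]) simp
    also have "\<dots> = (\<integral>\<^sup>+w. ennreal (\<epsilon> h) * (\<integral>\<^sup>+s. K h (T (w, gs h w + \<epsilon> h * s)) \<partial>lborel) \<partial>lborel)"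
    proof (rule nn_integral_cong)
      fix w
      show "(\<integral>\<^sup>+t. K h (T (w, t)) \<partial>lborel) = ennreal (\<epsilon> h) * (\<integral>\<^sup>+s. K h (T (w, gs h w + \<epsilon> h * s)) \<partial>lborel)"
        using nn_integral_real_affine[of "\<lambda>t. K h (T (w, t))" "\<epsilon> h" "gs h w"] \<epsilon>(1)[of h] by simp
    qed
    also have "\<dots> = ennreal (\<epsilon> h) * (\<integral>\<^sup>+w. (\<integral>\<^sup>+s. K h (T (w, gs h w + \<epsilon> h * s)) \<partial>lborel) \<partial>lborel)"
      using lborel.borel_measurable_nn_integral_fst[OF Hm[of h]]
      by (intro nn_integral_cmult) (simp add: H_def)
    also have "(\<integral>\<^sup>+w. (\<integral>\<^sup>+s. K h (T (w, gs h w + \<epsilon> h * s)) \<partial>lborel) \<partial>lborel)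
        = (\<integral>\<^sup>+p. H h p \<partial>(lborel \<Otimes>\<^sub>M lborel))"
      by (subst lborel.nn_integral_fst[OF Hm, symmetric]) (simp add: H_def)
    finally show ?thesis
      using \<epsilon>(1)[of h] by (simp add: mult.assoc[symmetric] ennreal_mult[symmetric])
  qed
  have pointwise: "ennreal (f (mass (T (- a w, 1)) s)) * \<phi> (T (w, g w)) \<le> liminf (\<lambda>h. H h (w, s))"
    if w: "w \<in> W" and s: "s > 0" for w s
  proof -
    obtain \<delta> where \<delta>: "\<delta> > 0" "\<forall>\<^sub>F h in sequentially. lies_below T (gs h) (ball (T (w, g w)) \<delta>) (E h)"
      using chart[OF w] by blast
    define p where "p h = T (w, gs h w + \<epsilon> h * s)" for h
    have "(\<lambda>h. cv h (p h)) \<longlonglongrightarrow> mass (T (- a w, 1)) s"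
      unfolding cv_def p_def
      by (rule convolution_limit[OF \<epsilon> E \<Omega> W\<Omega>[OF w] gs[OF w] quot[OF w] \<delta>])
    then have "(\<lambda>h. f (cv h (p h))) \<longlonglongrightarrow> f (mass (T (- a w, 1)) s)"
      by (rule continuous_on_tendsto_compose[OF f_continuous]) (auto simp: mass_nonneg cv0)
    then have "(\<lambda>h. ennreal (f (cv h (p h))) * \<phi> (p h)) \<longlonglongrightarrow> ennreal (f (mass (T (- a w, 1)) s)) * \<phi> (T (w, g w))"
      unfolding p_def using fin[of "T (w, g w)"]
      by (intro tendsto_mult_ennreal tendsto_ennrealI weight w s) auto
    moreover have "\<forall>\<^sub>F h in sequentially. ennreal (f (cv h (p h))) * \<phi> (p h) = H h (w, s)"
    proof -
      have "(\<lambda>h. (w, gs h w + \<epsilon> h * s)) \<longlonglongrightarrow> (w, g w + 0 * s)"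
        by (intro tendsto_intros \<epsilon> gs w)
      then have pl: "p \<longlonglongrightarrow> T (w, g w)"
        using continuous_on_tendsto_compose[OF continuous_T[of UNIV], of _ "(w, g w)" sequentially]
        by (simp add: p_def[abs_def])
      have "\<forall>\<^sub>F h in sequentially. p h \<in> \<Omega>"
        by (rule topological_tendstoD[OF pl \<Omega> W\<Omega>[OF w]])
      moreover have "\<forall>\<^sub>F h in sequentially. p h \<in> ball (T (w, g w)) \<delta>"
        by (rule topological_tendstoD[OF pl]) (use \<delta> in auto)
      ultimately show ?thesis using \<delta>(2)
      proof eventually_elim
        case (elim h)
        \<comment> \<open>Here s > 0 is used: the sample point is outside \<open>E h\<close>, so the
          indicator of the complement is 1 there.\<close>
        have "gs h w < gs h w + \<epsilon> h * s" using \<epsilon>(1)[of h] s by simp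
        then have "p h \<notin> E h" using elim(2,3) unfolding p_def lies_below_def by blast
        then show ?case using elim(1) by (simp add: H_def K_def p_def mult.commute)
      qed
    qed
    ultimately have "(\<lambda>h. H h (w, s)) \<longlonglongrightarrow> ennreal (f (mass (T (- a w, 1)) s)) * \<phi> (T (w, g w))"
      by (rule Lim_transform_eventually)
    then show ?thesis by (simp add: lim_imp_Liminf)
  qed
  have "(\<integral>\<^sup>+w\<in>W. \<phi> (T (w, g w)) * tension (T (- a w, 1) /\<^sub>R norm (a w, 1::real)) * ennreal (norm (a w, 1::real)) \<partial>lborel)
      \<le> (\<integral>\<^sup>+w. \<integral>\<^sup>+s. liminf (\<lambda>h. H h (w, s)) \<partial>lborel \<partial>lborel)"
  proof (rule nn_integral_mono)
    fix w
    show "\<phi> (T (w, g w)) * tension (T (- a w, 1) /\<^sub>R norm (a w, 1::real)) * ennreal (norm (a w, 1::real)) * indicator W w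
       \<le> (\<integral>\<^sup>+s. liminf (\<lambda>h. H h (w, s)) \<partial>lborel)"
    proof (cases "w \<in> W")
      case True
      define J where "J = norm (a w, 1::real)"
      have J: "J > 0" by (simp add: J_def zero_prod_def)
      have [measurable]: "(\<lambda>s. f (mass (T (- a w, 1)) s)) \<in> borel_measurable borel"
        by (rule measurable_f_comp) (auto simp: mass_nonneg)
      have "\<phi> (T (w, g w)) * tension (T (- a w, 1) /\<^sub>R J) * ennreal J
          = \<phi> (T (w, g w)) * (\<integral>\<^sup>+s\<in>{0<..}. ennreal (f (mass (T (- a w, 1)) s)) \<partial>lborel)"
        using tension_scale[OF J, of "T (- a w, 1) /\<^sub>R J"] J by (simp add: mult_ac)
      also have "\<dots> = (\<integral>\<^sup>+s. \<phi> (T (w, g w)) * (ennreal (f (mass (T (- a w, 1)) s)) * indicator {0<..} s) \<partial>lborel)"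
        by (rule nn_integral_cmult[symmetric]) measurable
      also have "\<dots> \<le> (\<integral>\<^sup>+s. liminf (\<lambda>h. H h (w, s)) \<partial>lborel)"
        by (rule nn_integral_mono) (use pointwise[OF True] in \<open>auto split: split_indicator simp: mult.commute\<close>)
      finally show ?thesis using True by (simp add: J_def)
    qed simp
  qed
  also have "\<dots> = (\<integral>\<^sup>+p. liminf (\<lambda>h. H h p) \<partial>(lborel \<Otimes>\<^sub>M lborel))"
    by (subst lborel.nn_integral_fst[symmetric]) auto
  also have "\<dots> \<le> liminf (\<lambda>h. \<integral>\<^sup>+p. H h p \<partial>(lborel \<Otimes>\<^sub>M lborel))"
    by (rule nn_integral_liminf) measurable
  also have "\<dots> = liminf (\<lambda>h. ennreal (1 / \<epsilon> h) * (\<integral>\<^sup>+x. K h x \<partial>lborel))"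
    by (simp add: eqH)
  finally show ?thesis by (simp add: K_def cv_def weighted_energy_def)
qed

end

text \<open>Meaningful only where \<open>g\<close> is differentiable, but Borel measurable everywhere.\<close>

definition difference_gradient :: "('a::euclidean_space \<Rightarrow> real) \<Rightarrow> 'a \<Rightarrow> 'a" where
  "difference_gradient g w = (\<Sum>b\<in>Basis. lim (\<lambda>k. real (Suc k) * (g (w + (1 / real (Suc k)) *\<^sub>R b) - g w)) *\<^sub>R b)"

lemma measurable_difference_gradient [measurable (raw)]:
  assumes [measurable]: "g \<in> borel_measurable borel"
  shows "difference_gradient g \<in> borel_measurable borel"
  unfolding difference_gradient_def[abs_def]
  by (intro borel_measurable_sum borel_measurable_scaleR borel_measurable_lim_metric) measurable

section \<open>Difference quotients and the set of differentiability\<close>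

lemma one_over_Suc_tendsto_0: "(\<lambda>k. 1 / real (Suc k)) \<longlonglongrightarrow> 0"
  by (rule LIMSEQ_Suc[OF lim_1_over_n])

lemma difference_quotient_tendsto:
  assumes deriv: "(g has_derivative (\<lambda>z. c \<bullet> z)) (at w)"
    and \<epsilon>: "\<And>h. \<epsilon> h > 0" "\<epsilon> \<longlonglongrightarrow> 0"
  shows "(\<lambda>h. (g (w + \<epsilon> h *\<^sub>R z) - g w) / \<epsilon> h) \<longlonglongrightarrow> c \<bullet> z"
proof (cases "z = 0")
  case False
  have "((\<lambda>y. (g y - g w - c \<bullet> (y - w)) /\<^sub>R norm (y - w)) \<longlongrightarrow> 0) (at w)"
    using deriv unfolding has_derivative_at_within by (simp add: diff_diff_eq algebra_simps)
  moreover have "filterlim (\<lambda>h. w + \<epsilon> h *\<^sub>R z) (at w) sequentially"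
  proof (rule filterlim_atI)
    show "(\<lambda>h. w + \<epsilon> h *\<^sub>R z) \<longlonglongrightarrow> w"
      using tendsto_add[OF tendsto_const[of w] tendsto_scaleR[OF \<epsilon>(2) tendsto_const[of z]]] by simp
    show "\<forall>\<^sub>F h in sequentially. w + \<epsilon> h *\<^sub>R z \<noteq> w" using False \<epsilon>(1) by (simp add: less_imp_neq[symmetric])
  qed
  ultimately have "(\<lambda>h. (g (w + \<epsilon> h *\<^sub>R z) - g w - c \<bullet> (w + \<epsilon> h *\<^sub>R z - w)) /\<^sub>R norm (w + \<epsilon> h *\<^sub>R z - w)) \<longlonglongrightarrow> 0"
    by (rule filterlim_compose)
  then have "(\<lambda>h. norm z * ((g (w + \<epsilon> h *\<^sub>R z) - g w - c \<bullet> (w + \<epsilon> h *\<^sub>R z - w)) /\<^sub>R norm (w + \<epsilon> h *\<^sub>R z - w)) + c \<bullet> z)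
      \<longlonglongrightarrow> norm z * 0 + c \<bullet> z" by (intro tendsto_intros)
  moreover have "norm z * ((g (w + \<epsilon> h *\<^sub>R z) - g w - c \<bullet> (w + \<epsilon> h *\<^sub>R z - w)) /\<^sub>R norm (w + \<epsilon> h *\<^sub>R z - w)) + c \<bullet> z
      = (g (w + \<epsilon> h *\<^sub>R z) - g w) / \<epsilon> h" for h
    using False \<epsilon>(1)[of h] by (simp add: field_simps)
  ultimately show ?thesis by simp
qed simp

lemma difference_gradient_eq:
  assumes "(g has_derivative (\<lambda>z. c \<bullet> z)) (at w)"
  shows "difference_gradient g w = c"
proof -
  have "lim (\<lambda>k. real (Suc k) * (g (w + (1 / real (Suc k)) *\<^sub>R b) - g w)) = c \<bullet> b" for b
  proof (rule limI)
    have "(\<lambda>k. (g (w + (1 / real (Suc k)) *\<^sub>R b) - g w) / (1 / real (Suc k))) \<longlonglongrightarrow> c \<bullet> b"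
      by (rule difference_quotient_tendsto[OF assms _ one_over_Suc_tendsto_0]) simp
    then show "(\<lambda>k. real (Suc k) * (g (w + (1 / real (Suc k)) *\<^sub>R b) - g w)) \<longlonglongrightarrow> c \<bullet> b"
      by (simp add: mult.commute)
  qed
  then show ?thesis by (simp add: difference_gradient_def euclidean_representation)
qed

text \<open>Differentiability at \<open>w\<close> means that for every k some slope is right up to
  1/(k+1) on some ball. Slopes may be taken from a countable dense set and radii from the numbers
  1/(m+1), and for fixed data the condition is closed in \<open>w\<close>. Conversely, such slopes
  for different k are close to each other, and their limit is the gradient.\<close>

lemma sets_differentiability_points:
  fixes g :: "'a::euclidean_space \<Rightarrow> real"
  assumes cont: "continuous_on UNIV g"
  shows "{w. \<exists>c. (g has_derivative (\<lambda>z. c \<bullet> z)) (at w)} \<in> sets borel"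
proof -
  obtain Q :: "'a set" where Q: "countable Q" "\<And>X. open X \<Longrightarrow> X \<noteq> {} \<Longrightarrow> \<exists>d\<in>Q. d \<in> X"
    using countable_dense_setE by blast
  define A where "A k c m = {w. \<forall>z\<in>{z. norm z < 1 / real (Suc m)}.
      \<bar>g (w + z) - g w - c \<bullet> z\<bar> \<le> norm z / real (Suc k)}" for k m :: nat and c :: 'a
  have "closed (A k c m)" for k c m
  proof -
    have "A k c m = (\<Inter>z\<in>{z. norm z < 1 / real (Suc m)}. {w. \<bar>g (w + z) - g w - c \<bullet> z\<bar> \<le> norm z / real (Suc k)})"
      by (auto simp: A_def)
    also have "closed \<dots>"
      by (intro closed_INT ballI closed_Collect_le continuous_intros continuous_on_compose2[OF cont]) auto
    finally show ?thesis .
  qed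
  then have "(\<Inter>k. \<Union>c\<in>Q. \<Union>m. A k c m) \<in> sets borel"
    using Q(1) by (intro sets.countable_INT' sets.countable_UN') auto
  also have "(\<Inter>k. \<Union>c\<in>Q. \<Union>m. A k c m) = {w. \<exists>c. (g has_derivative (\<lambda>z. c \<bullet> z)) (at w)}"
  proof (intro set_eqI iffI)
    fix w assume "w \<in> {w. \<exists>c. (g has_derivative (\<lambda>z. c \<bullet> z)) (at w)}"
    then obtain c where c: "(g has_derivative (\<lambda>z. c \<bullet> z)) (at w)" by auto
    show "w \<in> (\<Inter>k. \<Union>c\<in>Q. \<Union>m. A k c m)"
    proof
      fix k
      define e where "e = 1 / real (Suc k)"
      have e: "e / 2 > 0" by (simp add: e_def)
      obtain d where d: "d > 0" "\<And>v. norm (v - w) < d \<Longrightarrow> norm (g v - g w - c \<bullet> (v - w)) \<le> e / 2 * norm (v - w)"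
        using c[unfolded has_derivative_at_alt] e by meson
      obtain m where m: "1 / real (Suc m) < d" using reals_Archimedean[OF d(1)] by (auto simp: inverse_eq_divide)
      obtain q where q: "q \<in> Q" "norm (c - q) < e / 2" using Q(2)[of "ball c (e / 2)"] e by (auto simp: dist_norm)
      have "\<bar>g (w + z) - g w - q \<bullet> z\<bar> \<le> norm z / real (Suc k)" if "norm z < 1 / real (Suc m)" for z
      proof -
        have "\<bar>(c - q) \<bullet> z\<bar> \<le> norm (c - q) * norm z" by (rule Cauchy_Schwarz_ineq2)
        also have "\<dots> \<le> e / 2 * norm z" using q by (intro mult_right_mono) auto
        finally have 1: "\<bar>c \<bullet> z - q \<bullet> z\<bar> \<le> e / 2 * norm z" by (simp add: inner_diff_left)
        have 2: "\<bar>g (w + z) - g w - c \<bullet> z\<bar> \<le> e / 2 * norm z" using d(2)[of "w + z"] that m by simp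
        have "norm z / real (Suc k) = e * norm z" by (simp add: e_def)
        also have "\<dots> = e / 2 * norm z + e / 2 * norm z" by simp
        finally show ?thesis using 1 2 by linarith
      qed
      then show "w \<in> (\<Union>c\<in>Q. \<Union>m. A k c m)" using q by (auto simp: A_def)
    qed
  next
    fix w assume "w \<in> (\<Inter>k. \<Union>c\<in>Q. \<Union>m. A k c m)"
    then have "\<exists>c m. w \<in> A k c m" for k by blast
    then obtain c m where "\<And>k. w \<in> A k (c k) (m k)" by metis
    then have cm: "\<bar>g (w + z) - g w - c k \<bullet> z\<bar> \<le> norm z / real (Suc k)"
      if "norm z < 1 / real (Suc (m k))" for k z using that by (auto simp: A_def)
    have close: "norm (c k - c l) \<le> 1 / real (Suc k) + 1 / real (Suc l)" for k l
    proof (cases "c k = c l")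
      case False
      define b where "b = c k - c l"
      define p q where "p = 1 / real (Suc (m k))" and "q = 1 / real (Suc (m l))"
      \<comment> \<open>A multiple of c k - c l that is short enough for both estimates; tested in
        this direction, they bound the norm of the difference.\<close>
      define t where "t = min p q / (2 * norm b)"
      have pq: "p > 0" "q > 0" by (simp_all add: p_def q_def)
      have b: "norm b > 0" using False by (simp add: b_def)
      have t: "t > 0" using b pq by (simp add: t_def)
      have "norm (t *\<^sub>R b) = min p q / 2" using b pq by (simp add: t_def)
      moreover have "0 < min p q" "min p q \<le> p" "min p q \<le> q" using pq by simp_all
      ultimately have "norm (t *\<^sub>R b) < p" "norm (t *\<^sub>R b) < q" by linarith+
      note this[unfolded p_def q_def]
      from cm[OF this(1)] cm[OF this(2)]
      have "\<bar>b \<bullet> (t *\<^sub>R b)\<bar> \<le> norm (t *\<^sub>R b) / real (Suc k) + norm (t *\<^sub>R b) / real (Suc l)"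
        unfolding b_def inner_diff_left by linarith
      also have "\<bar>b \<bullet> (t *\<^sub>R b)\<bar> = (t * norm b) * norm b"
        using t by (simp add: power2_norm_eq_inner[symmetric] power2_eq_square)
      also have "norm (t *\<^sub>R b) / real (Suc k) + norm (t *\<^sub>R b) / real (Suc l)
          = (t * norm b) * (1 / real (Suc k) + 1 / real (Suc l))"
        using t by (simp add: algebra_simps)
      finally show ?thesis using t b by (simp add: b_def)
    qed simp
    have "Cauchy c"
    proof (rule metric_CauchyI)
      fix e :: real assume "e > 0"
      then obtain M where M: "1 / real (Suc M) < e / 2" using reals_Archimedean[of "e / 2"] by (auto simp: inverse_eq_divide)
      show "\<exists>M. \<forall>k\<ge>M. \<forall>l\<ge>M. dist (c k) (c l) < e"
      proof (intro exI allI impI)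
        fix k l assume "M \<le> k" "M \<le> l"
        then have "1 / real (Suc k) \<le> 1 / real (Suc M)" "1 / real (Suc l) \<le> 1 / real (Suc M)"
          by (auto simp: field_simps)
        then show "dist (c k) (c l) < e" using close[of k l] M by (simp add: dist_norm)
      qed
    qed
    then obtain c0 where c0: "c \<longlonglongrightarrow> c0" by (auto simp: Cauchy_convergent_iff convergent_def)
    have close0: "norm (c k - c0) \<le> 1 / real (Suc k)" for k
    proof (rule tendsto_le[OF trivial_limit_sequentially])
      show "(\<lambda>l. norm (c k - c l)) \<longlonglongrightarrow> norm (c k - c0)" by (intro tendsto_intros c0)
      show "(\<lambda>l. 1 / real (Suc k) + 1 / real (Suc l)) \<longlonglongrightarrow> 1 / real (Suc k)"
        using tendsto_add[OF tendsto_const one_over_Suc_tendsto_0, of "1 / real (Suc k)"] by simp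
    qed (rule always_eventually, rule allI, rule close)
    have "(g has_derivative (\<lambda>z. c0 \<bullet> z)) (at w)"
      unfolding has_derivative_at_alt
    proof (intro conjI allI impI bounded_linear_inner_right)
      fix e :: real assume "e > 0"
      then obtain k where k: "1 / real (Suc k) < e / 2" using reals_Archimedean[of "e / 2"] by (auto simp: inverse_eq_divide)
      show "\<exists>d>0. \<forall>y. norm (y - w) < d \<longrightarrow> norm (g y - g w - c0 \<bullet> (y - w)) \<le> e * norm (y - w)"
      proof (intro exI[of _ "1 / real (Suc (m k))"] conjI allI impI)
        fix y assume y: "norm (y - w) < 1 / real (Suc (m k))"
        have "\<bar>(c k - c0) \<bullet> (y - w)\<bar> \<le> norm (c k - c0) * norm (y - w)" by (rule Cauchy_Schwarz_ineq2)
        also have "\<dots> \<le> e / 2 * norm (y - w)" using close0[of k] k by (intro mult_right_mono) auto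
        finally have 1: "\<bar>c k \<bullet> (y - w) - c0 \<bullet> (y - w)\<bar> \<le> e / 2 * norm (y - w)" by (simp add: inner_diff_left)
        have "\<bar>g y - g w - c k \<bullet> (y - w)\<bar> \<le> 1 / real (Suc k) * norm (y - w)" using cm[OF y] by simp
        also have "\<dots> \<le> e / 2 * norm (y - w)" using k by (intro mult_right_mono) auto
        finally have 2: "\<bar>g y - g w - c k \<bullet> (y - w)\<bar> \<le> e / 2 * norm (y - w)" .
        have "e * norm (y - w) = e / 2 * norm (y - w) + e / 2 * norm (y - w)" by simp
        then show "norm (g y - g w - c0 \<bullet> (y - w)) \<le> e * norm (y - w)"
          unfolding real_norm_def using 1 2 by linarith
      qed simp
    qed
    then show "w \<in> {w. \<exists>c. (g has_derivative (\<lambda>z. c \<bullet> z)) (at w)}" by blast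
  qed
  finally show ?thesis .
qed

locale graph_kernel = rotated_kernel T G f + rotated_graph T g
  for T :: "'a::euclidean_space \<times> real \<Rightarrow> 'a \<times> real" and G :: "'a \<times> real \<Rightarrow> real" and f g
begin

text \<open>Only parameters where \<open>g\<close> is differentiable contribute to the majorant
  \<open>Y\<close>. Nothing is lost, since \<open>outer_normal_eq\<close> gives differentiability
  over every reduced boundary point in the chart and identifies the normal with the Borel field
  \<open>n\<close>.\<close>

lemma chart_estimate:
  fixes gs :: "nat \<Rightarrow> 'a \<Rightarrow> real" and \<phi> :: "'a \<times> real \<Rightarrow> ennreal"
  assumes V: "{w \<in> V. \<exists>c. (g has_derivative (\<lambda>z. c \<bullet> z)) (at w)} \<in> sets borel"
    and \<epsilon>: "\<And>h. \<epsilon> h > 0" "\<epsilon> \<longlonglongrightarrow> 0"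
    and E: "\<And>h. E h \<in> sets borel" and \<phi>[measurable]: "\<phi> \<in> borel_measurable borel"
    and gsm: "\<And>h. gs h \<in> borel_measurable borel" and \<Omega>: "open \<Omega>"
    and V\<Omega>: "\<And>w. w \<in> V \<Longrightarrow> \<Gamma> w \<in> \<Omega>" and gs: "\<And>w. w \<in> V \<Longrightarrow> (\<lambda>h. gs h w) \<longlonglongrightarrow> g w"
    and quot: "\<And>w z c. w \<in> V \<Longrightarrow> (g has_derivative (\<lambda>z. c \<bullet> z)) (at w) \<Longrightarrow>
        (\<lambda>h. (gs h (w - \<epsilon> h *\<^sub>R z) - gs h w) / \<epsilon> h) \<longlonglongrightarrow> - (c \<bullet> z)"
    and chart: "\<And>w. w \<in> V \<Longrightarrow> \<exists>\<delta>>0. \<forall>\<^sub>F h in sequentially. lies_below T (gs h) (ball (\<Gamma> w) \<delta>) (E h)"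
    and chart0: "\<And>w. w \<in> V \<Longrightarrow> \<exists>\<delta>>0. lies_below T g (ball (\<Gamma> w) \<delta>) E0"
    and lip: "\<And>w. w \<in> V \<Longrightarrow> \<exists>\<delta>>0. \<exists>L. L-lipschitz_on (ball w \<delta>) g"
    and weight: "\<And>w s. w \<in> V \<Longrightarrow> s > 0 \<Longrightarrow> (\<lambda>h. \<phi> (T (w, gs h w + \<epsilon> h * s))) \<longlonglongrightarrow> \<phi> (\<Gamma> w)"
    and fin: "\<And>x. \<phi> x < top"
  shows "charted \<phi> \<Omega> \<epsilon> E E0 (\<Gamma> ` V \<inter> reduced_boundary E0)"
  unfolding charted_def
proof (intro bexI conjI ballI)
  define a where "a = difference_gradient g"
  define W where "W = {w \<in> V. \<exists>c. (g has_derivative (\<lambda>z. c \<bullet> z)) (at w)}"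
  have [measurable]: "a \<in> borel_measurable borel" unfolding a_def by measurable
  have [measurable]: "W \<in> sets borel" using V by (simp add: W_def)
  have deriv: "(g has_derivative (\<lambda>z. a w \<bullet> z)) (at w)" if "w \<in> W" for w
    using that by (auto simp: W_def a_def difference_gradient_eq)
  define n where "n w = T (- a w, 1) /\<^sub>R norm (a w, 1::real)" for w
  have "(\<lambda>w. (- a w, 1::real)) \<in> borel \<rightarrow>\<^sub>M borel \<Otimes>\<^sub>M borel" by measurable
  then have "(\<lambda>w. (- a w, 1::real)) \<in> borel_measurable borel" by (simp add: borel_prod)
  from measurable_compose[OF this measurable_T] have [measurable]: "(\<lambda>w. T (- a w, 1)) \<in> borel_measurable borel" .
  have "(\<lambda>w. (a w, 1::real)) \<in> borel \<rightarrow>\<^sub>M borel \<Otimes>\<^sub>M borel" by measurable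
  then have [measurable]: "(\<lambda>w. (a w, 1::real)) \<in> borel_measurable borel" by (simp add: borel_prod)
  have [measurable]: "n \<in> borel_measurable borel" unfolding n_def[abs_def] by measurable
  define y where "y w = \<phi> (\<Gamma> w) * tension (n w)" for w
  have [measurable]: "y \<in> borel_measurable borel" unfolding y_def[abs_def] by measurable
  \<comment> \<open>The parameter of a graph point is recovered as fst (T x), which makes
    \<open>Y\<close> a function on the ambient space.\<close>
  define Y where "Y x = y (fst (T x)) * indicator (\<Gamma> ` W) x" for x
  show "Y \<in> borel_measurable borel" unfolding Y_def[abs_def] by measurable
  have "(\<integral>\<^sup>+x. Y x \<partial>hausdorff_measure DIM('a)) \<le> (\<integral>\<^sup>+w\<in>W. y w * ennreal (norm (a w, 1::real)) \<partial>lborel)"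
    unfolding Y_def by (rule nn_integral_hausdorff_\<Gamma>_le) (use deriv in auto)
  also have "\<dots> \<le> liminf (\<lambda>h. weighted_energy \<phi> \<Omega> (\<epsilon> h) (E h))"
    unfolding y_def n_def \<Gamma>_def
    by (rule energy_liminf[where gs = gs, OF _ \<epsilon> E \<phi> gsm \<Omega> _ _ _ _ _ fin])
       (use V V\<Omega> gs quot[OF _ deriv] chart weight in \<open>auto simp: W_def \<Gamma>_def\<close>)
  finally show "integral\<^sup>N (hausdorff_measure (DIM('a \<times> real) - 1)) Y \<le> liminf (\<lambda>h. weighted_energy \<phi> \<Omega> (\<epsilon> h) (E h))"
    by simp
  fix x assume "x \<in> \<Gamma> ` V \<inter> reduced_boundary E0"
  then obtain w where x: "x = \<Gamma> w" and w: "w \<in> V" and rb: "\<Gamma> w \<in> reduced_boundary E0" by auto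
  obtain \<delta>1 where \<delta>1: "\<delta>1 > 0" "lies_below T g (ball (\<Gamma> w) \<delta>1) E0"
    using chart0[OF w] by blast
  obtain \<delta>2 L where \<delta>2: "\<delta>2 > 0" "L-lipschitz_on (ball w \<delta>2) g" using lip[OF w] by blast
  have "\<exists>c. (g has_derivative (\<lambda>z. c \<bullet> z)) (at w) \<and> outer_normal E0 (\<Gamma> w) = T (- c, 1) /\<^sub>R norm (c, 1::real)"
  proof (rule outer_normal_eq[OF rb, of "min \<delta>1 \<delta>2" L])
    show "L-lipschitz_on (ball w (min \<delta>1 \<delta>2)) g"
      by (rule lipschitz_on_subset[OF \<delta>2(2)]) auto
  qed (use \<delta>1 \<delta>2 in \<open>auto simp: lies_below_def\<close>)
  then obtain c where c: "(g has_derivative (\<lambda>z. c \<bullet> z)) (at w)"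
      "outer_normal E0 (\<Gamma> w) = T (- c, 1) /\<^sub>R norm (c, 1::real)" by blast
  then have "w \<in> W" "outer_normal E0 (\<Gamma> w) = n w"
    using w by (auto simp: W_def n_def a_def difference_gradient_eq)
  then show "\<phi> x * tension (outer_normal E0 x) \<le> Y x"
    by (simp add: x Y_def y_def)
qed

end

subsection \<open>Assembling the charts\<close>

lemma hausdorff_null_in_null_sets:
  assumes "hausdorff_outer k Z = 0"
  shows "Z \<in> null_sets (hausdorff_measure k)"
proof -
  interpret algebra "UNIV :: 'a set" UNIV
    using sigma_algebra_Pow[of "UNIV :: 'a set"] by (simp add: sigma_algebra_def)
  have "hausdorff_outer k (X \<inter> Z) + hausdorff_outer k (X - Z) = hausdorff_outer k X" for X
  proof (rule antisym)
    have "hausdorff_outer k (X \<inter> Z) \<le> hausdorff_outer k Z" by (rule hausdorff_outer_mono) auto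
    then have "hausdorff_outer k (X \<inter> Z) = 0" using assms by simp
    then show "hausdorff_outer k (X \<inter> Z) + hausdorff_outer k (X - Z) \<le> hausdorff_outer k X"
      by (simp add: hausdorff_outer_mono)
    show "hausdorff_outer k X \<le> hausdorff_outer k (X \<inter> Z) + hausdorff_outer k (X - Z)"
      using hausdorff_outer_Un_le[of k "X \<inter> Z" "X - Z"] by (simp add: Int_Diff_Un)
  qed
  then have "Z \<in> sets (hausdorff_measure k)"
    unfolding sets_hausdorff_measure lambda_system_eq by auto
  then show ?thesis using assms by (auto simp: emeasure_hausdorff_measure)
qed

text \<open>Fatou's lemma for counting measure.\<close>

lemma sum_liminf_le:
  fixes F :: "'i \<Rightarrow> nat \<Rightarrow> ennreal"
  assumes "finite I"
  shows "(\<Sum>i\<in>I. liminf (F i)) \<le> liminf (\<lambda>h. \<Sum>i\<in>I. F i h)"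
  using nn_integral_liminf[of "\<lambda>h i. F i h" "count_space I"] assms
  by (simp add: nn_integral_count_space_finite)

text \<open>The integrand of \<open>F_lim\<close> is not known to be measurable, so its integral is
  first bounded by that of the sum of the Borel functions \<open>Y i\<close>, for which additivity
  holds. The limit side requires weights with sum at least 1 on \<open>S\<close>, the energy side
  weights with sum at most 1 everywhere.\<close>

lemma (in interaction_kernel) F_lim_le_liminf:
  assumes I: "finite I" and \<Omega>: "open \<Omega>" and E[measurable]: "\<And>h. E h \<in> sets borel" and \<epsilon>: "\<And>h. \<epsilon> h > 0"
    and \<phi>[measurable]: "\<And>i. i \<in> I \<Longrightarrow> \<phi> i \<in> borel_measurable borel"
    and le1: "\<And>x. (\<Sum>i\<in>I. \<phi> i x) \<le> 1"
    and bound: "\<And>i. i \<in> I \<Longrightarrow> charted (\<phi> i) \<Omega> \<epsilon> E E0 S"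
    and S: "reduced_boundary E0 \<inter> \<Omega> \<subseteq> S \<union> Z" and Z: "hausdorff_outer (DIM('a) - 1) Z = 0"
    and ge1: "\<And>x. x \<in> S \<Longrightarrow> 1 \<le> (\<Sum>i\<in>I. \<phi> i x)"
  shows "F_lim f G \<Omega> E0 \<le> liminf (\<lambda>h. F_eps f G \<Omega> (\<epsilon> h) (E h))"
proof -
  let ?H = "hausdorff_measure (DIM('a) - 1) :: 'a measure"
  obtain Y where Y: "\<And>i. i \<in> I \<Longrightarrow> Y i \<in> borel_measurable borel"
      "\<And>i. i \<in> I \<Longrightarrow> (\<integral>\<^sup>+x. Y i x \<partial>?H) \<le> liminf (\<lambda>h. weighted_energy (\<phi> i) \<Omega> (\<epsilon> h) (E h))"
      "\<And>i x. i \<in> I \<Longrightarrow> x \<in> S \<Longrightarrow> \<phi> i x * tension (outer_normal E0 x) \<le> Y i x"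
    using bound unfolding charted_def by metis
  have "F_lim f G \<Omega> E0 \<le> (\<integral>\<^sup>+x. (\<Sum>i\<in>I. Y i x) \<partial>?H)"
    unfolding F_lim_def
  proof (rule nn_integral_mono_AE)
    have "AE x in ?H. x \<notin> Z" by (rule AE_not_in[OF hausdorff_null_in_null_sets[OF Z]])
    then show "AE x in ?H. ennreal (theta f G (outer_normal E0 x)) * indicator (reduced_boundary E0 \<inter> \<Omega>) x
        \<le> (\<Sum>i\<in>I. Y i x)"
    proof eventually_elim
      case (elim x)
      show ?case
      proof (cases "x \<in> reduced_boundary E0 \<inter> \<Omega>")
        case True
        then have x: "x \<in> S" using S elim by auto
        have "ennreal (theta f G (outer_normal E0 x)) \<le> 1 * tension (outer_normal E0 x)"
          by (simp add: theta_le_tension)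
        also have "\<dots> \<le> (\<Sum>i\<in>I. \<phi> i x) * tension (outer_normal E0 x)"
          by (intro mult_right_mono ge1 x) simp
        also have "\<dots> \<le> (\<Sum>i\<in>I. Y i x)"
          unfolding sum_distrib_right by (intro sum_mono Y(3) x)
        finally show ?thesis using True by simp
      qed simp
    qed
  qed
  also have "\<dots> = (\<Sum>i\<in>I. \<integral>\<^sup>+x. Y i x \<partial>?H)"
    by (rule nn_integral_sum) (rule borel_measurable_hausdorff[OF Y(1)])
  also have "\<dots> \<le> (\<Sum>i\<in>I. liminf (\<lambda>h. weighted_energy (\<phi> i) \<Omega> (\<epsilon> h) (E h)))"
    by (intro sum_mono Y(2))
  also have "\<dots> \<le> liminf (\<lambda>h. \<Sum>i\<in>I. weighted_energy (\<phi> i) \<Omega> (\<epsilon> h) (E h))"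
    by (rule sum_liminf_le[OF I])
  also have "\<dots> \<le> liminf (\<lambda>h. F_eps f G \<Omega> (\<epsilon> h) (E h))"
  proof (intro Liminf_mono always_eventually allI)
    fix h
    have [measurable]: "\<Omega> \<in> sets borel" using \<Omega> by simp
    define cv where "cv = convolution (rescaled G (\<epsilon> h)) (indicat_real (E h \<inter> \<Omega>))"
    have [measurable]: "(\<lambda>x. f (cv x)) \<in> borel_measurable borel"
      unfolding cv_def
      by (intro measurable_f_comp measurable_convolution convolution_nonneg) (use \<epsilon> in auto)
    have "(\<Sum>i\<in>I. weighted_energy (\<phi> i) \<Omega> (\<epsilon> h) (E h))
        = ennreal (1 / \<epsilon> h) * (\<Sum>i\<in>I. \<integral>\<^sup>+x\<in>- E h \<inter> \<Omega>. \<phi> i x * ennreal (f (cv x)) \<partial>lborel)"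
      by (simp add: weighted_energy_def cv_def sum_distrib_left)
    also have "(\<Sum>i\<in>I. \<integral>\<^sup>+x\<in>- E h \<inter> \<Omega>. \<phi> i x * ennreal (f (cv x)) \<partial>lborel)
        = (\<integral>\<^sup>+x. (\<Sum>i\<in>I. \<phi> i x * ennreal (f (cv x)) * indicator (- E h \<inter> \<Omega>) x) \<partial>lborel)"
      by (rule nn_integral_sum[symmetric]) measurable
    also have "\<dots> \<le> (\<integral>\<^sup>+x\<in>- E h \<inter> \<Omega>. ennreal (f (cv x)) \<partial>lborel)"
    proof (rule nn_integral_mono)
      fix x
      have "(\<Sum>i\<in>I. \<phi> i x * ennreal (f (cv x)) * indicator (- E h \<inter> \<Omega>) x)
          = (\<Sum>i\<in>I. \<phi> i x) * (ennreal (f (cv x)) * indicator (- E h \<inter> \<Omega>) x)"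
        by (simp add: sum_distrib_right mult.assoc)
      also have "\<dots> \<le> 1 * (ennreal (f (cv x)) * indicator (- E h \<inter> \<Omega>) x)"
        by (intro mult_right_mono le1) simp
      finally show "(\<Sum>i\<in>I. \<phi> i x * ennreal (f (cv x)) * indicator (- E h \<inter> \<Omega>) x)
          \<le> ennreal (f (cv x)) * indicator (- E h \<inter> \<Omega>) x" by simp
    qed
    also have "\<dots> = (\<integral>\<^sup>+x\<in>- E h \<inter> \<Omega>. ennreal (f (cv x)) \<partial>lebesgue)"
      by (rule nn_integral_completion[symmetric])
    finally show "(\<Sum>i\<in>I. weighted_energy (\<phi> i) \<Omega> (\<epsilon> h) (E h)) \<le> F_eps f G \<Omega> (\<epsilon> h) (E h)"
      unfolding F_eps_def cv_def by (simp add: mult_left_mono)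
  qed
  finally show ?thesis .
qed

section \<open>Gradients, and domains with Lipschitz boundary\<close>

lemma gradient_derivative:
  assumes "u differentiable (at x)"
  shows "(u has_derivative (\<lambda>z. gradient u x \<bullet> z)) (at x)"
proof -
  obtain u' where u': "(u has_derivative u') (at x)" using assms by (auto simp: differentiable_def)
  define d where "d = (\<Sum>b\<in>Basis. u' b *\<^sub>R b)"
  have "linear u'" using u' by (rule has_derivative_linear)
  have "u' z = z \<bullet> d" for z
  proof -
    have "u' z = u' (\<Sum>b\<in>Basis. (z \<bullet> b) *\<^sub>R b)" by (simp add: euclidean_representation)
    also have "\<dots> = (\<Sum>b\<in>Basis. (z \<bullet> b) * u' b)"
      by (simp add: linear_sum[OF \<open>linear u'\<close>] linear_cmul[OF \<open>linear u'\<close>])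
    also have "\<dots> = z \<bullet> d" by (simp add: d_def inner_sum_right mult.commute)
    finally show ?thesis .
  qed
  then have eq: "u' = (\<lambda>z. z \<bullet> d)" by (rule ext)
  have d: "GDERIV u x :> d" unfolding gderiv_def eq[symmetric] by (rule u')
  have "gradient u x = d"
    unfolding gradient_def
  proof (rule the_equality, rule d)
    fix d' assume "GDERIV u x :> d'"
    then have "(\<lambda>h. h \<bullet> d') = (\<lambda>h. h \<bullet> d)"
      using d unfolding gderiv_def by (rule has_derivative_unique)
    then show "d' = d" by (simp only: fun_eq_iff vector_eq_ldot)
  qed
  then have "(\<lambda>z. gradient u x \<bullet> z) = (\<lambda>z. z \<bullet> d)" by (simp only: inner_commute[of d])
  then show ?thesis using d unfolding gderiv_def by (simp only:)
qed

text \<open>The mean value inequality for \<open>F\<close> minus a linear function. The reference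
  slope c = 0 yields Lipschitz bounds; the gradient at a centre point yields limits of difference
  quotients.\<close>

lemma convex_gradient_bound:
  assumes "convex S" and deriv: "\<And>x. x \<in> S \<Longrightarrow> (F has_derivative (\<lambda>z. d x \<bullet> z)) (at x)"
    and B: "\<And>x. x \<in> S \<Longrightarrow> norm (d x - c) \<le> B" and xy: "x \<in> S" "y \<in> S"
  shows "\<bar>F x - F y - c \<bullet> (x - y)\<bar> \<le> B * norm (x - y)"
proof -
  have "norm ((F x - c \<bullet> x) - (F y - c \<bullet> y)) \<le> B * norm (x - y)"
  proof (rule differentiable_bound[OF \<open>convex S\<close>, of "\<lambda>v. F v - c \<bullet> v" "\<lambda>x z. (d x - c) \<bullet> z"])
    fix v assume v: "v \<in> S"
    have "((\<lambda>v. F v - c \<bullet> v) has_derivative (\<lambda>z. d v \<bullet> z - c \<bullet> z)) (at v)"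
      by (intro has_derivative_diff deriv v has_derivative_inner_right has_derivative_ident)
    then show "((\<lambda>v. F v - c \<bullet> v) has_derivative (\<lambda>z. (d v - c) \<bullet> z)) (at v within S)"
      by (simp add: inner_diff_left has_derivative_at_withinI)
    show "onorm (\<lambda>z. (d v - c) \<bullet> z) \<le> B"
    proof (rule onorm_bound)
      show "0 \<le> B" using B[OF v] norm_ge_zero order_trans by blast
      fix z
      have "\<bar>(d v - c) \<bullet> z\<bar> \<le> norm (d v - c) * norm z" by (rule Cauchy_Schwarz_ineq2)
      also have "\<dots> \<le> B * norm z" by (intro mult_right_mono B v) simp
      finally show "norm ((d v - c) \<bullet> z) \<le> B * norm z" by simp
    qed
  qed (use xy in auto)
  then show ?thesis by (simp add: inner_diff_right algebra_simps)
qed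

lemma projection_along_unit:
  fixes e :: "'a::euclidean_space"
  assumes "norm e = 1"
  shows "(z - (z \<bullet> e) *\<^sub>R e) \<bullet> e = 0" "norm (z - (z \<bullet> e) *\<^sub>R e) \<le> norm z"
proof -
  have ee: "e \<bullet> e = 1" using assms by (simp add: norm_eq_1)
  then show "(z - (z \<bullet> e) *\<^sub>R e) \<bullet> e = 0" by (simp add: inner_diff_left)
  have "(z - (z \<bullet> e) *\<^sub>R e) \<bullet> (z - (z \<bullet> e) *\<^sub>R e) = z \<bullet> z - (z \<bullet> e)\<^sup>2"
    by (simp add: inner_diff_left inner_diff_right ee inner_commute[of e z] power2_eq_square)
  then show "norm (z - (z \<bullet> e) *\<^sub>R e) \<le> norm z" by (simp add: norm_eq_sqrt_inner)
qed

text \<open>Two points above the graph are joined by moving both far enough up in the direction \<open>e\<close>; the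
  resulting three segments stay in \<open>D\<close> and have total length comparable to the distance.\<close>

lemma lipschitz_above_graph:
  fixes D :: "'a::euclidean_space set"
  assumes e: "norm e = 1" and \<gamma>: "L-lipschitz_on {w. w \<bullet> e = 0} \<gamma>" and "r > 0"
    and D: "D \<inter> ball p r = {z \<in> ball p r. \<gamma> (z - (z \<bullet> e) *\<^sub>R e) < z \<bullet> e}"
    and deriv: "\<And>x. x \<in> D \<Longrightarrow> (u has_derivative (\<lambda>z. d x \<bullet> z)) (at x)"
    and M: "\<And>x. x \<in> D \<Longrightarrow> norm (d x) \<le> M"
  obtains \<rho> C where "0 < \<rho>" "\<rho> \<le> r" "C-lipschitz_on (D \<inter> ball p \<rho>) u"
proof -
  define P where "P z = z - (z \<bullet> e) *\<^sub>R e" for z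
  have ee: "e \<bullet> e = 1" using e by (simp add: norm_eq_1)
  have L: "L \<ge> 0" using \<gamma> by (rule lipschitz_on_nonneg)
  have Padd: "P (x + y) = P x + P y" "P (c *\<^sub>R x) = c *\<^sub>R P x" "P e = 0" for x y c
    by (simp_all add: P_def inner_add_left ee algebra_simps)
  note P0 = projection_along_unit(1)[OF e, folded P_def] and Pnorm = projection_along_unit(2)[OF e, folded P_def]
  have \<gamma>P: "\<gamma> (P x + P v) \<le> \<gamma> (P x) + L * norm v" for x v
  proof -
    have "dist (\<gamma> (P x + P v)) (\<gamma> (P x)) \<le> L * dist (P x + P v) (P x)"
      by (rule lipschitz_onD[OF \<gamma>]) (simp_all add: P0 inner_add_left)
    also have "\<dots> \<le> L * norm v" using Pnorm[of v] L by (simp add: dist_norm mult_left_mono)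
    finally show ?thesis by (simp add: dist_real_def)
  qed
  have in_D: "z \<in> D" if "z \<in> ball p r" "\<gamma> (P z) < z \<bullet> e" for z
  proof -
    have "z \<in> D \<inter> ball p r" unfolding D using that by (simp add: P_def)
    then show ?thesis by simp
  qed
  have D_above: "\<gamma> (P z) < z \<bullet> e" if "z \<in> D" "z \<in> ball p r" for z
  proof -
    have "z \<in> D \<inter> ball p r" using that by simp
    then show ?thesis unfolding D by (simp add: P_def)
  qed
  \<comment> \<open>Points of the path lie within t + k = k (L + 2) < 2 \<rho> (L + 2) of a point of
    the small ball; this choice keeps them in the ball of radius r.\<close>
  define \<rho> where "\<rho> = r / (4 * (L + 3))"
  have \<rho>: "\<rho> > 0" using \<open>r > 0\<close> L by (simp add: \<rho>_def)
  have \<rho>r: "2 * \<rho> * (L + 2) + \<rho> < r"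
  proof -
    have "r = 4 * (L + 3) * \<rho>" using L by (simp add: \<rho>_def)
    moreover have "0 \<le> L * \<rho>" using L \<rho> by simp
    ultimately show ?thesis using \<rho> by (simp add: algebra_simps)
  qed
  have seg: "\<bar>u x - u y\<bar> \<le> M * norm (x - y)" if "closed_segment x y \<subseteq> D" for x y
    using convex_gradient_bound[of "closed_segment x y" u d 0 M x y] deriv[OF subsetD[OF that]] M[OF subsetD[OF that]]
    by simp
  have "(M * (2 * (L + 1) + 1))-lipschitz_on (D \<inter> ball p \<rho>) u" if M0: "M \<ge> 0"
  proof (rule lipschitz_onI)
    show "0 \<le> M * (2 * (L + 1) + 1)" using M0 L by simp
    fix x y assume x: "x \<in> D \<inter> ball p \<rho>" and y: "y \<in> D \<inter> ball p \<rho>"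
    define k where "k = norm (x - y)"
    \<comment> \<open>Climbing L k offsets the rise of \<gamma> across the gap, and the additional k
      offsets the component of y - x along \<open>e\<close>.\<close>
    define t where "t = (L + 1) * k"
    have k: "k < 2 * \<rho>" using x y dist_triangle_less_add[of x p \<rho> y \<rho>] by (auto simp: k_def dist_norm norm_minus_commute)
    have "k \<ge> 0" by (simp add: k_def)
    have t0: "t \<ge> 0" using L \<open>k \<ge> 0\<close> by (simp add: t_def)
    have kL: "k * (L + 2) \<le> 2 * \<rho> * (L + 2)" using k L by (intro mult_right_mono) auto
    have tk: "t + k = k * (L + 2)" by (simp add: t_def algebra_simps)
    have near: "z + v \<in> ball p r" if "z \<in> ball p \<rho>" "norm v \<le> t + k" for z v
    proof -
      have "norm (p - (z + v)) \<le> norm (p - z) + norm v" using norm_triangle_ineq4[of "p - z" v] by (simp add: diff_diff_eq)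
      then show ?thesis using that kL tk \<rho>r by (simp add: dist_norm)
    qed
    have up: "closed_segment z (z + t *\<^sub>R e) \<subseteq> D" if z: "z \<in> D \<inter> ball p \<rho>" for z
    proof
      fix q assume "q \<in> closed_segment z (z + t *\<^sub>R e)"
      then obtain s where s: "0 \<le> s" "s \<le> 1" "q = z + (s * t) *\<^sub>R e"
        by (auto simp: in_segment algebra_simps)
      have st: "0 \<le> s * t" "s * t \<le> t" using s t0 by (simp_all add: mult_left_le_one_le)
      show "q \<in> D"
      proof (rule in_D)
        show "q \<in> ball p r" unfolding s(3) by (rule near) (use z st e \<open>k \<ge> 0\<close> in auto)
        have "\<gamma> (P z) < z \<bullet> e" using z near[of z 0] t0 \<open>k \<ge> 0\<close> by (intro D_above) auto
        then show "\<gamma> (P q) < q \<bullet> e" using st by (simp add: s(3) Padd inner_add_left ee)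
      qed
    qed
    have across: "closed_segment (x + t *\<^sub>R e) (y + t *\<^sub>R e) \<subseteq> D"
    proof
      fix q assume "q \<in> closed_segment (x + t *\<^sub>R e) (y + t *\<^sub>R e)"
      then obtain s where s: "0 \<le> s" "s \<le> 1" "q = x + (t *\<^sub>R e + s *\<^sub>R (y - x))"
        by (auto simp: in_segment algebra_simps)
      have nv: "norm (s *\<^sub>R (y - x)) \<le> k"
        using s by (simp add: k_def norm_minus_commute mult_left_le_one_le)
      show "q \<in> D"
      proof (rule in_D)
        show "q \<in> ball p r" unfolding s(3)
          by (rule near) (use x nv e t0 norm_triangle_ineq[of "t *\<^sub>R e" "s *\<^sub>R (y - x)"] in auto)
        have "\<gamma> (P q) = \<gamma> (P x + P (s *\<^sub>R (y - x)))" by (simp add: s(3) Padd)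
        also have "\<dots> \<le> \<gamma> (P x) + L * norm (s *\<^sub>R (y - x))" by (rule \<gamma>P)
        also have "\<dots> \<le> \<gamma> (P x) + L * k" using nv L by (intro add_left_mono mult_left_mono) auto
        also have "\<dots> < x \<bullet> e + L * k" using x near[of x 0] t0 \<open>k \<ge> 0\<close> D_above[of x] by auto
        also have "\<dots> \<le> x \<bullet> e + t + (s *\<^sub>R (y - x)) \<bullet> e"
        proof -
          have "\<bar>(s *\<^sub>R (y - x)) \<bullet> e\<bar> \<le> norm (s *\<^sub>R (y - x)) * norm e" by (rule Cauchy_Schwarz_ineq2)
          then have "\<bar>(s *\<^sub>R (y - x)) \<bullet> e\<bar> \<le> k" using nv e by simp
          moreover have "t = L * k + k" by (simp add: t_def algebra_simps)
          ultimately show ?thesis by linarith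
        qed
        also have "\<dots> = q \<bullet> e" by (simp add: s(3) inner_add_left ee)
        finally show "\<gamma> (P q) < q \<bullet> e" .
      qed
    qed
    have "\<bar>u x - u (x + t *\<^sub>R e)\<bar> \<le> M * t" "\<bar>u y - u (y + t *\<^sub>R e)\<bar> \<le> M * t"
      using seg[OF up[OF x]] seg[OF up[OF y]] e t0 by simp_all
    moreover have "\<bar>u (x + t *\<^sub>R e) - u (y + t *\<^sub>R e)\<bar> \<le> M * k"
      using seg[OF across] by (simp add: k_def)
    moreover have "M * (2 * (L + 1) + 1) * k = M * t + M * t + M * k" by (simp add: t_def algebra_simps)
    ultimately have "\<bar>u x - u y\<bar> \<le> M * (2 * (L + 1) + 1) * k" by linarith
    then show "dist (u x) (u y) \<le> M * (2 * (L + 1) + 1) * dist x y" by (simp add: dist_norm k_def)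
  qed
  \<comment> \<open>A negative bound on norms is possible only if \<open>D\<close> is empty.\<close>
  moreover have "1-lipschitz_on (D \<inter> ball p \<rho>) u" if "\<not> M \<ge> 0"
  proof -
    have "D = {}" using M that norm_ge_zero order_trans by blast
    then show ?thesis by (simp add: lipschitz_on_def)
  qed
  moreover have "\<rho> \<le> r"
  proof -
    have "0 \<le> 2 * \<rho> * (L + 2)" using \<rho> L by simp
    then show ?thesis using \<rho>r by linarith
  qed
  ultimately show thesis using that[OF \<rho>] by blast
qed

lemma frontier_above_graph:
  fixes D :: "'a::euclidean_space set"
  assumes e: "norm e = 1" and \<gamma>: "L-lipschitz_on {w. w \<bullet> e = 0} \<gamma>"
    and D: "D \<inter> ball p r = {z \<in> ball p r. \<gamma> (z - (z \<bullet> e) *\<^sub>R e) < z \<bullet> e}" and "open D"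
    and x: "x \<in> frontier D" "x \<in> ball p r"
  shows "\<gamma> (x - (x \<bullet> e) *\<^sub>R e) = x \<bullet> e"
proof (rule antisym)
  define P where "P z = z - (z \<bullet> e) *\<^sub>R e" for z
  note P0 = projection_along_unit(1)[OF e, folded P_def]
  have "continuous_on UNIV P" unfolding P_def[abs_def] by (intro continuous_intros)
  then have cont: "continuous_on UNIV (\<lambda>z. \<gamma> (P z))"
    by (rule continuous_on_compose2[OF lipschitz_on_continuous_on[OF \<gamma>]]) (use P0 in auto)
  show "\<gamma> (x - (x \<bullet> e) *\<^sub>R e) \<le> x \<bullet> e"
  proof (rule ccontr)
    assume less: "\<not> \<gamma> (x - (x \<bullet> e) *\<^sub>R e) \<le> x \<bullet> e"
    define U where "U = {z. z \<bullet> e < \<gamma> (P z)} \<inter> ball p r"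
    have "open U" unfolding U_def by (intro open_Int open_Collect_less cont continuous_intros open_ball)
    moreover have "x \<in> U \<inter> closure D" using x less by (simp add: U_def frontier_def P_def)
    ultimately have "U \<inter> D \<noteq> {}" using open_Int_closure_eq_empty[of U D] by blast
    then obtain z where z: "z \<in> U" "z \<in> D" by blast
    then have "z \<in> D \<inter> ball p r" by (simp add: U_def)
    then have "\<gamma> (z - (z \<bullet> e) *\<^sub>R e) < z \<bullet> e" unfolding D by simp
    then show False using z(1) by (simp add: U_def P_def)
  qed
  show "x \<bullet> e \<le> \<gamma> (x - (x \<bullet> e) *\<^sub>R e)"
  proof (rule ccontr)
    assume "\<not> x \<bullet> e \<le> \<gamma> (x - (x \<bullet> e) *\<^sub>R e)"
    then have "x \<in> D \<inter> ball p r" unfolding D using x by simp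
    then show False using x \<open>open D\<close> by (simp add: frontier_def interior_open)
  qed
qed

text \<open>The frontier lies in the image of a hyperplane, a null set of the space, under the
  Lipschitz map w |-> w + \<gamma> w e.\<close>

lemma negligible_frontier_above_graph:
  fixes D :: "'a::euclidean_space set"
  assumes e: "norm e = 1" and \<gamma>: "L-lipschitz_on {w. w \<bullet> e = 0} \<gamma>"
    and D: "D \<inter> ball p r = {z \<in> ball p r. \<gamma> (z - (z \<bullet> e) *\<^sub>R e) < z \<bullet> e}" and "open D"
  shows "negligible (frontier D \<inter> ball p r)"
proof (rule negligible_subset)
  let ?H = "{w. w \<bullet> e = 0}"
  have "negligible {w. e \<bullet> w = 0}" using e by (intro negligible_hyperplane) auto
  then have H: "negligible ?H" by (simp add: inner_commute)
  show "negligible ((\<lambda>w. w + \<gamma> w *\<^sub>R e) ` ?H)"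
  proof (rule negligible_locally_Lipschitz_image[OF order_refl H])
    fix x assume x: "x \<in> ?H"
    show "\<exists>T B. open T \<and> x \<in> T \<and>
        (\<forall>y\<in>?H \<inter> T. norm ((y + \<gamma> y *\<^sub>R e) - (x + \<gamma> x *\<^sub>R e)) \<le> B * norm (y - x))"
    proof (intro exI[of _ UNIV] exI[of _ "1 + L"] conjI ballI)
      fix y assume "y \<in> ?H \<inter> UNIV"
      then have "\<bar>\<gamma> y - \<gamma> x\<bar> \<le> L * norm (y - x)" using lipschitz_onD[OF \<gamma>, of y x] x by (simp add: dist_norm)
      moreover have "(y + \<gamma> y *\<^sub>R e) - (x + \<gamma> x *\<^sub>R e) = (y - x) + (\<gamma> y - \<gamma> x) *\<^sub>R e"
        by (simp add: algebra_simps)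
      moreover have "norm ((y - x) + (\<gamma> y - \<gamma> x) *\<^sub>R e) \<le> norm (y - x) + \<bar>\<gamma> y - \<gamma> x\<bar>"
        using norm_triangle_ineq[of "y - x" "(\<gamma> y - \<gamma> x) *\<^sub>R e"] e by simp
      ultimately show "norm ((y + \<gamma> y *\<^sub>R e) - (x + \<gamma> x *\<^sub>R e)) \<le> (1 + L) * norm (y - x)"
        by (simp add: algebra_simps)
    qed auto
  qed
  show "frontier D \<inter> ball p r \<subseteq> (\<lambda>w. w + \<gamma> w *\<^sub>R e) ` ?H"
  proof
    fix x assume x: "x \<in> frontier D \<inter> ball p r"
    have "x = (x - (x \<bullet> e) *\<^sub>R e) + \<gamma> (x - (x \<bullet> e) *\<^sub>R e) *\<^sub>R e"
      using frontier_above_graph[OF assms, of x] x by simp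
    moreover have "x - (x \<bullet> e) *\<^sub>R e \<in> ?H" using e by (simp add: inner_diff_left norm_eq_1)
    ultimately show "x \<in> (\<lambda>w. w + \<gamma> w *\<^sub>R e) ` ?H" by (rule image_eqI)
  qed
qed

subsection \<open>Charts for a sequence of subgraphs\<close>

locale subgraph_sequence = interaction_kernel G f
  for G :: "'a::euclidean_space \<times> real \<Rightarrow> real" and f +
  fixes \<Omega> :: "('a \<times> real) set" and D :: "'a set" and u :: "'a \<Rightarrow> real" and us :: "nat \<Rightarrow> 'a \<Rightarrow> real"
    and \<epsilon> :: "nat \<Rightarrow> real" and M :: real
  assumes open_\<Omega>: "open \<Omega>" and open_D: "open D"
    and deriv_u: "x \<in> D \<Longrightarrow> (u has_derivative (\<lambda>z. gradient u x \<bullet> z)) (at x)"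
    and deriv_us: "x \<in> D \<Longrightarrow> (us h has_derivative (\<lambda>z. gradient (us h) x \<bullet> z)) (at x)"
    and continuous_gradient: "continuous_on D (gradient u)"
    and gradient_bound: "x \<in> D \<Longrightarrow> norm (gradient u x) \<le> M"
    and u_pos: "x \<in> D \<Longrightarrow> 0 < u x"
    and uniform_us: "uniform_limit D us u sequentially"
    and uniform_gradient: "uniform_limit D (\<lambda>h. gradient (us h)) (gradient u) sequentially"
    and \<epsilon>_pos: "0 < \<epsilon> h" and \<epsilon>_tendsto: "\<epsilon> \<longlonglongrightarrow> 0"
begin

abbreviation E0 :: "('a \<times> real) set" where "E0 \<equiv> subgraph D u"

abbreviation Es :: "nat \<Rightarrow> ('a \<times> real) set" where "Es h \<equiv> subgraph D (us h)"

lemma continuous_u: "continuous_on D u"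
  by (meson continuous_at_imp_continuous_on has_derivative_continuous deriv_u)

lemma continuous_us: "continuous_on D (us h)"
  by (meson continuous_at_imp_continuous_on has_derivative_continuous deriv_us)

text \<open>Charts ask for functions that are Borel on the whole space; the value 0 outside
  \<open>D\<close> is a dummy.\<close>

lemma measurable_zero_extension:
  assumes "continuous_on D v"
  shows "(\<lambda>x. if x \<in> D then v x else 0 :: real) \<in> borel_measurable borel"
proof -
  have "(\<lambda>x. indicat_real D x *\<^sub>R v x) \<in> borel_measurable borel"
    by (rule borel_measurable_continuous_on_indicator) (use open_D assms in auto)
  moreover have "(\<lambda>x. indicat_real D x *\<^sub>R v x) = (\<lambda>x. if x \<in> D then v x else 0)" by auto
  ultimately show ?thesis by simp
qed

lemma sets_subgraph:
  assumes "continuous_on D v"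
  shows "subgraph D v \<in> sets borel"
proof -
  define v' where "v' x = (if x \<in> D then v x else 0)" for x
  have [measurable]: "v' \<in> borel_measurable borel"
    unfolding v'_def[abs_def] by (rule measurable_zero_extension[OF assms])
  have [measurable]: "D \<in> sets borel" using open_D by simp
  have "{p \<in> space (borel \<Otimes>\<^sub>M borel). fst p \<in> D \<and> 0 \<le> snd p \<and> snd p \<le> v' (fst p)} \<in> sets (borel \<Otimes>\<^sub>M borel)"
    by measurable
  also have "{p \<in> space (borel \<Otimes>\<^sub>M borel). fst p \<in> D \<and> 0 \<le> snd p \<and> snd p \<le> v' (fst p)} = subgraph D v"
    by (auto simp: subgraph_def v'_def space_pair_measure)
  finally show ?thesis unfolding borel_prod .
qed

lemma open_over_D:
  assumes "continuous_on (D \<times> UNIV) k"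
  shows "open {p. fst p \<in> D \<and> (0::real) < k p}"
proof -
  have "open ((D \<times> UNIV) \<inter> k -` {0<..})"
    by (intro continuous_open_preimage assms open_Times open_D) auto
  moreover have "(D \<times> UNIV) \<inter> k -` {0<..} = {p. fst p \<in> D \<and> 0 < k p}" by auto
  ultimately show ?thesis by simp
qed

lemma continuous_u_fst: "continuous_on (D \<times> UNIV) (\<lambda>p. u (fst p))"
  by (rule continuous_on_compose2[OF continuous_u]) (auto intro!: continuous_intros)

lemma frontier_subgraph_over_D:
  assumes x: "x \<in> frontier E0" and "fst x \<in> D"
  shows "snd x = 0 \<or> snd x = u (fst x)"
proof (rule ccontr)
  assume no: "\<not> ?thesis"
  let ?k1 = "\<lambda>p :: 'a \<times> real. - snd p" and ?k2 = "\<lambda>p. snd p - u (fst p)" and ?k3 = "\<lambda>p. min (snd p) (u (fst p) - snd p)"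
  have o: "open {p. fst p \<in> D \<and> 0 < ?k1 p}" "open {p. fst p \<in> D \<and> 0 < ?k2 p}" "open {p. fst p \<in> D \<and> 0 < ?k3 p}"
    by (rule open_over_D; intro continuous_intros continuous_u_fst)+
  have out: "x \<notin> {p. fst p \<in> D \<and> 0 < k p}"
    if "open {p. fst p \<in> D \<and> 0 < k p}" "{p. fst p \<in> D \<and> 0 < k p} \<inter> E0 = {}" for k :: "'a \<times> real \<Rightarrow> real"
    using open_Int_closure_eq_empty[OF that(1), of E0] that(2) x by (auto simp: frontier_def)
  have "x \<notin> {p. fst p \<in> D \<and> 0 < ?k1 p}" by (rule out[OF o(1)]) (auto simp: subgraph_def)
  moreover have "x \<notin> {p. fst p \<in> D \<and> 0 < ?k2 p}" by (rule out[OF o(2)]) (auto simp: subgraph_def)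
  moreover have "x \<notin> {p. fst p \<in> D \<and> 0 < ?k3 p}"
  proof
    assume "x \<in> {p. fst p \<in> D \<and> 0 < ?k3 p}"
    moreover have "{p. fst p \<in> D \<and> 0 < ?k3 p} \<subseteq> E0" by (auto simp: subgraph_def)
    ultimately have "x \<in> interior E0" using o(3) by (rule interiorI[rotated])
    then show False using x by (simp add: frontier_def)
  qed
  ultimately show False using no \<open>fst x \<in> D\<close> by auto
qed

text \<open>Function and scale change together, so pointwise convergence of \<open>us\<close> would
  say nothing. Uniform convergence of the gradients and continuity of the limit gradient put the
  gradients of \<open>us h\<close> near \<open>w\<close> within 2 e of \<open>gradient u w\<close>,
  and the mean value inequality does the rest.\<close>

lemma difference_quotient_us:
  assumes w: "w \<in> D"
  shows "(\<lambda>h. (us h (w - \<epsilon> h *\<^sub>R z) - us h w) / \<epsilon> h) \<longlonglongrightarrow> - (gradient u w \<bullet> z)"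
proof (rule tendstoI)
  fix \<eta> :: real assume \<eta>: "\<eta> > 0"
  \<comment> \<open>norm z + 1 instead of norm z avoids division by 0 and leaves the strict
    inequality \<open>ez\<close>.\<close>
  define e where "e = \<eta> / (2 * (norm z + 1))"
  have e: "e > 0" "e + e > 0" using \<eta> by (simp_all add: e_def add_nonneg_pos)
  have ez: "(e + e) * norm z < \<eta>"
  proof -
    have "(e + e) * (norm z + 1) = \<eta>" by (simp add: e_def add_nonneg_eq_0_iff field_simps)
    moreover have "(e + e) * norm z < (e + e) * (norm z + 1)" using e by simp
    ultimately show ?thesis by simp
  qed
  obtain r1 where r1: "r1 > 0" "ball w r1 \<subseteq> D" using open_D w openE by blast
  have "continuous (at w) (gradient u)"
    using continuous_gradient open_D w continuous_on_eq_continuous_at by blast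
  then obtain r2 where r2: "r2 > 0" "\<And>v. dist v w < r2 \<Longrightarrow> dist (gradient u v) (gradient u w) < e"
    using e(1) unfolding continuous_at_eps_delta by blast
  define r where "r = min r1 r2"
  have r: "r > 0" using r1 r2 by (simp add: r_def)
  have "(\<lambda>h. w - \<epsilon> h *\<^sub>R z) \<longlonglongrightarrow> w - 0 *\<^sub>R z" by (intro tendsto_intros \<epsilon>_tendsto)
  then have "\<forall>\<^sub>F h in sequentially. w - \<epsilon> h *\<^sub>R z \<in> ball w r"
    by (rule topological_tendstoD) (use r in auto)
  moreover have "\<forall>\<^sub>F h in sequentially. \<forall>x\<in>D. dist (gradient (us h) x) (gradient u x) < e"
    by (rule uniform_limitD[OF uniform_gradient e(1)])
  ultimately show "\<forall>\<^sub>F h in sequentially.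
      dist ((us h (w - \<epsilon> h *\<^sub>R z) - us h w) / \<epsilon> h) (- (gradient u w \<bullet> z)) < \<eta>"
  proof eventually_elim
    case (elim h)
    have "\<bar>us h (w - \<epsilon> h *\<^sub>R z) - us h w - gradient u w \<bullet> (w - \<epsilon> h *\<^sub>R z - w)\<bar> \<le> (e + e) * norm (w - \<epsilon> h *\<^sub>R z - w)"
    proof (rule convex_gradient_bound[OF convex_ball])
      fix x assume x: "x \<in> ball w r"
      then have xD: "x \<in> D" using r1 by (auto simp: r_def)
      show "(us h has_derivative (\<lambda>z. gradient (us h) x \<bullet> z)) (at x)" by (rule deriv_us[OF xD])
      have "dist (gradient (us h) x) (gradient u w) \<le> dist (gradient (us h) x) (gradient u x) + dist (gradient u x) (gradient u w)"
        by (rule dist_triangle)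
      also have "\<dots> \<le> e + e"
        using elim(2) xD r2(2)[of x] x by (intro add_mono less_imp_le) (auto simp: r_def dist_commute)
      finally show "norm (gradient (us h) x - gradient u w) \<le> e + e" by (simp add: dist_norm)
    qed (use elim r in auto)
    also have "\<dots> = \<epsilon> h * ((e + e) * norm z)" using \<epsilon>_pos[of h] by simp
    also have "\<dots> < \<epsilon> h * \<eta>" using ez \<epsilon>_pos[of h] by (rule mult_strict_left_mono)
    finally have *: "\<bar>us h (w - \<epsilon> h *\<^sub>R z) - us h w + \<epsilon> h * (gradient u w \<bullet> z)\<bar> < \<epsilon> h * \<eta>" by simp
    have "(us h (w - \<epsilon> h *\<^sub>R z) - us h w) / \<epsilon> h - - (gradient u w \<bullet> z)
        = (us h (w - \<epsilon> h *\<^sub>R z) - us h w + \<epsilon> h * (gradient u w \<bullet> z)) / \<epsilon> h"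
      using \<epsilon>_pos[of h] by (simp add: add_divide_distrib)
    then have "dist ((us h (w - \<epsilon> h *\<^sub>R z) - us h w) / \<epsilon> h) (- (gradient u w \<bullet> z))
        = \<bar>us h (w - \<epsilon> h *\<^sub>R z) - us h w + \<epsilon> h * (gradient u w \<bullet> z)\<bar> / \<epsilon> h"
      unfolding dist_real_def using \<epsilon>_pos[of h] by (simp only: abs_divide abs_of_pos)
    also have "\<dots> < \<eta>" using * \<epsilon>_pos[of h] by (simp add: field_simps)
    finally show ?case .
  qed
qed

text \<open>Shared by top and bottom: the weight is the indicator of an open set containing the
  graph over \<open>D\<close>, hence eventually constant along the sample points.\<close>

lemma charted_over_D:
  assumes T: "linear_involutive_isometry T" and U: "open U"
    and g: "g \<in> borel_measurable borel" and gs: "\<And>h. gs h \<in> borel_measurable borel"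
    and inU: "\<And>w. w \<in> D \<Longrightarrow> T (w, g w) \<in> U" and lim: "\<And>w. w \<in> D \<Longrightarrow> (\<lambda>h. gs h w) \<longlonglongrightarrow> g w"
    and deriv: "\<And>w. w \<in> D \<Longrightarrow> (g has_derivative (\<lambda>z. d w \<bullet> z)) (at w)"
    and quot: "\<And>w z. w \<in> D \<Longrightarrow> (\<lambda>h. (gs h (w - \<epsilon> h *\<^sub>R z) - gs h w) / \<epsilon> h) \<longlonglongrightarrow> - (d w \<bullet> z)"
    and chart: "\<And>w. w \<in> D \<Longrightarrow> \<exists>\<delta>>0. \<forall>\<^sub>F h in sequentially. lies_below T (gs h) (ball (T (w, g w)) \<delta>) (Es h)"
    and chart0: "\<And>w. w \<in> D \<Longrightarrow> \<exists>\<delta>>0. lies_below T g (ball (T (w, g w)) \<delta>) E0"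
    and lip: "\<And>w. w \<in> D \<Longrightarrow> \<exists>\<delta>>0. \<exists>L. L-lipschitz_on (ball w \<delta>) g"
    and cover: "\<And>x. x \<in> U \<Longrightarrow> x \<in> frontier E0 \<Longrightarrow> \<exists>w\<in>D. x = T (w, g w)"
  shows "charted (indicator U) \<Omega> \<epsilon> Es E0 (reduced_boundary E0 \<inter> \<Omega>)"
proof -
  interpret linear_involutive_isometry T by (rule T)
  interpret graph_kernel T G f g by unfold_locales (rule g)
  define V where "V = {w \<in> D. \<Gamma> w \<in> \<Omega>}"
  have "charted (indicator U) \<Omega> \<epsilon> Es E0 (\<Gamma> ` V \<inter> reduced_boundary E0)"
  proof (rule chart_estimate[where gs = gs])
    have "{w \<in> V. \<exists>c. (g has_derivative (\<lambda>z. c \<bullet> z)) (at w)} = D \<inter> \<Gamma> -` \<Omega>"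
      using deriv unfolding V_def by blast
    also have "\<dots> \<in> sets borel"
      using measurable_sets[OF measurable_\<Gamma>, of \<Omega>] open_\<Omega> open_D by auto
    finally show "{w \<in> V. \<exists>c. (g has_derivative (\<lambda>z. c \<bullet> z)) (at w)} \<in> sets borel" .
    fix w assume "w \<in> V"
    then have w: "w \<in> D" by (simp add: V_def)
    show "\<exists>\<delta>>0. \<forall>\<^sub>F h in sequentially. lies_below T (gs h) (ball (\<Gamma> w) \<delta>) (Es h)"
      "\<exists>\<delta>>0. lies_below T g (ball (\<Gamma> w) \<delta>) E0" "\<exists>\<delta>>0. \<exists>L. L-lipschitz_on (ball w \<delta>) g" "(\<lambda>h. gs h w) \<longlonglongrightarrow> g w"
      using chart[OF w] chart0[OF w] lip[OF w] lim[OF w] by (simp_all add: \<Gamma>_def)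
    show "(\<lambda>h. (gs h (w - \<epsilon> h *\<^sub>R z) - gs h w) / \<epsilon> h) \<longlonglongrightarrow> - (c \<bullet> z)"
      if "(g has_derivative (\<lambda>z. c \<bullet> z)) (at w)" for z c
      using quot[OF w, of z] difference_gradient_eq[OF that] difference_gradient_eq[OF deriv[OF w]] by simp
    show "(\<lambda>h. indicator U (T (w, gs h w + \<epsilon> h * s))) \<longlonglongrightarrow> (indicator U (\<Gamma> w) :: ennreal)" for s
    proof -
      have "(\<lambda>h. (w, gs h w + \<epsilon> h * s)) \<longlonglongrightarrow> (w, g w + 0 * s)"
        by (intro tendsto_intros lim[OF w] \<epsilon>_tendsto)
      then have "(\<lambda>h. T (w, gs h w + \<epsilon> h * s)) \<longlonglongrightarrow> T (w, g w)"
        using continuous_on_tendsto_compose[OF continuous_T[of UNIV], of _ "(w, g w)" sequentially] by simp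
      from topological_tendstoD[OF this U inU[OF w]]
      have "\<forall>\<^sub>F h in sequentially. indicator U (T (w, gs h w + \<epsilon> h * s)) = (indicator U (\<Gamma> w) :: ennreal)"
        by eventually_elim (use inU[OF w] in \<open>simp add: \<Gamma>_def\<close>)
      then show ?thesis by (rule tendsto_eventually)
    qed
  next
    show "(indicator U :: _ \<Rightarrow> ennreal) \<in> borel_measurable borel" using U by simp
    show "indicator U x < (top :: ennreal)" for x by (simp add: indicator_def)
  qed (auto simp: \<epsilon>_pos \<epsilon>_tendsto open_\<Omega> gs V_def intro: sets_subgraph continuous_us)
  then show ?thesis
  proof (rule charted_subset)
    fix x assume x: "x \<in> reduced_boundary E0 \<inter> \<Omega>" and "indicator U x \<noteq> (0 :: ennreal)"
    then have "x \<in> U" "x \<in> frontier E0"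
      using is_outer_normal_imp_frontier by (auto simp: reduced_boundary_def split: split_indicator_asm)
    then obtain w where "w \<in> D" "x = \<Gamma> w" using cover unfolding \<Gamma>_def by blast
    then show "x \<in> \<Gamma> ` V \<inter> reduced_boundary E0" using x by (auto simp: V_def)
  qed
qed

lemma charted_top:
  "charted (indicator {p. fst p \<in> D \<and> u (fst p) / 2 < snd p}) \<Omega> \<epsilon> Es E0 (reduced_boundary E0 \<inter> \<Omega>)"
proof -
  \<comment> \<open>The height u / 2 separates the top from the bottom. Above it y >= 0 is
    automatic, so there each subgraph is bounded by its upper function alone.\<close>
  define U where "U = {p. fst p \<in> D \<and> u (fst p) / 2 < snd p}"
  define g where "g x = (if x \<in> D then u x else 0)" for x
  define gs where "gs h x = (if x \<in> D then us h x else 0)" for h x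
  have U: "open U"
  proof -
    have "continuous_on (D \<times> UNIV) (\<lambda>p. snd p - u (fst p) / 2)" by (intro continuous_intros continuous_u_fst) auto
    from open_over_D[OF this] show ?thesis by (simp add: U_def)
  qed
  have inU: "(w, g w) \<in> U" if "w \<in> D" for w
    using that u_pos[OF that] by (simp add: U_def g_def)
  have below: "lies_below (\<lambda>x. x) (\<lambda>x. if x \<in> D then v x else 0) B (subgraph D v)" if "B \<subseteq> U" for B v
    unfolding lies_below_def
  proof (intro allI, rule impI)
    fix x s assume "(x, s) \<in> B"
    then have "x \<in> D" "u x / 2 < s" using that by (auto simp: U_def)
    then show "(s < (if x \<in> D then v x else 0) \<longrightarrow> (x, s) \<in> subgraph D v)
        \<and> ((if x \<in> D then v x else 0) < s \<longrightarrow> (x, s) \<notin> subgraph D v)"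
      using u_pos[of x] by (simp add: subgraph_def)
  qed
  have "charted (indicator U) \<Omega> \<epsilon> Es E0 (reduced_boundary E0 \<inter> \<Omega>)"
  proof (rule charted_over_D[where g = g and gs = gs and d = "gradient u"])
    show "linear_involutive_isometry (\<lambda>x :: 'a \<times> real. x)"
      by (rule linear_involutive_isometry.intro) (simp_all add: linear_iff)
    show "g \<in> borel_measurable borel"
      unfolding g_def[abs_def] by (rule measurable_zero_extension[OF continuous_u])
    show "gs h \<in> borel_measurable borel" for h
      unfolding gs_def[abs_def] by (rule measurable_zero_extension[OF continuous_us])
    fix w assume w: "w \<in> D"
    show "(\<lambda>h. gs h w) \<longlonglongrightarrow> g w"
      using w tendsto_uniform_limitI[OF uniform_us w] by (simp add: g_def gs_def)
    show "(g has_derivative (\<lambda>z. gradient u w \<bullet> z)) (at w)"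
      by (rule has_derivative_transform_within_open[OF deriv_u[OF w] open_D w]) (simp add: g_def)
    obtain \<delta>0 where \<delta>0: "\<delta>0 > 0" "ball (w, g w) \<delta>0 \<subseteq> U" using openE[OF U inU[OF w]] .
    show "\<exists>\<delta>>0. lies_below (\<lambda>x. x) g (ball (w, g w) \<delta>) E0"
      using below[OF \<delta>0(2), of u] \<delta>0(1) unfolding g_def[symmetric] by blast
    show "\<exists>\<delta>>0. \<forall>\<^sub>F h in sequentially. lies_below (\<lambda>x. x) (gs h) (ball (w, g w) \<delta>) (Es h)"
      using below[OF \<delta>0(2), of "us h" for h] \<delta>0(1) unfolding gs_def[symmetric] by (blast intro: always_eventually)
    obtain \<delta> where \<delta>: "\<delta> > 0" "ball w \<delta> \<subseteq> D" using openE[OF open_D w] .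
    have "(max M 0)-lipschitz_on (ball w \<delta>) g"
    proof (rule lipschitz_onI)
      fix x y assume xy: "x \<in> ball w \<delta>" "y \<in> ball w \<delta>"
      have "\<bar>u x - u y - 0 \<bullet> (x - y)\<bar> \<le> max M 0 * norm (x - y)"
        by (rule convex_gradient_bound[OF convex_ball _ _ xy])
           (use subsetD[OF \<delta>(2)] deriv_u gradient_bound in \<open>auto intro: max.coboundedI1\<close>)
      then show "dist (g x) (g y) \<le> max M 0 * dist x y" using xy \<delta> by (auto simp: g_def dist_norm)
    qed simp
    then show "\<exists>\<delta>>0. \<exists>L. L-lipschitz_on (ball w \<delta>) g" using \<delta> by blast
    fix z
    have "(\<lambda>h. w - \<epsilon> h *\<^sub>R z) \<longlonglongrightarrow> w - 0 *\<^sub>R z" by (intro tendsto_intros \<epsilon>_tendsto)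
    then have "\<forall>\<^sub>F h in sequentially. w - \<epsilon> h *\<^sub>R z \<in> D"
      by (rule topological_tendstoD) (use open_D w in auto)
    then have "\<forall>\<^sub>F h in sequentially. (us h (w - \<epsilon> h *\<^sub>R z) - us h w) / \<epsilon> h = (gs h (w - \<epsilon> h *\<^sub>R z) - gs h w) / \<epsilon> h"
      by eventually_elim (simp add: gs_def w)
    with difference_quotient_us[OF w] show "(\<lambda>h. (gs h (w - \<epsilon> h *\<^sub>R z) - gs h w) / \<epsilon> h) \<longlonglongrightarrow> - (gradient u w \<bullet> z)"
      by (rule Lim_transform_eventually)
  next
    fix x assume x: "x \<in> U" "x \<in> frontier E0"
    then have "fst x \<in> D" by (simp add: U_def)
    moreover from this have "snd x = u (fst x)"
      using frontier_subgraph_over_D[OF x(2)] x(1) u_pos[of "fst x"] by (auto simp: U_def)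
    ultimately show "\<exists>w\<in>D. x = (w, g w)" by (intro bexI[of _ "fst x"]) (simp_all add: g_def prod_eq_iff)
  qed (rule U inU, assumption?)+
  then show ?thesis unfolding U_def .
qed

end

context subgraph_sequence
begin

lemma charted_bottom:
  "charted (indicator {p. fst p \<in> D \<and> snd p < u (fst p) / 2}) \<Omega> \<epsilon> Es E0 (reduced_boundary E0 \<inter> \<Omega>)"
proof -
  define U where "U = {p. fst p \<in> D \<and> snd p < u (fst p) / 2}"
  \<comment> \<open>Turned upside down, the set lies below the constant function 0 near its bottom,
    for every h.\<close>
  define T where "T x = (fst x, - snd x)" for x :: "'a \<times> real"
  have T: "T (v, s) = (v, - s)" for v s by (simp add: T_def)
  \<comment> \<open>Heights stay below u w / 4 while \<open>u\<close> stays above u w / 2, so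
    functions within u w / 4 of \<open>u\<close> still exceed these heights and only the constraint
    y >= 0 is active.\<close>
  have near: "\<exists>\<delta>>0. \<forall>v s. (v, s) \<in> ball (w, 0) \<delta> \<longrightarrow> v \<in> D \<and> u w / 2 < u v \<and> s < u w / 4" if w: "w \<in> D" for w
  proof -
    let ?k = "\<lambda>p. min (u (fst p) - u w / 2) (u w / 4 - snd p)"
    have "open {p. fst p \<in> D \<and> 0 < ?k p}"
      by (rule open_over_D, intro continuous_intros continuous_u_fst)
    moreover have "(w, 0) \<in> {p. fst p \<in> D \<and> 0 < ?k p}" using w u_pos[OF w] by simp
    ultimately obtain \<delta> where \<delta>: "\<delta> > 0" "ball (w, 0) \<delta> \<subseteq> {p. fst p \<in> D \<and> 0 < ?k p}"
      by (rule openE)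
    have "v \<in> D \<and> u w / 2 < u v \<and> s < u w / 4" if "(v, s) \<in> ball (w, 0) \<delta>" for v s
      using subsetD[OF \<delta>(2) that] by simp
    then show ?thesis using \<delta>(1) by blast
  qed
  have "charted (indicator U) \<Omega> \<epsilon> Es E0 (reduced_boundary E0 \<inter> \<Omega>)"
  proof (rule charted_over_D[where T = T and g = "\<lambda>_. 0" and gs = "\<lambda>_ _. 0" and d = "\<lambda>_. 0"])
    show "linear_involutive_isometry T"
      unfolding T_def[abs_def]
      by (rule linear_involutive_isometry.intro) (auto simp: linear_iff norm_prod_def)
    have "continuous_on (D \<times> UNIV) (\<lambda>p. u (fst p) / 2 - snd p)" by (intro continuous_intros continuous_u_fst) auto
    from open_over_D[OF this] show "open U" by (simp add: U_def)
    show "\<exists>w\<in>D. x = T (w, 0)" if x: "x \<in> U" "x \<in> frontier E0" for x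
    proof -
      have "fst x \<in> D" using x by (simp add: U_def)
      moreover from this have "snd x = 0"
        using frontier_subgraph_over_D[OF x(2)] x(1) u_pos[of "fst x"] by (auto simp: U_def)
      ultimately show ?thesis by (intro bexI[of _ "fst x"]) (simp_all add: T prod_eq_iff)
    qed
    fix w assume w: "w \<in> D"
    show "T (w, 0) \<in> U" using w u_pos[OF w] by (simp add: U_def T)
    obtain \<delta> where \<delta>: "\<delta> > 0" "\<And>v s. (v, s) \<in> ball (w, 0) \<delta> \<Longrightarrow> v \<in> D \<and> u w / 2 < u v \<and> s < u w / 4"
      using near[OF w] by blast
    have below: "lies_below T (\<lambda>_. 0) (ball (T (w, 0)) \<delta>) (subgraph D v)"
      if v: "\<forall>x\<in>D. dist (v x) (u x) < u w / 4" for v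
      unfolding lies_below_def
    proof (intro allI, rule impI)
      fix x s assume "T (x, s) \<in> ball (T (w, 0)) \<delta>"
      then have x: "x \<in> D" "u w / 2 < u x" "- s < u w / 4" using \<delta>(2)[of x "- s"] by (simp_all add: T)
      have "\<bar>v x - u x\<bar> < u w / 4" using v x(1) by (simp add: dist_real_def)
      then have "- s < v x" using x(2,3) by linarith
      then show "(s < 0 \<longrightarrow> T (x, s) \<in> subgraph D v) \<and> (0 < s \<longrightarrow> T (x, s) \<notin> subgraph D v)"
        using x(1) by (auto simp: T subgraph_def)
    qed
    have pos: "u w / 4 > 0" using u_pos[OF w] by simp
    show "\<exists>\<delta>>0. lies_below T (\<lambda>_. 0) (ball (T (w, 0)) \<delta>) E0"
      using below[of u] pos \<delta>(1) by auto
    have "\<forall>\<^sub>F h in sequentially. lies_below T (\<lambda>_. 0) (ball (T (w, 0)) \<delta>) (Es h)"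
      using uniform_limitD[OF uniform_us pos] by eventually_elim (rule below)
    then show "\<exists>\<delta>>0. \<forall>\<^sub>F h in sequentially. lies_below T (\<lambda>_. 0) (ball (T (w, 0)) \<delta>) (Es h)"
      using \<delta>(1) by blast
    have "0-lipschitz_on (ball w 1) (\<lambda>_. 0 :: real)" by (simp add: lipschitz_on_def)
    then show "\<exists>\<delta>>0. \<exists>L. L-lipschitz_on (ball w \<delta>) (\<lambda>_. 0 :: real)" by (intro exI[of _ 1]) auto
  qed simp_all
  then show ?thesis unfolding U_def .
qed

text \<open>The lateral boundary points near which all the sets are cylinders over \<open>D\<close>.\<close>

definition lateral :: "('a \<times> real) set" where
  "lateral = {x. fst x \<in> frontier D \<and> 0 < snd x \<and> (\<exists>\<delta>>0. \<forall>q\<in>D \<inter> ball (fst x) \<delta>. snd x + \<delta> < u q)}"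

text \<open>Apart from the frontier condition the definition is open: halving \<delta> leaves room
  to move x.\<close>

lemma sets_lateral: "lateral \<in> sets borel"
proof -
  define A where "A = {x. 0 < snd x \<and> (\<exists>\<delta>>0. \<forall>q\<in>D \<inter> ball (fst x) \<delta>. snd x + \<delta> < u q)}"
  have "open A"
    unfolding open_contains_ball
  proof
    fix x assume "x \<in> A"
    then obtain \<delta> where \<delta>: "0 < snd x" "\<delta> > 0" "\<And>q. q \<in> D \<Longrightarrow> dist (fst x) q < \<delta> \<Longrightarrow> snd x + \<delta> < u q"
      by (auto simp: A_def)
    show "\<exists>e>0. ball x e \<subseteq> A"
    proof (intro exI conjI subsetI)
      show "0 < min (\<delta> / 2) (snd x)" using \<delta> by simp
      fix y assume "y \<in> ball x (min (\<delta> / 2) (snd x))"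
      then have "dist x y < \<delta> / 2" "dist x y < snd x" by auto
      moreover have "dist (fst x) (fst y) \<le> dist x y" "dist (snd x) (snd y) \<le> dist x y"
        by (rule dist_fst_le, rule dist_snd_le)
      ultimately have y: "dist (fst x) (fst y) < \<delta> / 2" "\<bar>snd x - snd y\<bar> < \<delta> / 2" "0 < snd y"
        by (auto simp: dist_real_def)
      have "snd y + \<delta> / 2 < u q" if "q \<in> D" "dist (fst y) q < \<delta> / 2" for q
      proof -
        have "dist (fst x) q < \<delta>" using dist_triangle[of "fst x" q "fst y"] y that by linarith
        then show ?thesis using \<delta>(3)[OF that(1)] y(2) by linarith
      qed
      then show "y \<in> A" using y(3) \<delta>(2) by (auto simp: A_def intro!: exI[of _ "\<delta> / 2"])
    qed
  qed
  then have [measurable]: "A \<in> sets borel" by simp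
  have "fst -` frontier D \<in> sets (borel :: ('a \<times> real) measure)"
    by (rule borel_closed, rule closed_vimage) (auto intro: continuous_intros)
  moreover have "lateral = A \<inter> fst -` frontier D" by (auto simp: lateral_def A_def)
  ultimately show ?thesis by simp
qed

lemma fst_closure_subgraph: "x \<in> closure E0 \<Longrightarrow> fst x \<in> closure D"
proof -
  assume "x \<in> closure E0"
  then have "fst x \<in> fst ` closure E0" by (rule imageI)
  also have "\<dots> \<subseteq> closure (fst ` E0)"
    by (rule continuous_image_closure_subset[of UNIV]) (auto intro: continuous_intros)
  also have "\<dots> \<subseteq> closure D" by (rule closure_mono) (auto simp: subgraph_def)
  finally show "fst x \<in> closure D" .
qed

text \<open>Near \<open>lateral\<close> the sets are cylinders over \<open>D\<close>, eventually in
  h, so one function \<open>g\<close> serves the whole sequence. The weight drops to 0 on entering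
  \<open>D\<close>, where the energy belongs to top and bottom; but the sample points approach from
  outside \<open>D\<close>, where the weight is given by \<open>k\<close>, which is continuous at
  the frontier.\<close>

lemma charted_lateral:
  assumes e: "norm e = 1" and \<gamma>: "L-lipschitz_on {w. w \<bullet> e = 0} \<gamma>"
    and D: "D \<inter> ball p r = {z \<in> ball p r. \<gamma> (z - (z \<bullet> e) *\<^sub>R e) < z \<bullet> e}"
    and k[measurable]: "k \<in> borel_measurable borel" and contk: "\<And>x. x \<in> frontier D \<Longrightarrow> isCont k x"
    and k0: "\<And>x. x \<notin> ball p r \<Longrightarrow> k x = 0"
  shows "charted (\<lambda>x. ennreal (if fst x \<in> D then 0 else k (fst x))) \<Omega> \<epsilon> Es E0
    {x \<in> reduced_boundary E0 \<inter> \<Omega>. fst x \<in> frontier D \<longrightarrow> x \<in> lateral}"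
proof -
  define P where "P z = z - (z \<bullet> e) *\<^sub>R e" for z
  have ee: "e \<bullet> e = 1" using e by (simp add: norm_eq_1)
  have PP: "P (P v - c *\<^sub>R e) = P v" "(P v - c *\<^sub>R e) \<bullet> e = - c" for v c
    by (simp_all add: P_def inner_diff_left ee algebra_simps)
  note P0 = projection_along_unit(1)[OF e, folded P_def] and Pnorm = projection_along_unit(2)[OF e, folded P_def]
  have D_iff: "z \<in> D \<longleftrightarrow> \<gamma> (P z) < z \<bullet> e" if "z \<in> ball p r" for z
  proof -
    have "z \<in> D \<longleftrightarrow> z \<in> D \<inter> ball p r" using that by simp
    also have "\<dots> \<longleftrightarrow> \<gamma> (P z) < z \<bullet> e" unfolding D using that by (simp add: P_def)
    finally show ?thesis .
  qed
  \<comment> \<open>Composition with the projection makes \<gamma>, which is controlled on the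
    hyperplane only, globally Lipschitz; the sign turns the region above \<gamma> into a region
    below \<open>g\<close>.\<close>
  define g where "g v = - \<gamma> (P v)" for v
  \<comment> \<open>The last coordinate and the direction \<open>e\<close> change places, both with
    reversed sign; the component orthogonal to both is kept.\<close>
  define T where "T x = (P (fst x) - snd x *\<^sub>R e, - (fst x \<bullet> e))" for x
  have T: "T (v, s) = (P v - s *\<^sub>R e, - (v \<bullet> e))" for v s by (simp add: T_def)
  have "linear_involutive_isometry T"
  proof (rule linear_involutive_isometry.intro)
    show "linear T"
      by (rule linearI) (simp_all add: T_def P_def algebra_simps inner_add_left)
    fix x :: "'a \<times> real"
    have "T x \<bullet> T x = x \<bullet> x"
      by (simp add: T_def P_def inner_prod_def inner_diff_left inner_diff_right ee inner_commute[of e "fst x"] algebra_simps)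
    then show "norm (T x) = norm x" by (simp add: norm_eq_sqrt_inner)
    show "T (T x) = x"
      by (cases x) (simp add: T PP, simp add: P_def)
  qed
  then interpret linear_involutive_isometry T .
  have lip_g: "L-lipschitz_on UNIV g"
  proof (rule lipschitz_onI)
    fix x y
    have "dist (g x) (g y) = dist (\<gamma> (P x)) (\<gamma> (P y))" by (simp add: g_def dist_real_def)
    also have "\<dots> \<le> L * dist (P x) (P y)" by (rule lipschitz_onD[OF \<gamma>]) (simp_all add: P0)
    also have "dist (P x) (P y) = norm (P (x - y))" by (simp add: dist_norm P_def inner_diff_left algebra_simps)
    also have "L * \<dots> \<le> L * dist x y"
      using Pnorm[of "x - y"] lipschitz_on_nonneg[OF \<gamma>] by (simp add: dist_norm mult_left_mono)
    finally show "dist (g x) (g y) \<le> L * dist x y" .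
  qed (rule lipschitz_on_nonneg[OF \<gamma>])
  then have cont_g: "continuous_on UNIV g" by (rule lipschitz_on_continuous_on)
  then have g_meas: "g \<in> borel_measurable borel" by (rule borel_measurable_continuous_onI)
  then interpret graph_kernel T G f g by unfold_locales
  define \<phi> where "\<phi> x = ennreal (if fst x \<in> D then 0 else k (fst x))" for x :: "'a \<times> real"
  have \<phi>_meas: "\<phi> \<in> borel_measurable borel"
  proof -
    have [measurable]: "D \<in> sets borel" using open_D by simp
    have "(\<lambda>z. ennreal (if z \<in> D then 0 else k z)) \<in> borel_measurable borel" by measurable
    moreover have "fst \<in> borel_measurable (borel :: ('a \<times> real) measure)"
      by (intro borel_measurable_continuous_onI continuous_intros)
    ultimately show ?thesis unfolding \<phi>_def[abs_def] by (rule measurable_compose[rotated])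
  qed
  define V where "V = {w. \<Gamma> w \<in> \<Omega> \<inter> lateral \<inter> fst -` ball p r}"
  have \<Gamma>T: "\<Gamma> w = T (w, g w)" for w by (simp add: \<Gamma>_def)
  have side: "fst (T (v, s)) \<in> D \<longleftrightarrow> s < g v" if "fst (T (v, s)) \<in> ball p r" for v s
    using D_iff[OF that] by (auto simp: T PP g_def)
  have near: "\<exists>\<delta>>0. \<exists>\<eta>>0. \<forall>v s. T (v, s) \<in> ball (\<Gamma> w) \<delta> \<longrightarrow>
      fst (T (v, s)) \<in> ball p r \<and> 0 < snd (T (v, s)) \<and> (fst (T (v, s)) \<in> D \<longrightarrow> snd (T (v, s)) + \<eta> < u (fst (T (v, s))))"
    if w: "w \<in> V" for w
  proof -
    have "\<Gamma> w \<in> lateral" and p: "dist p (fst (\<Gamma> w)) < r" using w by (auto simp: V_def)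
    then obtain \<delta> where \<delta>: "\<delta> > 0" "0 < snd (\<Gamma> w)"
        "\<And>q. q \<in> D \<Longrightarrow> dist (fst (\<Gamma> w)) q < \<delta> \<Longrightarrow> snd (\<Gamma> w) + \<delta> < u q"
      by (auto simp: lateral_def)
    \<comment> \<open>The three bounds preserve, in this order, the margin below \<open>u\<close>,
      the positive height and membership in the ball around \<open>p\<close>.\<close>
    define d where "d = min (\<delta> / 2) (min (snd (\<Gamma> w)) (r - dist p (fst (\<Gamma> w))))"
    have "d > 0" using \<delta> p by (simp add: d_def)
    show ?thesis
    proof (rule exI[of _ d], rule conjI, rule \<open>d > 0\<close>, rule exI[of _ "\<delta> / 2"], rule conjI, use \<delta> in simp, intro allI, rule impI)
      fix v s assume "T (v, s) \<in> ball (\<Gamma> w) d"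
      then have "dist (\<Gamma> w) (T (v, s)) < d" by simp
      moreover have "dist (fst (\<Gamma> w)) (fst (T (v, s))) \<le> dist (\<Gamma> w) (T (v, s))" by (rule dist_fst_le)
      moreover have "dist (snd (\<Gamma> w)) (snd (T (v, s))) \<le> dist (\<Gamma> w) (T (v, s))" by (rule dist_snd_le)
      ultimately have 1: "dist (fst (\<Gamma> w)) (fst (T (v, s))) < d" "\<bar>snd (\<Gamma> w) - snd (T (v, s))\<bar> < d"
        by (auto simp: dist_real_def)
      have d: "d \<le> \<delta> / 2" "d \<le> snd (\<Gamma> w)" "d \<le> r - dist p (fst (\<Gamma> w))"
        by (simp_all only: d_def min_le_iff_disj order_refl simp_thms)
      have "dist p (fst (T (v, s))) < r"
        using dist_triangle[of p "fst (T (v, s))" "fst (\<Gamma> w)"] 1(1) d(3) by linarith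
      moreover have "0 < snd (T (v, s))" using 1(2) d(2) by linarith
      moreover have "snd (T (v, s)) + \<delta> / 2 < u (fst (T (v, s)))" if "fst (T (v, s)) \<in> D"
      proof -
        have "dist (fst (\<Gamma> w)) (fst (T (v, s))) < \<delta>" using 1(1) d(1) \<delta>(1) by linarith
        then show ?thesis using \<delta>(3)[OF that] 1(2) d(1) by linarith
      qed
      ultimately show "fst (T (v, s)) \<in> ball p r \<and> 0 < snd (T (v, s)) \<and>
          (fst (T (v, s)) \<in> D \<longrightarrow> snd (T (v, s)) + \<delta> / 2 < u (fst (T (v, s))))" by simp
    qed
  qed
  have "charted \<phi> \<Omega> \<epsilon> Es E0 (\<Gamma> ` V \<inter> reduced_boundary E0)"
  proof (rule chart_estimate[where gs = "\<lambda>_. g"])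
    have "fst -` ball p r \<in> sets (borel :: ('a \<times> real) measure)"
      by (rule borel_open, rule open_vimage) (auto intro: continuous_intros)
    then have "\<Gamma> -` (\<Omega> \<inter> lateral \<inter> fst -` ball p r) \<in> sets borel"
      using measurable_sets[OF measurable_\<Gamma>, of "\<Omega> \<inter> lateral \<inter> fst -` ball p r"] open_\<Omega> sets_lateral by auto
    moreover have "{w \<in> V. \<exists>c. (g has_derivative (\<lambda>z. c \<bullet> z)) (at w)}
        = \<Gamma> -` (\<Omega> \<inter> lateral \<inter> fst -` ball p r) \<inter> {w. \<exists>c. (g has_derivative (\<lambda>z. c \<bullet> z)) (at w)}"
      unfolding V_def by blast
    ultimately show "{w \<in> V. \<exists>c. (g has_derivative (\<lambda>z. c \<bullet> z)) (at w)} \<in> sets borel"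
      using sets_differentiability_points[OF cont_g] by simp
    show "\<phi> \<in> borel_measurable borel" by (rule \<phi>_meas)
    show "\<phi> x < top" for x by (simp add: \<phi>_def)
    show "g \<in> borel_measurable borel" by (rule g_meas)
    show "(\<lambda>h. g w) \<longlonglongrightarrow> g w" for w by simp
    fix w assume w: "w \<in> V"
    obtain \<delta> \<eta> where \<delta>: "\<delta> > 0" "\<eta> > 0" "\<And>v s. T (v, s) \<in> ball (\<Gamma> w) \<delta> \<Longrightarrow>
      fst (T (v, s)) \<in> ball p r \<and> 0 < snd (T (v, s)) \<and> (fst (T (v, s)) \<in> D \<longrightarrow> snd (T (v, s)) + \<eta> < u (fst (T (v, s))))"
      using near[OF w] by blast
    have below: "lies_below T g (ball (\<Gamma> w) \<delta>) (subgraph D v)" if v: "\<forall>x\<in>D. dist (v x) (u x) < \<eta>" for v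
      unfolding lies_below_def
    proof (intro allI, rule impI)
      fix x s assume "T (x, s) \<in> ball (\<Gamma> w) \<delta>"
      note b = \<delta>(3)[OF this]
      have "\<bar>v (fst (T (x, s))) - u (fst (T (x, s)))\<bar> < \<eta>" if "fst (T (x, s)) \<in> D"
        using v that by (simp add: dist_real_def)
      then have "T (x, s) \<in> subgraph D v \<longleftrightarrow> fst (T (x, s)) \<in> D"
        using b by (cases "T (x, s)") (auto simp: subgraph_def)
      then show "(s < g x \<longrightarrow> T (x, s) \<in> subgraph D v) \<and> (g x < s \<longrightarrow> T (x, s) \<notin> subgraph D v)"
        using side[of x s] b by auto
    qed
    show "\<exists>\<delta>>0. lies_below T g (ball (\<Gamma> w) \<delta>) E0" using below[of u] \<delta>(1,2) by auto
    have "\<forall>\<^sub>F h in sequentially. lies_below T g (ball (\<Gamma> w) \<delta>) (Es h)"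
      using uniform_limitD[OF uniform_us \<delta>(2)] by eventually_elim (rule below)
    then show "\<exists>\<delta>>0. \<forall>\<^sub>F h in sequentially. lies_below T g (ball (\<Gamma> w) \<delta>) (Es h)"
      using \<delta>(1) by blast
    have "L-lipschitz_on (ball w 1) g" by (rule lipschitz_on_subset[OF lip_g]) simp
    then show "\<exists>\<delta>>0. \<exists>L. L-lipschitz_on (ball w \<delta>) g" by (intro exI[of _ 1]) auto
    show "(\<lambda>h. (g (w - \<epsilon> h *\<^sub>R z) - g w) / \<epsilon> h) \<longlonglongrightarrow> - (c \<bullet> z)"
      if c: "(g has_derivative (\<lambda>z. c \<bullet> z)) (at w)" for z c
      using difference_quotient_tendsto[OF c \<epsilon>_pos \<epsilon>_tendsto, of "- z"] by simp
    show "(\<lambda>h. \<phi> (T (w, g w + \<epsilon> h * s))) \<longlonglongrightarrow> \<phi> (\<Gamma> w)" if "s > 0" for s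
    proof -
      have fr: "fst (\<Gamma> w) \<in> frontier D" "fst (\<Gamma> w) \<in> ball p r" using w by (auto simp: V_def lateral_def)
      have 0: "fst (\<Gamma> w) \<notin> D" using fr(1) open_D by (simp add: frontier_def interior_open)
      have "(\<lambda>h. P w - (g w + \<epsilon> h * s) *\<^sub>R e) \<longlonglongrightarrow> P w - (g w + 0 * s) *\<^sub>R e"
        by (intro tendsto_intros \<epsilon>_tendsto)
      then have lim: "(\<lambda>h. fst (T (w, g w + \<epsilon> h * s))) \<longlonglongrightarrow> fst (\<Gamma> w)" by (simp add: T \<Gamma>T)
      have "\<forall>\<^sub>F h in sequentially. fst (T (w, g w + \<epsilon> h * s)) \<in> ball p r"
        by (rule topological_tendstoD[OF lim open_ball fr(2)])
      then have ev: "\<forall>\<^sub>F h in sequentially. ennreal (k (fst (T (w, g w + \<epsilon> h * s)))) = \<phi> (T (w, g w + \<epsilon> h * s))"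
      proof eventually_elim
        case (elim h)
        have "\<not> g w + \<epsilon> h * s < g w" using that \<epsilon>_pos[of h] by (simp add: not_less)
        then have "fst (T (w, g w + \<epsilon> h * s)) \<notin> D" using side[OF elim] by simp
        then show ?case by (simp add: \<phi>_def)
      qed
      have "(\<lambda>h. ennreal (k (fst (T (w, g w + \<epsilon> h * s))))) \<longlonglongrightarrow> ennreal (k (fst (\<Gamma> w)))"
        by (intro tendsto_ennrealI isCont_tendsto_compose[OF contk[OF fr(1)] lim])
      then have "(\<lambda>h. \<phi> (T (w, g w + \<epsilon> h * s))) \<longlonglongrightarrow> ennreal (k (fst (\<Gamma> w)))"
        using ev by (rule Lim_transform_eventually)
      then show ?thesis using 0 by (simp add: \<phi>_def)
    qed
  qed (auto simp: \<epsilon>_pos \<epsilon>_tendsto open_\<Omega> V_def intro: sets_subgraph continuous_us)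
  then show ?thesis
    unfolding \<phi>_def[symmetric]
  proof (rule charted_subset)
    fix x assume "x \<in> {x \<in> reduced_boundary E0 \<inter> \<Omega>. fst x \<in> frontier D \<longrightarrow> x \<in> lateral}" and "\<phi> x \<noteq> 0"
    then have x: "x \<in> reduced_boundary E0" "x \<in> \<Omega>" "fst x \<in> frontier D \<longrightarrow> x \<in> lateral"
      and k: "fst x \<notin> D" "k (fst x) \<noteq> 0" by (auto simp: \<phi>_def split: if_splits)
    have ball: "fst x \<notin> D" "fst x \<in> ball p r" using k k0[of "fst x"] by blast+
    have "x \<in> closure E0"
      using x is_outer_normal_imp_frontier by (auto simp: reduced_boundary_def frontier_def)
    then have fr: "fst x \<in> frontier D"
      using fst_closure_subgraph ball open_D by (simp add: frontier_def interior_open)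
    obtain v s where vs: "T x = (v, s)" by (cases "T x")
    then have xT: "x = T (v, s)" by (metis T_T)
    have "\<gamma> (P (fst x)) = fst x \<bullet> e"
      using frontier_above_graph[OF e \<gamma> D open_D fr] ball by (simp add: P_def)
    then have "s = g v" by (simp add: xT T PP g_def)
    then have "x = \<Gamma> v" by (simp add: xT \<Gamma>T)
    then show "x \<in> \<Gamma> ` V \<inter> reduced_boundary E0" using x fr ball by (auto simp: V_def)
  qed
qed

text \<open>\<open>u\<close> extends continuously up to \<open>\<partial>D\<close>, and the exceptional points lie on \<open>\<partial>D \<times> {0}\<close> or on the graph
  of the extension over \<open>\<partial>D\<close>.\<close>

lemma exceptional_null:
  assumes neg: "negligible (frontier D \<inter> ball p \<rho>)" and lip: "C-lipschitz_on (D \<inter> ball p \<rho>) u"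
  shows "hausdorff_outer DIM('a) {x \<in> closure E0. fst x \<in> frontier D \<inter> ball p \<rho> \<and> x \<notin> lateral} = 0"
proof -
  define N where "N = frontier D \<inter> ball p \<rho>"
  obtain v where v: "C-lipschitz_on (closure (D \<inter> ball p \<rho>)) v" "\<And>x. x \<in> D \<inter> ball p \<rho> \<Longrightarrow> v x = u x"
    using lipschitz_extend_closure[OF lip] by blast
  have Ncl: "N \<subseteq> closure (D \<inter> ball p \<rho>)"
    using open_Int_closure_subset[OF open_ball, of p \<rho> D] by (auto simp: N_def frontier_def Int_commute)
  have v_cont: "continuous_on (closure (D \<inter> ball p \<rho>)) v" by (rule lipschitz_on_continuous_on[OF v(1)])
  have near: "\<exists>d>0. \<forall>q\<in>D. dist (fst x) q < d \<longrightarrow> q \<in> ball p \<rho> \<and> \<bar>u q - v (fst x)\<bar> < \<eta>"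
    if x: "fst x \<in> N" and "\<eta> > 0" for x :: "'a \<times> real" and \<eta>
  proof -
    obtain d1 where d1: "d1 > 0" "\<And>q. q \<in> closure (D \<inter> ball p \<rho>) \<Longrightarrow> dist q (fst x) < d1 \<Longrightarrow> dist (v q) (v (fst x)) < \<eta>"
      using v_cont Ncl x \<open>\<eta> > 0\<close> unfolding continuous_on_iff by blast
    have "fst x \<in> ball p \<rho>" using x by (simp add: N_def)
    then obtain d2 where d2: "d2 > 0" "ball (fst x) d2 \<subseteq> ball p \<rho>" by (rule openE[OF open_ball])
    show ?thesis
    proof (intro exI[of _ "min d1 d2"] conjI ballI impI)
      show "0 < min d1 d2" using d1 d2 by simp
      fix q assume q: "q \<in> D" "dist (fst x) q < min d1 d2"
      then show "q \<in> ball p \<rho>" using d2 by auto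
      then have q': "q \<in> D \<inter> ball p \<rho>" using q by simp
      then have "dist (v q) (v (fst x)) < \<eta>" using q d1(2)[OF subsetD[OF closure_subset q']] by (simp add: dist_commute)
      then show "\<bar>u q - v (fst x)\<bar> < \<eta>" using v(2)[OF q'] by (simp add: dist_real_def)
    qed
  qed
  have sub: "{x \<in> closure E0. fst x \<in> N \<and> x \<notin> lateral} \<subseteq> (\<lambda>z. (z, 0)) ` N \<union> (\<lambda>z. (z, v z)) ` N"
  proof
    fix x assume "x \<in> {x \<in> closure E0. fst x \<in> N \<and> x \<notin> lateral}"
    then have cl: "x \<in> closure E0" and N: "fst x \<in> N" and nl: "x \<notin> lateral" by auto
    have "0 \<le> snd x"
    proof (rule ccontr)
      assume "\<not> 0 \<le> snd x"
      then have "0 < - snd x" by simp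
      then obtain y where y: "y \<in> E0" "dist y x < - snd x"
        using closure_approachable[THEN iffD1, OF cl, rule_format, of "- snd x"] by blast
      have "0 \<le> snd y" using y(1) by (auto simp: subgraph_def)
      moreover have "\<bar>snd y - snd x\<bar> \<le> dist y x" using dist_snd_le[of y x] by (simp add: dist_real_def)
      ultimately show False using y(2) by linarith
    qed
    moreover have "snd x \<le> v (fst x)"
    proof (rule ccontr)
      define \<eta> where "\<eta> = (snd x - v (fst x)) / 2"
      assume "\<not> snd x \<le> v (fst x)"
      then have \<eta>: "\<eta> > 0" by (simp add: \<eta>_def)
      obtain d where d: "d > 0" "\<And>q. q \<in> D \<Longrightarrow> dist (fst x) q < d \<Longrightarrow> \<bar>u q - v (fst x)\<bar> < \<eta>"
        using near[OF N \<eta>] by blast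
      obtain y where y: "y \<in> E0" "dist y x < min d \<eta>"
        using closure_approachable[THEN iffD1, OF cl, rule_format, of "min d \<eta>"] d(1) \<eta> by auto
      have "dist (fst x) (fst y) < d" "\<bar>snd x - snd y\<bar> < \<eta>"
        using y(2) dist_fst_le[of y x] dist_snd_le[of y x] by (auto simp: dist_commute dist_real_def)
      moreover have "fst y \<in> D" "snd y \<le> u (fst y)" using y(1) by (auto simp: subgraph_def)
      moreover have "snd x = v (fst x) + \<eta> + \<eta>" by (simp add: \<eta>_def field_simps)
      ultimately show False using d(2)[of "fst y"] by linarith
    qed
    moreover have "\<not> (0 < snd x \<and> snd x < v (fst x))"
    proof
      assume b: "0 < snd x \<and> snd x < v (fst x)"
      \<comment> \<open>Half of the gap pays for the distance between \<open>u\<close> and the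
        extension \<open>v\<close>; the other half remains as the margin asked for by
        \<open>lateral\<close>.\<close>
      define \<eta> where "\<eta> = (v (fst x) - snd x) / 2"
      have \<eta>: "\<eta> > 0" using b by (simp add: \<eta>_def)
      obtain d where d: "d > 0" "\<And>q. q \<in> D \<Longrightarrow> dist (fst x) q < d \<Longrightarrow> \<bar>u q - v (fst x)\<bar> < \<eta>"
        using near[OF N \<eta>] by blast
      have "\<forall>q\<in>D \<inter> ball (fst x) (min d \<eta>). snd x + min d \<eta> < u q"
      proof
        fix q assume "q \<in> D \<inter> ball (fst x) (min d \<eta>)"
        then have "\<bar>u q - v (fst x)\<bar> < \<eta>" using d by auto
        moreover have "v (fst x) = snd x + \<eta> + \<eta>" by (simp add: \<eta>_def)
        ultimately have "snd x + \<eta> < u q" by linarith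
        then show "snd x + min d \<eta> < u q" by simp
      qed
      then have "x \<in> lateral" unfolding lateral_def using b N d(1) \<eta>
        by (auto simp: N_def intro!: exI[of _ "min d \<eta>"])
      then show False using nl by simp
    qed
    ultimately have "snd x = 0 \<or> snd x = v (fst x)" by auto
    then have "x = (fst x, 0) \<or> x = (fst x, v (fst x))" by (auto simp: prod_eq_iff)
    then show "x \<in> (\<lambda>z. (z, 0)) ` N \<union> (\<lambda>z. (z, v z)) ` N" using N by blast
  qed
  have "1-lipschitz_on N (\<lambda>z. (z, 0::real))" by (simp add: lipschitz_on_def dist_Pair_Pair)
  then have 1: "hausdorff_outer DIM('a) ((\<lambda>z. (z, 0::real)) ` N) = 0"
    using neg by (intro hausdorff_outer_lipschitz_negligible) (auto simp: N_def)
  have "(1 + C)-lipschitz_on N (\<lambda>z. (z, v z))"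
  proof (rule lipschitz_onI)
    have C: "C \<ge> 0" by (rule lipschitz_on_nonneg[OF lip])
    then show "0 \<le> 1 + C" by simp
    fix x y assume xy: "x \<in> N" "y \<in> N"
    have "dist (x, v x) (y, v y) \<le> dist x y + dist (v x) (v y)"
      unfolding dist_Pair_Pair by (rule sqrt_sum_squares_le_sum) auto
    also have "\<dots> \<le> dist x y + C * dist x y"
      using xy Ncl by (intro add_left_mono lipschitz_onD[OF v(1)]) auto
    finally show "dist (x, v x) (y, v y) \<le> (1 + C) * dist x y" by (simp add: algebra_simps)
  qed
  then have 2: "hausdorff_outer DIM('a) ((\<lambda>z. (z, v z)) ` N) = 0"
    using neg by (intro hausdorff_outer_lipschitz_negligible) (auto simp: N_def)
  have "hausdorff_outer DIM('a) {x \<in> closure E0. fst x \<in> N \<and> x \<notin> lateral}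
      \<le> hausdorff_outer DIM('a) ((\<lambda>z. (z, 0::real)) ` N \<union> (\<lambda>z. (z, v z)) ` N)"
    by (rule hausdorff_outer_mono[OF sub])
  also have "\<dots> \<le> hausdorff_outer DIM('a) ((\<lambda>z. (z, 0::real)) ` N) + hausdorff_outer DIM('a) ((\<lambda>z. (z, v z)) ` N)"
    by (rule hausdorff_outer_Un_le)
  also have "\<dots> = 0" by (simp add: 1 2)
  finally show ?thesis by (simp add: N_def)
qed

end

section \<open>Partition of unity and conclusion\<close>

text \<open>Compactness of the frontier of \<open>D\<close> leaves finitely many lateral charts. Two
  radii occur: within \<open>r p\<close> the boundary is a graph, within the possibly smaller
  \<open>\<rho> p\<close> the function \<open>u\<close> is moreover Lipschitz, as
  \<open>exceptional_null\<close> requires.\<close>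

lemma (in subgraph_sequence) liminf_F_eps_ge_F_lim:
  assumes "bounded D" and lb: "lipschitz_boundary D"
  shows "F_lim f G \<Omega> (subgraph D u) \<le> liminf (\<lambda>h. F_eps f G \<Omega> (\<epsilon> h) (subgraph D (us h)))"
proof -
  define Q where "Q p r e \<gamma> L \<rho> C \<longleftrightarrow> 0 < r \<and> norm e = 1 \<and> L-lipschitz_on {w. w \<bullet> e = 0} \<gamma> \<and>
      D \<inter> ball p r = {z \<in> ball p r. \<gamma> (z - (z \<bullet> e) *\<^sub>R e) < z \<bullet> e} \<and>
      0 < \<rho> \<and> \<rho> \<le> r \<and> C-lipschitz_on (D \<inter> ball p \<rho>) u" for p r e \<gamma> L \<rho> C
  have "\<exists>r e \<gamma> L \<rho> C. Q p r e \<gamma> L \<rho> C" if p: "p \<in> frontier D" for p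
  proof -
    obtain r e \<gamma> L where *: "r > 0" "norm e = 1" "L-lipschitz_on {w. w \<bullet> e = 0} \<gamma>"
        "D \<inter> ball p r = {z \<in> ball p r. \<gamma> (z - (z \<bullet> e) *\<^sub>R e) < z \<bullet> e}"
      using lb[unfolded lipschitz_boundary_def, rule_format, OF p] by (elim exE conjE) (rule that)
    obtain \<rho> C where "0 < \<rho>" "\<rho> \<le> r" "C-lipschitz_on (D \<inter> ball p \<rho>) u"
      by (rule lipschitz_above_graph[OF *(2,3,1,4) deriv_u gradient_bound])
    with * have "Q p r e \<gamma> L \<rho> C" unfolding Q_def by (intro conjI)
    then show ?thesis by blast
  qed
  then obtain r e \<gamma> L \<rho> C where "\<And>p. p \<in> frontier D \<Longrightarrow> Q p (r p) (e p) (\<gamma> p) (L p) (\<rho> p) (C p)"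
    by metis
  note * = this[unfolded Q_def]
  have \<rho>_pos: "0 < \<rho> p" and \<rho>_le: "\<rho> p \<le> r p" and e1: "norm (e p) = 1"
    and \<gamma>_lip: "(L p)-lipschitz_on {w. w \<bullet> e p = 0} (\<gamma> p)"
    and D_graph: "D \<inter> ball p (r p) = {z \<in> ball p (r p). \<gamma> p (z - (z \<bullet> e p) *\<^sub>R e p) < z \<bullet> e p}"
    and u_lip: "(C p)-lipschitz_on (D \<inter> ball p (\<rho> p)) u" if "p \<in> frontier D" for p
    using *[OF that] by - (elim conjE, assumption)+
  have compact: "compact (frontier D)" using \<open>bounded D\<close> by (rule compact_frontier_bounded)
  have cover: "frontier D \<subseteq> (\<Union>p\<in>frontier D. ball p (\<rho> p))"
  proof
    fix p assume "p \<in> frontier D"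
    then show "p \<in> (\<Union>p\<in>frontier D. ball p (\<rho> p))" using \<rho>_pos[of p] by (intro UN_I[of p]) auto
  qed
  obtain P where P: "P \<subseteq> frontier D" "finite P" "frontier D \<subseteq> (\<Union>p\<in>P. ball p (\<rho> p))"
    by (rule compactE_image[OF compact open_ball cover])
  \<comment> \<open>Tent functions supported in the balls of the finite cover. Where all of them
    vanish, 0 / 0 = 0 makes the normalised weights \<open>k\<close> sum to 0 instead of 1, which
    still respects the upper bound.\<close>
  define \<psi> where "\<psi> p x = max 0 (\<rho> p - dist p x)" for p x
  define k where "k p x = \<psi> p x / (\<Sum>q\<in>P. \<psi> q x)" for p x
  have \<psi>0: "\<psi> p x \<ge> 0" for p x by (simp add: \<psi>_def)
  have \<psi>_cont: "continuous_on UNIV (\<psi> p)" for p unfolding \<psi>_def by (intro continuous_intros)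
  have k0: "k p x \<ge> 0" for p x unfolding k_def by (intro divide_nonneg_nonneg sum_nonneg \<psi>0)
  have sum_pos: "(\<Sum>q\<in>P. \<psi> q x) > 0" if x: "x \<in> frontier D" for x
  proof -
    obtain p where "p \<in> P" "x \<in> ball p (\<rho> p)" using P(3) x by blast
    then show ?thesis using P(2) \<psi>0 by (intro sum_pos2[of P p]) (auto simp: \<psi>_def)
  qed
  have sum_k: "(\<Sum>p\<in>P. k p x) = (if (\<Sum>q\<in>P. \<psi> q x) = 0 then 0 else 1)" for x
    by (simp add: k_def sum_divide_distrib[symmetric])
  define Ut where "Ut = {p. fst p \<in> D \<and> u (fst p) / 2 < snd p}"
  define Ub where "Ub = {p. fst p \<in> D \<and> snd p < u (fst p) / 2}"
  define \<phi> where "\<phi> i = (case i of Inl b \<Rightarrow> indicator (if b then Ut else Ub)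
      | Inr p \<Rightarrow> (\<lambda>x. ennreal (if fst x \<in> D then 0 else k p (fst x))))" for i :: "bool + 'a"
  define I where "I = range (Inl :: bool \<Rightarrow> bool + 'a) \<union> Inr ` P"
  have sum_\<phi>: "(\<Sum>i\<in>I. \<phi> i x) = indicator Ut x + indicator Ub x
      + (if fst x \<in> D then 0 else ennreal (\<Sum>p\<in>P. k p (fst x)))" for x
  proof -
    have "(\<Sum>i\<in>I. \<phi> i x) = (\<Sum>i\<in>range Inl. \<phi> i x) + (\<Sum>i\<in>Inr ` P. \<phi> i x)"
      unfolding I_def using P(2) by (intro sum.union_disjoint) auto
    also have "(\<Sum>i\<in>range Inl. \<phi> i x) = indicator Ut x + indicator Ub x"
      by (subst sum.reindex) (auto simp: \<phi>_def UNIV_bool add.commute)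
    also have "(\<Sum>i\<in>Inr ` P. \<phi> i x) = (if fst x \<in> D then 0 else ennreal (\<Sum>p\<in>P. k p (fst x)))"
      by (subst sum.reindex) (auto simp: \<phi>_def k0)
    finally show ?thesis .
  qed
  let ?rb = "reduced_boundary E0 \<inter> \<Omega>"
  let ?S = "{x \<in> ?rb. fst x \<in> frontier D \<longrightarrow> x \<in> lateral}"
  define Zp where "Zp p = {x \<in> closure E0. fst x \<in> frontier D \<inter> ball p (\<rho> p) \<and> x \<notin> lateral}" for p
  have rb_frontier: "x \<in> frontier E0" if "x \<in> ?rb" for x
    using that is_outer_normal_imp_frontier by (auto simp: reduced_boundary_def)
  have DIM: "DIM('a \<times> real) - 1 = DIM('a)" by simp
  show ?thesis
  proof (rule F_lim_le_liminf[where I = I and \<phi> = \<phi> and S = ?S and Z = "\<Union>p\<in>P. Zp p"])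
    show "finite I" using P(2) by (simp add: I_def)
    show "Es h \<in> sets borel" for h by (rule sets_subgraph[OF continuous_us])
    have k_meas: "k p \<in> borel_measurable borel" for p
      unfolding k_def[abs_def]
      by (intro borel_measurable_divide borel_measurable_sum borel_measurable_continuous_onI \<psi>_cont)
    have Ut: "Ut \<in> sets borel" and Ub: "Ub \<in> sets borel"
    proof -
      have "continuous_on (D \<times> UNIV) (\<lambda>p. snd p - u (fst p) / 2)" by (intro continuous_intros continuous_u_fst) auto
      from open_over_D[OF this] show "Ut \<in> sets borel" by (simp add: Ut_def)
      have "continuous_on (D \<times> UNIV) (\<lambda>p. u (fst p) / 2 - snd p)" by (intro continuous_intros continuous_u_fst) auto
      from open_over_D[OF this] show "Ub \<in> sets borel" by (simp add: Ub_def)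
    qed
    have fst_meas: "fst \<in> borel_measurable (borel :: ('a \<times> real) measure)"
      by (intro borel_measurable_continuous_onI continuous_intros)
    show "\<phi> i \<in> borel_measurable borel" for i
    proof (cases i)
      case (Inr p)
      have [measurable]: "D \<in> sets borel" using open_D by simp
      have "(\<lambda>z. ennreal (if z \<in> D then 0 else k p z)) \<in> borel_measurable borel"
        using k_meas[of p] by measurable
      from measurable_compose[OF fst_meas this] show ?thesis by (simp add: \<phi>_def Inr)
    qed (use Ut Ub in \<open>simp add: \<phi>_def\<close>)
    show "(\<Sum>i\<in>I. \<phi> i x) \<le> 1" for x
    proof (cases "fst x \<in> D")
      case True
      have "\<not> (x \<in> Ut \<and> x \<in> Ub)" by (simp add: Ut_def Ub_def)
      then show ?thesis using True unfolding sum_\<phi> by (cases "x \<in> Ut"; cases "x \<in> Ub") simp_all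
    next
      case False
      then have "x \<notin> Ut" "x \<notin> Ub" by (simp_all add: Ut_def Ub_def)
      then show ?thesis using False unfolding sum_\<phi> sum_k by simp
    qed
    show "1 \<le> (\<Sum>i\<in>I. \<phi> i x)" if x: "x \<in> ?S" for x
    proof (cases "fst x \<in> D")
      case True
      then have "x \<in> Ut \<or> x \<in> Ub"
        using frontier_subgraph_over_D[OF rb_frontier True] x u_pos[OF True] by (auto simp: Ut_def Ub_def)
      then show ?thesis using True unfolding sum_\<phi> by (elim disjE) simp_all
    next
      case False
      then have "fst x \<in> frontier D"
        using rb_frontier[of x] fst_closure_subgraph[of x] x open_D by (auto simp: frontier_def interior_open)
      from sum_pos[OF this] have "(\<Sum>q\<in>P. \<psi> q (fst x)) \<noteq> 0" by simp
      then show ?thesis using False unfolding sum_\<phi> sum_k by simp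
    qed
    show "?rb \<subseteq> ?S \<union> (\<Union>p\<in>P. Zp p)"
    proof
      fix x assume x: "x \<in> ?rb"
      show "x \<in> ?S \<union> (\<Union>p\<in>P. Zp p)"
      proof (cases "fst x \<in> frontier D \<and> x \<notin> lateral")
        case True
        then obtain p where "p \<in> P" "fst x \<in> ball p (\<rho> p)" using P(3) by blast
        moreover have "x \<in> closure E0" using rb_frontier[OF x] by (simp add: frontier_def)
        ultimately show ?thesis using True by (auto simp: Zp_def)
      qed (use x in auto)
    qed
    have "Zp p \<in> null_sets (hausdorff_measure DIM('a))" if "p \<in> P" for p
    proof (rule hausdorff_null_in_null_sets)
      have p: "p \<in> frontier D" using that P(1) by auto
      have "negligible (frontier D \<inter> ball p (r p))"
        by (rule negligible_frontier_above_graph[OF e1[OF p] \<gamma>_lip[OF p] D_graph[OF p] open_D])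
      then have "negligible (frontier D \<inter> ball p (\<rho> p))"
        by (rule negligible_subset) (use \<rho>_le[OF p] in auto)
      then show "hausdorff_outer DIM('a) (Zp p) = 0"
        unfolding Zp_def by (rule exceptional_null[OF _ u_lip[OF p]])
    qed
    then have "(\<Union>p\<in>P. Zp p) \<in> null_sets (hausdorff_measure DIM('a))"
      using P(2) by (intro null_sets_UN' countable_finite) auto
    then have "hausdorff_outer DIM('a) (\<Union>p\<in>P. Zp p) = 0"
      using emeasure_hausdorff_measure[of "\<Union>p\<in>P. Zp p" "DIM('a)"] by (auto simp: null_sets_def)
    then show "hausdorff_outer (DIM('a \<times> real) - 1) (\<Union>p\<in>P. Zp p) = 0" unfolding DIM .
    fix i assume "i \<in> I"
    show "charted (\<phi> i) \<Omega> \<epsilon> Es E0 ?S"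
    proof (cases i)
      case (Inl b)
      have mono: "charted \<phi>' \<Omega> \<epsilon> Es E0 ?S" if "charted \<phi>' \<Omega> \<epsilon> Es E0 ?rb" for \<phi>'
        using that by (rule charted_subset) simp
      show ?thesis
        using mono[OF charted_top[folded Ut_def]] mono[OF charted_bottom[folded Ub_def]]
        by (cases b) (simp_all only: \<phi>_def Inl sum.case if_True if_False)
    next
      case (Inr p)
      then have "p \<in> P" using \<open>i \<in> I\<close> by (auto simp: I_def)
      then have p: "p \<in> frontier D" using P(1) by auto
      have "charted (\<lambda>x. ennreal (if fst x \<in> D then 0 else k p (fst x))) \<Omega> \<epsilon> Es E0 ?S"
      proof (rule charted_lateral[OF e1[OF p] \<gamma>_lip[OF p] D_graph[OF p] k_meas])
        show "isCont (k p) x" if "x \<in> frontier D" for x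
        proof -
          have "isCont (\<psi> q) x" for q using \<psi>_cont[of q] by (simp add: continuous_on_eq_continuous_at)
          moreover have "(\<Sum>q\<in>P. \<psi> q x) \<noteq> 0" using sum_pos[OF that] by simp
          ultimately show ?thesis unfolding k_def[abs_def] by (intro isCont_divide continuous_sum)
        qed
        show "k p x = 0" if "x \<notin> ball p (r p)" for x
          using that \<rho>_le[OF p] by (simp add: k_def \<psi>_def)
      qed
      then show ?thesis by (simp add: \<phi>_def Inr)
    qed
  qed (rule open_\<Omega> \<epsilon>_pos)+
qed

theorem theorem3p2:
  fixes \<Omega> :: "((real ^ 'n) \<times> real) set"
    and G :: "(real ^ 'n) \<times> real \<Rightarrow> real"
    and f :: "real \<Rightarrow> real"
    and D :: "(real ^ 'n) set"
    and u :: "real ^ 'n \<Rightarrow> real"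
    and u_h :: "nat \<Rightarrow> real ^ 'n \<Rightarrow> real"
    and \<epsilon> :: "nat \<Rightarrow> real"
  assumes "open \<Omega>" and "bounded \<Omega>"
    and "\<And>x. 0 \<le> G x"
    and "smooth G"
    and "closure {x. G x \<noteq> 0} = cball 0 1"
    and "\<And>x. G (- x) = G x"
    and "(LINT x|lebesgue. G x) = 1"
    and "continuous_on {0..} f"
    and "mono_on {0..} f"
    and "f 0 = 0"
    and "open D" and "bounded D" and "lipschitz_boundary D"
    and "C11_on D u" and "\<And>h. C11_on D (u_h h)"
    and "\<And>x. x \<in> D \<Longrightarrow> 0 < u x" and "\<And>h x. x \<in> D \<Longrightarrow> 0 < u_h h x"
    and "uniform_limit D u_h u sequentially"
    and "uniform_limit D (\<lambda>h. gradient (u_h h)) (gradient u) sequentially"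
    and "\<And>h. 0 < \<epsilon> h"
    and "\<epsilon> \<longlonglongrightarrow> 0"
  shows "liminf (\<lambda>h. F_eps f G \<Omega> (\<epsilon> h) (subgraph D (u_h h))) \<ge> F_lim f G \<Omega> (subgraph D u)"
proof -
  have "C_k 0 G" using \<open>smooth G\<close> unfolding smooth_def by blast
  then have G: "G \<in> borel_measurable borel" by (simp add: borel_measurable_continuous_onI)
  \<comment> \<open>A non-integrable function would have integral 0.\<close>
  have "integrable lebesgue G"
    using \<open>(LINT x|lebesgue. G x) = 1\<close> not_integrable_integral_eq[of lebesgue G] by auto
  then have G_int: "integrable lborel G" using G by (simp add: integrable_completion)
  \<comment> \<open>A Lipschitz gradient on a bounded set is bounded, which yields the constant
    \<open>M\<close>.\<close>
  obtain K where "K-lipschitz_on D (gradient u)" using \<open>C11_on D u\<close> unfolding C11_on_def by blast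
  then have "bounded (gradient u ` D)"
    using bounded_uniformly_continuous_image[OF lipschitz_on_uniformly_continuous \<open>bounded D\<close>] by blast
  then obtain M where M: "\<And>x. x \<in> D \<Longrightarrow> norm (gradient u x) \<le> M" unfolding bounded_iff by blast
  have f_nonneg: "0 \<le> f t" if "0 \<le> t" for t
    using mono_onD[OF \<open>mono_on {0..} f\<close>, of 0 t] that \<open>f 0 = 0\<close> by simp
  have deriv_u: "(u has_derivative (\<lambda>z. gradient u x \<bullet> z)) (at x)" if "x \<in> D" for x
    using assms(14) that unfolding C11_on_def by (intro gradient_derivative) blast
  have deriv_us: "(u_h h has_derivative (\<lambda>z. gradient (u_h h) x \<bullet> z)) (at x)" if "x \<in> D" for x h
    using assms(15)[of h] that unfolding C11_on_def by (intro gradient_derivative) blast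
  have cont: "continuous_on D (gradient u)" using assms(14) unfolding C11_on_def by blast
  interpret subgraph_sequence G f \<Omega> D u u_h \<epsilon> M
  proof (rule subgraph_sequence.intro)
    show "interaction_kernel G f"
      by (rule interaction_kernel.intro) (rule assms(3) G G_int assms(8) | erule f_nonneg)+
    show "subgraph_sequence_axioms \<Omega> D u u_h \<epsilon> M"
      by (rule subgraph_sequence_axioms.intro)
        (rule assms(1,11,18-21) cont | erule deriv_u deriv_us M assms(16))+
  qed
  show ?thesis by (rule liminf_F_eps_ge_F_lim[OF assms(12,13)])
qed

end
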